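(* Let $X$ be a complex Banach space, $m,r\in\mathbb N$, $n\in\mathbb N_0$, let $t_1<t_2<\dots<t_m$ be real numbers and $a_{jk}$ ($1\le j\le m$, $0\le k\le n$) complex $r\times r$ matrices such that the function $t\mapsto\det\big(\sum_{j=1}^m a_{jn}e^{i t_j t}\big)$ is not identically $0$ on $\mathbb R$. Let $\ell\in\mathbb N_0$ and let $U\subset L^1_{loc}(\mathbb R,X)$ be such that, with $U_{ub}:=U\cap C_{ub}(\mathbb R,X)$: (1) $\gamma_\omega U_{ub}\subset U$ for all $\omega\in\mathbb R$; (2) $U_{ub}*\mathcal S(\mathbb R,\mathbb C)\subset U$; (3) for each $g=(g_1,\dots,g_r)\in REC_{urc}(\mathbb R,X^r)$ the class $rec_{urc}\{g_1,\dots,g_r\}$ satisfies $(L_U)$. Let $y:\mathbb R\to X^r$ be a solution on $\mathbb R$ of $$\sum_{k=0}^n\sum_{j=1}^m a_{jk}\,y^{(k)}(t+t_j)=f(t).$$ If $f\in\mathcal M^{\ell+1}REC_{urc}(\mathbb R,X^r)$ and $y\in\mathcal M^{\ell}\big(C_{ub}(\mathbb R,X^r)\cap U^r\big)$, then $y\in\mathcal M^{\ell}\big(REC_{urc}(\mathbb R,X^r)\big)$.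
   Context: $L^1_{loc}(\mathbb R,Y)$: locally Bochner integrable functions. $C_{ub}(\mathbb R,Y)$: bounded uniformly continuous functions; $C_{urc}(\mathbb R,Y)$: uniformly continuous functions with relatively compact range. $\mathcal S(\mathbb R,\mathbb C)$: Schwartz space of rapidly decreasing functions; $*$ is convolution. $\gamma_\omega(t)=e^{i\omega t}$. $\Delta_hF(t)=F(t+h)-F(t)$. Mean classes: $M_hf(t)=\frac1h\int_0^h f(t+s)\,ds$. For a set $\mathcal A$ of functions $\mathbb R\to Y$: $\mathcal M\mathcal A=\{f\in L^1_{loc}(\mathbb R,Y): M_hf\in\mathcal A\text{ for all }h>0\}$, $\mathcal M^0\mathcal A=\mathcal A\cap L^1_{loc}(\mathbb R,Y)$, $\mathcal M^k\mathcal A=\mathcal M(\mathcal M^{k-1}\mathcal A)$. Recurrent functions: a continuous $f:\mathbb R\to Y$ ($Y$ a Banach space) is recurrent if for each compact $K\subset\mathbb R$ and $\varepsilon>0$ the set $E(f,\varepsilon,K)=\{\tau\in\mathbb R:\|f(t+\tau)-f(t)\|\le\varepsilon\ \forall t\in K\}$ is relatively dense, i.e. there is a compact $L\subset\mathbb R$ with $E(f,\varepsilon,K)+L=\mathbb R$. $REC(\mathbb R,Y)$ is the set of recurrent functions and $REC_{urc}=REC\cap C_{urc}$. The class $rec_{urc}V$: a set $W\subset REC_{urc}(\mathbb R,X)$ satisfies condition ( * ) if for all $p\in\mathbb N$ and $f_1,\dots,f_p\in W$ one has $(f_1,\dots,f_p)\in REC(\mathbb R,X^p)$. For nonempty $V\subset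 REC_{urc}(\mathbb R,X)$ satisfying ( * ), $rec_{urc}V$ denotes a (fixed) maximal element, with respect to inclusion, of $\{W\subset REC_{urc}(\mathbb R,X): V\subset W,\ W\text{ satisfies }( * )\}$ (it exists by Zorn's lemma). If $(g_1,\dots,g_r)\in REC_{urc}(\mathbb R,X^r)$, then $\{g_1,\dots,g_r\}$ satisfies ( * ). $(L_U)$: $\mathcal A$ satisfies $(L_U)$ if $F\in U$ and $\Delta_hF\in\mathcal A$ for all $h>0$ imply $F\in\mathcal A$. Solution: $y\in W^{1,n}_{loc}(\mathbb R,X^r)$ (i.e. $y\in L^1_{loc}$ if $n=0$; for $n\ge1$, $y\in C^{n-1}$ and $y^{(n-1)}$ is an indefinite Bochner integral of a function $y^{(n)}\in L^1_{loc}$) and the equation holds a.e. on $\mathbb R$; $y,f$ are column vectors. *)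

theory Defs
  imports "HOL-Analysis.Analysis"
begin

class complex_banach = banach +
  fixes scaleC :: "complex \<Rightarrow> 'a \<Rightarrow> 'a"  (infixr \<open>*\<^sub>C\<close> 75)
  assumes scaleC_add_right: "c *\<^sub>C (x + y) = c *\<^sub>C x + c *\<^sub>C y"
    and scaleC_add_left: "(c + d) *\<^sub>C x = c *\<^sub>C x + d *\<^sub>C x"
    and scaleC_scaleC: "c *\<^sub>C d *\<^sub>C x = (c * d) *\<^sub>C x"
    and scaleC_of_real: "of_real a *\<^sub>C x = a *\<^sub>R x"
    and norm_scaleC: "norm (c *\<^sub>C x) = cmod c * norm x"

instantiation complex :: complex_banach
begin

definition scaleC_complex :: "complex \<Rightarrow> complex \<Rightarrow> complex"
  where "scaleC_complex c x = c * x"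

instance
  by standard (simp_all add: scaleC_complex_def algebra_simps norm_mult scaleR_conv_of_real)

end

definition matrix_scaleC :: "complex^'r^'r \<Rightarrow> 'a::complex_banach^'r \<Rightarrow> 'a^'r"
    (infixr \<open>*v\<^sub>C\<close> 75)
  where "A *v\<^sub>C x = (\<chi> i. \<Sum>j\<in>UNIV. (A $ i $ j) *\<^sub>C (x $ j))"

text \<open>
  The Bochner integral of \<^theory>\<open>HOL-Analysis.Bochner_Integration\<close> is only available for
  second countable range spaces.  The definition below has the same form, without that restriction.
  Convergence in mean to simple functions forces a subsequence to converge almost everywhere,
  so \<open>f\<close> is strongly measurable also when its range space is not separable.
\<close>

definition has_bochner :: "'s measure \<Rightarrow> ('s \<Rightarrow> 'b::real_normed_vector) \<Rightarrow> 'b \<Rightarrow> bool"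
  where "has_bochner M f x \<longleftrightarrow>
    f \<in> borel_measurable M \<and>
    (\<exists>s. (\<forall>i::nat. Bochner_Integration.simple_bochner_integrable M (s i)) \<and>
         (\<lambda>i. \<integral>\<^sup>+u. ennreal (norm (f u - s i u)) \<partial>M) \<longlonglongrightarrow> 0 \<and>
         (\<lambda>i. Bochner_Integration.simple_bochner_integral M (s i)) \<longlonglongrightarrow> x)"

definition bochner_integrable :: "'s measure \<Rightarrow> ('s \<Rightarrow> 'b::real_normed_vector) \<Rightarrow> bool"
  where "bochner_integrable M f \<longleftrightarrow> (\<exists>x. has_bochner M f x)"

definition bochner_integral :: "'s measure \<Rightarrow> ('s \<Rightarrow> 'b::real_normed_vector) \<Rightarrow> 'b"
  where "bochner_integral M f = (THE x. has_bochner M f x)"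

definition L1loc :: "(real \<Rightarrow> 'b::banach) set"
  where "L1loc = {f. \<forall>a b. bochner_integrable (lebesgue_on {a..b}) f}"

definition C_ub :: "(real \<Rightarrow> 'b::banach) set"
  where "C_ub = {f. bounded (range f) \<and> uniformly_continuous_on UNIV f}"

definition C_urc :: "(real \<Rightarrow> 'b::banach) set"
  where "C_urc = {f. uniformly_continuous_on UNIV f \<and> compact (closure (range f))}"

text \<open>In \<open>schwartz\<close>, the function \<open>D k\<close> is the \<open>k\<close>-th derivative of \<open>\<phi>\<close>.\<close>

definition schwartz :: "(real \<Rightarrow> complex) set"
  where "schwartz = {\<phi>. \<exists>D. D 0 = \<phi> \<and>
    (\<forall>k t. (D k has_vector_derivative D (Suc k) t) (at t)) \<and>
    (\<forall>j k. bounded (range (\<lambda>t. \<bar>t\<bar> ^ j *\<^sub>R D k t)))}"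

definition convolution ::
    "(real \<Rightarrow> 'a::complex_banach) \<Rightarrow> (real \<Rightarrow> complex) \<Rightarrow> real \<Rightarrow> 'a"
  where "convolution f \<phi> t = bochner_integral lebesgue (\<lambda>s. \<phi> s *\<^sub>C f (t - s))"

definition gamma_char :: "real \<Rightarrow> real \<Rightarrow> complex"
  where "gamma_char \<omega> t = exp (\<i> * of_real (\<omega> * t))"

definition diff_shift :: "real \<Rightarrow> (real \<Rightarrow> 'b::banach) \<Rightarrow> real \<Rightarrow> 'b"
  where "diff_shift h F t = F (t + h) - F t"

definition mean :: "real \<Rightarrow> (real \<Rightarrow> 'b::banach) \<Rightarrow> real \<Rightarrow> 'b"
  where "mean h f t = (1 / h) *\<^sub>R bochner_integral (lebesgue_on {0..h}) (\<lambda>s. f (t + s))"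

definition mean_class :: "(real \<Rightarrow> 'b::banach) set \<Rightarrow> (real \<Rightarrow> 'b) set"
  where "mean_class A = {f \<in> L1loc. \<forall>h>0. mean h f \<in> A}"

primrec mean_class_pow :: "nat \<Rightarrow> (real \<Rightarrow> 'b::banach) set \<Rightarrow> (real \<Rightarrow> 'b) set"
  where
    "mean_class_pow 0 A = A \<inter> L1loc"
  | "mean_class_pow (Suc k) A = mean_class (mean_class_pow k A)"

definition componentwise :: "(real \<Rightarrow> 'a) set \<Rightarrow> (real \<Rightarrow> 'a^'r) set"
  where "componentwise U = {g. \<forall>i. (\<lambda>t. g t $ i) \<in> U}"

definition satisfies_L :: "(real \<Rightarrow> 'b::banach) set \<Rightarrow> (real \<Rightarrow> 'b) set \<Rightarrow> bool"
  where "satisfies_L U A \<longleftrightarrow> (\<forall>F\<in>U. (\<forall>h>0. diff_shift h F \<in> A) \<longrightarrow> F \<in> A)"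

definition relatively_dense :: "real set \<Rightarrow> bool"
  where "relatively_dense E \<longleftrightarrow> (\<exists>L. compact L \<and> {\<tau> + l | \<tau> l. \<tau> \<in> E \<and> l \<in> L} = UNIV)"

definition REC :: "(real \<Rightarrow> 'b::banach) set"
  where "REC = {f. continuous_on UNIV f \<and>
    (\<forall>K \<epsilon>. compact K \<and> \<epsilon> > 0 \<longrightarrow>
      relatively_dense {\<tau>. \<forall>t\<in>K. norm (f (t + \<tau>) - f t) \<le> \<epsilon>})}"

definition REC_urc :: "(real \<Rightarrow> 'b::banach) set"
  where "REC_urc = REC \<inter> C_urc"

text \<open>
  \<open>REC_tuple I f\<close> says that the tuple \<open>(f i)\<^sub>i\<^sub>\<in>\<^sub>I\<close> is a recurrent function with values in the
  power \<open>X\<^sup>I\<close> carrying the maximum norm.  It is needed where the length of the tuple is quantified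
  inside a formula and therefore cannot be a type; for a fixed finite index type it is recurrence
  in the library's \<open>X\<^sup>r\<close> (whose norm is equivalent), by lemma \<open>REC_vec_iff\<close>.
\<close>

definition REC_tuple :: "'i set \<Rightarrow> ('i \<Rightarrow> real \<Rightarrow> 'b::banach) \<Rightarrow> bool"
  where "REC_tuple I f \<longleftrightarrow>
    (\<forall>i\<in>I. continuous_on UNIV (f i)) \<and>
    (\<forall>K \<epsilon>. compact K \<and> \<epsilon> > 0 \<longrightarrow>
      relatively_dense {\<tau>. \<forall>t\<in>K. \<forall>i\<in>I. norm (f i (t + \<tau>) - f i t) \<le> \<epsilon>})"

lemma relatively_dense_mono:
  assumes "relatively_dense E" "E \<subseteq> E'"
  shows "relatively_dense E'"
proof -
  obtain L where L: "compact L" "{\<tau> + l | \<tau> l. \<tau> \<in> E \<and> l \<in> L} = UNIV"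
    using assms(1) unfolding relatively_dense_def by blast
  have "{\<tau> + l | \<tau> l. \<tau> \<in> E' \<and> l \<in> L} = UNIV"
  proof (intro equalityI subset_UNIV subsetI)
    fix x :: real
    have "x \<in> {\<tau> + l | \<tau> l. \<tau> \<in> E \<and> l \<in> L}"
      using L(2) by simp
    then show "x \<in> {\<tau> + l | \<tau> l. \<tau> \<in> E' \<and> l \<in> L}"
      using assms(2) by blast
  qed
  with L(1) show ?thesis
    unfolding relatively_dense_def by (intro exI[of _ L] conjI)
qed

lemma REC_vec_iff:
  fixes g :: "real \<Rightarrow> 'a::banach^'r"
  shows "g \<in> REC \<longleftrightarrow> REC_tuple UNIV (\<lambda>i t. g t $ i)"
proof -
  have cont: "continuous_on UNIV g \<longleftrightarrow> (\<forall>i. continuous_on UNIV (\<lambda>t. g t $ i))"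
  proof
    assume "continuous_on UNIV g"
    then show "\<forall>i. continuous_on UNIV (\<lambda>t. g t $ i)"
      by (auto intro: continuous_intros)
  next
    assume "\<forall>i. continuous_on UNIV (\<lambda>t. g t $ i)"
    then have "continuous_on UNIV (\<lambda>t. \<chi> i. g t $ i)"
      by (intro continuous_on_vec_lambda) auto
    then show "continuous_on UNIV g"
      by simp
  qed
  have 1: "{\<tau>. \<forall>t\<in>K. norm (g (t + \<tau>) - g t) \<le> \<epsilon>}
      \<subseteq> {\<tau>. \<forall>t\<in>K. \<forall>i\<in>UNIV. norm (g (t + \<tau>) $ i - g t $ i) \<le> \<epsilon>}" for K \<epsilon>
  proof clarify
    fix \<tau> t i
    assume "\<forall>t\<in>K. norm (g (t + \<tau>) - g t) \<le> \<epsilon>" "t \<in> K"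
    then have "norm (g (t + \<tau>) - g t) \<le> \<epsilon>"
      by blast
    then show "norm (g (t + \<tau>) $ i - g t $ i) \<le> \<epsilon>"
      using Finite_Cartesian_Product.norm_nth_le[of "g (t + \<tau>) - g t" i] by simp
  qed
  have 2: "{\<tau>. \<forall>t\<in>K. \<forall>i\<in>UNIV. norm (g (t + \<tau>) $ i - g t $ i) \<le> \<epsilon> / CARD('r)}
      \<subseteq> {\<tau>. \<forall>t\<in>K. norm (g (t + \<tau>) - g t) \<le> \<epsilon>}" for K \<epsilon>
  proof clarify
    fix \<tau> t
    assume *: "\<forall>t\<in>K. \<forall>i\<in>UNIV. norm (g (t + \<tau>) $ i - g t $ i) \<le> \<epsilon> / CARD('r)" and "t \<in> K"
    have "norm (g (t + \<tau>) - g t) \<le> (\<Sum>i\<in>UNIV. norm ((g (t + \<tau>) - g t) $ i))"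
      unfolding norm_vec_def by (rule L2_set_le_sum) simp
    also have "\<dots> \<le> (\<Sum>i\<in>(UNIV::'r set). \<epsilon> / CARD('r))"
      using * \<open>t \<in> K\<close> by (intro sum_mono) simp
    finally show "norm (g (t + \<tau>) - g t) \<le> \<epsilon>"
      by simp
  qed
  have 3: "relatively_dense {\<tau>. \<forall>t\<in>K. norm (g (t + \<tau>) - g t) \<le> \<epsilon>}"
    if "\<forall>K \<epsilon>. compact K \<and> \<epsilon> > 0 \<longrightarrow>
          relatively_dense {\<tau>. \<forall>t\<in>K. \<forall>i\<in>UNIV. norm (g (t + \<tau>) $ i - g t $ i) \<le> \<epsilon>}"
      and "compact K" "\<epsilon> > 0" for K \<epsilon>
  proof (rule relatively_dense_mono[OF _ 2])
    have "\<epsilon> / CARD('r) > 0"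
      using \<open>\<epsilon> > 0\<close> by simp
    with that show "relatively_dense
        {\<tau>. \<forall>t\<in>K. \<forall>i\<in>UNIV. norm (g (t + \<tau>) $ i - g t $ i) \<le> \<epsilon> / CARD('r)}"
      by blast
  qed
  have 4: "relatively_dense {\<tau>. \<forall>t\<in>K. \<forall>i\<in>UNIV. norm (g (t + \<tau>) $ i - g t $ i) \<le> \<epsilon>}"
    if "\<forall>K \<epsilon>. compact K \<and> \<epsilon> > 0 \<longrightarrow>
          relatively_dense {\<tau>. \<forall>t\<in>K. norm (g (t + \<tau>) - g t) \<le> \<epsilon>}"
      and "compact K" "\<epsilon> > 0" for K \<epsilon>
    by (rule relatively_dense_mono[OF _ 1]) (use that in blast)
  show ?thesis
  proof
    assume "g \<in> REC"
    with cont 4 show "REC_tuple UNIV (\<lambda>i t. g t $ i)"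
      by (simp add: REC_def REC_tuple_def)
  next
    assume "REC_tuple UNIV (\<lambda>i t. g t $ i)"
    with cont 3 show "g \<in> REC"
      by (simp add: REC_def REC_tuple_def)
  qed
qed

definition condition_star :: "(real \<Rightarrow> 'a::banach) set \<Rightarrow> bool"
  where "condition_star W \<longleftrightarrow>
    (\<forall>p\<ge>1. \<forall>f :: nat \<Rightarrow> real \<Rightarrow> 'a. (\<forall>i\<in>{1..p}. f i \<in> W) \<longrightarrow> REC_tuple {1..p} f)"

definition star_extensions :: "(real \<Rightarrow> 'a::banach) set \<Rightarrow> (real \<Rightarrow> 'a) set set"
  where "star_extensions V = {W. W \<subseteq> REC_urc \<and> V \<subseteq> W \<and> condition_star W}"

text \<open>
  A selection of one maximal element \<open>rec_urc V\<close> for each admissible \<open>V\<close>; outside the admissible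
  sets the value is irrelevant.
\<close>

definition rec_urc_selection :: "((real \<Rightarrow> 'a::banach) set \<Rightarrow> (real \<Rightarrow> 'a) set) \<Rightarrow> bool"
  where "rec_urc_selection rec_urc \<longleftrightarrow>
    (\<forall>V. V \<noteq> {} \<and> V \<subseteq> REC_urc \<and> condition_star V \<longrightarrow>
      rec_urc V \<in> star_extensions V \<and>
      (\<forall>W\<in>star_extensions V. rec_urc V \<subseteq> W \<longrightarrow> W = rec_urc V))"

text \<open>
  \<open>W1loc_derivs n y D\<close>: the function \<open>y\<close> is in \<open>W\<^sup>1\<^sup>,\<^sup>n\<^sub>l\<^sub>o\<^sub>c\<close> and \<open>D k\<close> is its \<open>k\<close>-th derivative for
  \<open>k \<le> n\<close>.  The top derivative \<open>D n\<close> is determined only almost everywhere (if \<open>n \<ge> 1\<close>).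
\<close>

definition W1loc_derivs :: "nat \<Rightarrow> (real \<Rightarrow> 'b::banach) \<Rightarrow> (nat \<Rightarrow> real \<Rightarrow> 'b) \<Rightarrow> bool"
  where "W1loc_derivs n y D \<longleftrightarrow>
    D 0 = y \<and> D n \<in> L1loc \<and>
    (n \<ge> 1 \<longrightarrow>
      (\<forall>k<n - 1. \<forall>t. (D k has_vector_derivative D (Suc k) t) (at t)) \<and>
      continuous_on UNIV (D (n - 1)) \<and>
      (\<forall>a b. a \<le> b \<longrightarrow> has_bochner (lebesgue_on {a..b}) (D n) (D (n - 1) b - D (n - 1) a)))"

definition is_solution ::
    "nat \<Rightarrow> nat \<Rightarrow> (nat \<Rightarrow> real) \<Rightarrow> (nat \<Rightarrow> nat \<Rightarrow> complex^'r^'r) \<Rightarrow>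
     (real \<Rightarrow> 'a::complex_banach^'r) \<Rightarrow> (real \<Rightarrow> 'a^'r) \<Rightarrow> bool"
  where "is_solution m n t a f y \<longleftrightarrow>
    (\<exists>D. W1loc_derivs n y D \<and>
      (AE s in lebesgue. (\<Sum>k=0..n. \<Sum>j=1..m. a j k *v\<^sub>C D k (s + t j)) = f s))"

end

theory Submission
  imports Defs "HOL-Complex_Analysis.Conformal_Mappings"
begin

text \<open>
  Means commute with the equation, so an induction on \<open>l\<close> reduces the theorem to \<open>l = 0\<close>,
  where \<open>y\<close> is bounded and uniformly continuous and \<open>g = mean 1 f\<close> is recurrent with
  relatively compact range.  Let \<open>A\<close> be the selected maximal family that contains the
  components of \<open>g\<close>.  Finitely many members of \<open>A\<close> are jointly recurrent, so it is enough
  that the components of \<open>y\<close> belong to \<open>A\<close> (\<open>REC_urc_componentwise\<close>).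

  Maximality makes \<open>A\<close> large: a function in \<open>C_urc\<close> belongs to \<open>A\<close> as soon as it almost
  returns whenever some finitely many members of \<open>A\<close> and some finitely many characters
  \<open>gamma_char \<omega>\<close> do (\<open>maximal_star_mem\<close>).  Characters may be included because recurrence is
  never destroyed by adjoining a rotation of the circle (\<open>return_chain_inter_char\<close>).
  Consequently \<open>A\<close> is a uniformly closed complex vector space, invariant under translations
  and under multiplication by characters, and therefore under convolution with kernels of
  quadratic decay.

  The derivatives of \<open>y\<close> need not be bounded.  A unit mean turns a derivative into a
  difference, so after \<open>n + 1\<close> unit means the equation involves only means and differences
  of \<open>y\<close> (\<open>averaged_equation\<close>).  Convolution with a kernel \<open>FT \<psi>\<close>, where \<open>\<psi>\<close> is smooth with
  compact support, replaces these operations by multiplication of \<open>\<psi>\<close> with the matrix \<open>Q =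
  symbol m n t a\<close> of entire functions, and the cofactors of \<open>Q\<close> separate the unknowns: the
  convolution of each component of \<open>y\<close> with \<open>FT (det Q \<cdot> \<psi>)\<close> lies in \<open>A\<close> for every \<open>\<psi>\<close>
  (\<open>det_convolution\<close>).

  The entire function \<open>det Q\<close> is not identically zero (\<open>det_symbol_nonzero\<close>): at large real
  frequencies the leading coefficients dominate, and they are almost periodic, so a nonzero
  value of their determinant is nearly attained again arbitrarily far out.  Hence \<open>det Q\<close>
  has finitely many zeros in an interval that contains the support of \<open>\<psi>\<close>.  A factor without
  zeros there can be absorbed into \<open>\<psi>\<close>.  A factor vanishing at the real point \<open>\<omega>\<close> is removed
  by the property \<open>(L\<^sub>U)\<close> of \<open>A\<close>: multiplication by \<open>gamma_char (- \<omega>)\<close> moves the zero to the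
  frequency \<open>0\<close>, where taking differences produces it (\<open>remove_zero_step\<close>).  Thus \<open>A\<close>
  contains the convolution of each component of \<open>y\<close> with every kernel \<open>FT \<psi>\<close>.  Some such
  kernel has a nonzero integral, and rescaling it gives an approximate identity; as \<open>A\<close> is
  closed, the components of \<open>y\<close> are in \<open>A\<close> (\<open>scalar_regularity\<close>).
\<close>

section \<open>Return times and characters\<close>

lemma norm_gamma_char [simp]: "cmod (gamma_char \<omega> s) = 1"
  by (simp add: gamma_char_def)

lemma gamma_char_add: "gamma_char \<omega> (s + t) = gamma_char \<omega> s * gamma_char \<omega> t"
  by (simp add: gamma_char_def exp_add[symmetric] algebra_simps)

definition returns :: "(real \<Rightarrow> 'b::banach) set \<Rightarrow> real set \<Rightarrow> real \<Rightarrow> real set"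
  where "returns F K e = {\<tau>. \<forall>t\<in>K. \<forall>f\<in>F. norm (f (t + \<tau>) - f t) \<le> e}"

definition char_returns :: "real set \<Rightarrow> real \<Rightarrow> real set"
  where "char_returns \<Omega> e = {\<tau>. \<forall>\<omega>\<in>\<Omega>. cmod (gamma_char \<omega> \<tau> - 1) \<le> e}"

text \<open>
  The third condition says that returns compose: a precise return \<open>\<sigma>\<close> may be followed by any return
  \<open>\<tau>\<close> that is precise enough in terms of \<open>\<sigma>\<close>.
\<close>
definition return_chain :: "(nat \<Rightarrow> real set) \<Rightarrow> bool"
  where "return_chain R \<longleftrightarrow> decseq R \<and> (\<forall>n. relatively_dense (R n)) \<and>
    (\<forall>n. \<exists>m. \<forall>\<sigma>\<in>R m. \<exists>m'. \<forall>\<tau>\<in>R m'. \<sigma> + \<tau> \<in> R n)"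

lemma relatively_dense_finite_shifts:
  assumes "relatively_dense E" "finite S" "\<And>\<tau>. \<tau> \<in> E \<Longrightarrow> \<exists>\<sigma>\<in>S. \<sigma> + \<tau> \<in> E'"
  shows "relatively_dense E'"
proof -
  obtain L where L: "compact L" "{\<tau> + l | \<tau> l. \<tau> \<in> E \<and> l \<in> L} = UNIV"
    using assms(1) unfolding relatively_dense_def by blast
  let ?L = "{l - \<sigma> | l \<sigma>. l \<in> L \<and> \<sigma> \<in> S}"
  have "compact ?L"
    using compact_differences[OF L(1) finite_imp_compact[OF assms(2)]] .
  moreover have "x \<in> {\<tau> + l | \<tau> l. \<tau> \<in> E' \<and> l \<in> ?L}" for x
  proof -
    have "x \<in> {\<tau> + l | \<tau> l. \<tau> \<in> E \<and> l \<in> L}"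
      using L(2) by simp
    then obtain \<tau> l where 1: "x = \<tau> + l" "\<tau> \<in> E" "l \<in> L"
      by (elim CollectE exE conjE)
    obtain \<sigma> where 2: "\<sigma> \<in> S" "\<sigma> + \<tau> \<in> E'"
      using assms(3) 1(2) by blast
    have "x = (\<sigma> + \<tau>) + (l - \<sigma>)"
      using 1 by simp
    moreover have "l - \<sigma> \<in> ?L"
      using 1(3) 2(1) by blast
    ultimately show ?thesis
      using 2(2) by (rule_tac CollectI, rule_tac exI[of _ "\<sigma> + \<tau>"], rule_tac exI[of _ "l - \<sigma>"]) (intro conjI)
  qed
  ultimately show ?thesis
    unfolding relatively_dense_def by (intro exI[of _ ?L] conjI) auto
qed

text \<open>
  Let \<open>Z\<close> be the set of limits of the character along ever more precise returns.  As returns compose,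
  \<open>Z\<close> is a compact subsemigroup of the circle, so each \<open>z \<in> Z\<close> has an inverse in \<open>Z\<close> up to an
  arbitrarily small error.  Hence a precise return \<open>\<tau>\<close>, at which the character is close to some
  \<open>z \<in> Z\<close>, can be followed by a return \<open>\<sigma>\<close> that brings the character back to \<open>1\<close>; by compactness
  finitely many \<open>\<sigma>\<close> suffice, and a set is relatively dense if finitely many of its shifts together
  cover a relatively dense set.
\<close>
lemma return_chain_inter_char:
  assumes R: "return_chain R"
  shows "return_chain (\<lambda>n. R n \<inter> {\<tau>. cmod (gamma_char \<omega> \<tau> - 1) \<le> 1 / (real n + 1)})"
proof -
  define e where "e = gamma_char \<omega>"
  define Z where "Z = {z. \<forall>n. \<forall>d>0. \<exists>\<tau>\<in>R n. cmod (e \<tau> - z) < d}"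
  have e_add: "e (s + t) = e s * e t" and e_norm [simp]: "cmod (e s) = 1" for s t
    by (simp_all add: e_def gamma_char_add)
  have dec: "R n \<subseteq> R m" if "m \<le> n" for m n
    using R that unfolding return_chain_def decseq_def by blast
  have comp: "\<exists>m. \<forall>\<sigma>\<in>R m. \<exists>m'. \<forall>\<tau>\<in>R m'. \<sigma> + \<tau> \<in> R n" for n
    using R unfolding return_chain_def by blast
  have dense: "relatively_dense (R n)" for n
    using R unfolding return_chain_def by blast
  have lim: "\<exists>z\<in>Z. \<exists>r. strict_mono r \<and> (\<lambda>k. e (\<tau> (r k))) \<longlonglongrightarrow> z"
    if \<tau>: "\<And>n. \<tau> n \<in> R n" for \<tau> :: "nat \<Rightarrow> real"
  proof -
    have "\<forall>n. e (\<tau> n) \<in> sphere 0 1"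
      by simp
    then obtain z r where zr: "strict_mono r" "((\<lambda>n. e (\<tau> n)) \<circ> r) \<longlonglongrightarrow> z"
      using compact_sphere[of "0::complex" 1] unfolding compact_def by metis
    have "z \<in> Z"
      unfolding Z_def
    proof (intro CollectI allI impI)
      fix n and d :: real
      assume "d > 0"
      with zr(2) obtain k0 where k0: "\<And>k. k \<ge> k0 \<Longrightarrow> cmod (e (\<tau> (r k)) - z) < d"
        by (auto simp: lim_sequentially dist_norm)
      have "n \<le> r (max k0 n)"
        using strict_mono_imp_increasing[OF zr(1), of "max k0 n"] by linarith
      then have "\<tau> (r (max k0 n)) \<in> R n"
        using \<tau> dec by blast
      with k0[of "max k0 n"] show "\<exists>\<tau>\<in>R n. cmod (e \<tau> - z) < d"
        by auto
    qed
    with zr show ?thesis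
      by (auto simp: o_def)
  qed
  have norm_Z: "cmod z = 1" if "z \<in> Z" for z
  proof (rule ccontr)
    assume "cmod z \<noteq> 1"
    then have "\<bar>cmod z - 1\<bar> > 0"
      by simp
    with that obtain \<tau> where "cmod (e \<tau> - z) < \<bar>cmod z - 1\<bar>"
      unfolding Z_def by blast
    with norm_triangle_ineq3[of "e \<tau>" z] show False
      by simp
  qed
  have "closed Z"
    unfolding closure_subset_eq[symmetric]
  proof
    fix z assume "z \<in> closure Z"
    then have z: "\<forall>d>0. \<exists>w\<in>Z. dist w z < d"
      by (simp add: closure_approachable)
    show "z \<in> Z"
      unfolding Z_def
    proof (intro CollectI allI impI)
      fix n and d :: real
      assume "d > 0"
      then obtain w where w: "w \<in> Z" "dist w z < d / 2"
        using z half_gt_zero by blast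
      moreover obtain \<tau> where "\<tau> \<in> R n" "cmod (e \<tau> - w) < d / 2"
        using w(1) \<open>d > 0\<close> half_gt_zero unfolding Z_def by blast
      ultimately show "\<exists>\<tau>\<in>R n. cmod (e \<tau> - z) < d"
        by (metis dist_norm dist_triangle_half_l dist_commute)
    qed
  qed
  then have compact_Z: "compact Z"
    unfolding compact_eq_bounded_closed using norm_Z
    by (auto simp: bounded_iff intro!: exI[of _ 1])
  have mult_Z: "z * w \<in> Z" if zw: "z \<in> Z" "w \<in> Z" for z w
    unfolding Z_def
  proof (intro CollectI allI impI)
    fix n and d :: real
    assume "d > 0"
    then have "d / 2 > 0" by simp
    obtain m where m: "\<forall>\<sigma>\<in>R m. \<exists>m'. \<forall>\<tau>\<in>R m'. \<sigma> + \<tau> \<in> R n"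
      using comp by blast
    obtain \<sigma> where \<sigma>: "\<sigma> \<in> R m" "cmod (e \<sigma> - z) < d / 2"
      using zw(1) \<open>d / 2 > 0\<close> unfolding Z_def by blast
    obtain m' where m': "\<forall>\<tau>\<in>R m'. \<sigma> + \<tau> \<in> R n"
      using m \<sigma>(1) by blast
    obtain \<tau> where \<tau>: "\<tau> \<in> R m'" "cmod (e \<tau> - w) < d / 2"
      using zw(2) \<open>d / 2 > 0\<close> unfolding Z_def by blast
    have "e (\<sigma> + \<tau>) - z * w = (e \<sigma> - z) * e \<tau> + z * (e \<tau> - w)"
      by (simp add: e_add algebra_simps)
    then have "cmod (e (\<sigma> + \<tau>) - z * w) \<le> cmod (e \<sigma> - z) + cmod (e \<tau> - w)"
      using norm_triangle_ineq[of "(e \<sigma> - z) * e \<tau>" "z * (e \<tau> - w)"] norm_Z[OF zw(1)]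
      by (simp add: norm_mult)
    with \<sigma> \<tau> have "cmod (e (\<sigma> + \<tau>) - z * w) < d"
      by linarith
    with m' \<tau>(1) show "\<exists>\<tau>\<in>R n. cmod (e \<tau> - z * w) < d"
      by blast
  qed
  have power_Z: "z ^ Suc k \<in> Z" if "z \<in> Z" for z k
    by (induction k) (use that mult_Z in auto)
  have inverse_Z: "\<exists>w\<in>Z. cmod (z * w - 1) < d" if z: "z \<in> Z" and d: "d > 0" for z d
  proof -
    have "\<forall>k. z ^ Suc k \<in> Z"
      using power_Z[OF z] by blast
    then obtain x r where r: "strict_mono r" "((\<lambda>k. z ^ Suc k) \<circ> r) \<longlonglongrightarrow> x"
      using compact_Z unfolding compact_def by metis
    then have "Cauchy ((\<lambda>k. z ^ Suc k) \<circ> r)"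
      using LIMSEQ_imp_Cauchy by blast
    then obtain i where i: "\<And>j. j \<ge> i \<Longrightarrow> cmod (z ^ Suc (r j) - z ^ Suc (r i)) < d"
      using d unfolding Cauchy_def dist_norm o_def by blast
    \<comment> \<open>exponents that differ by at least 2 leave a positive power of \<open>z\<close> as the almost inverse\<close>
    have "r i < r (Suc i)" "r (Suc i) < r (Suc (Suc i))"
      using r(1) by (auto simp: strict_mono_def)
    then have q: "r (Suc (Suc i)) = r i + Suc (Suc (r (Suc (Suc i)) - r i - 2))" (is "_ = r i + Suc (Suc ?q)")
      by linarith
    then have "z ^ Suc (r (Suc (Suc i))) = z ^ Suc (r i) * (z * z ^ Suc ?q)"
      by (metis power_add power_Suc add_Suc mult.assoc mult.left_commute)
    then have "z ^ Suc (r (Suc (Suc i))) - z ^ Suc (r i) = z ^ Suc (r i) * (z * z ^ Suc ?q - 1)"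
      by (simp only: right_diff_distrib mult_1_right)
    then have "cmod (z * z ^ Suc ?q - 1) < d"
      using i[of "Suc (Suc i)"] norm_Z[OF z] by (simp add: norm_mult norm_power)
    with power_Z[OF z] show ?thesis
      by blast
  qed
  have main: "relatively_dense (R n \<inter> {\<tau>. cmod (e \<tau> - 1) \<le> 1 / (real n + 1)})" for n
  proof -
    define d where "d = 1 / (real n + 1)"
    have "d > 0" by (simp add: d_def)
    obtain m where m: "\<forall>\<sigma>\<in>R m. \<exists>m'. \<forall>\<tau>\<in>R m'. \<sigma> + \<tau> \<in> R n"
      using comp by blast
    define B where "B \<sigma> = {w. cmod (w * e \<sigma> - 1) < d}" for \<sigma>
    have open_B: "open (B \<sigma>)" for \<sigma>
      unfolding B_def by (intro open_Collect_less continuous_intros)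
    have "\<exists>\<sigma>\<in>R m. z \<in> B \<sigma>" if z: "z \<in> Z" for z
    proof -
      obtain w where w: "w \<in> Z" "cmod (z * w - 1) < d / 2"
        using inverse_Z[OF z, of "d / 2"] \<open>d > 0\<close> by auto
      obtain \<sigma> where \<sigma>: "\<sigma> \<in> R m" "cmod (e \<sigma> - w) < d / 2"
        using w(1) \<open>d > 0\<close> half_gt_zero unfolding Z_def by blast
      have "z * e \<sigma> - 1 = z * (e \<sigma> - w) + (z * w - 1)"
        by (simp add: algebra_simps)
      moreover have "cmod (z * (e \<sigma> - w) + (z * w - 1)) \<le> cmod (e \<sigma> - w) + cmod (z * w - 1)"
        using norm_triangle_ineq[of "z * (e \<sigma> - w)" "z * w - 1"] norm_Z[OF z]
        by (simp only: norm_mult mult_1_left)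
      ultimately have "cmod (z * e \<sigma> - 1) \<le> cmod (e \<sigma> - w) + cmod (z * w - 1)"
        by (simp only:)
      with w \<sigma> show ?thesis
        unfolding B_def by force
    qed
    then have "Z \<subseteq> (\<Union>\<sigma>\<in>R m. B \<sigma>)"
      by blast
    then obtain S where S: "S \<subseteq> R m" "finite S" "Z \<subseteq> (\<Union>\<sigma>\<in>S. B \<sigma>)"
      using compactE_image[OF compact_Z, of "R m" B] open_B by blast
    have "\<exists>M. \<forall>\<tau>\<in>R M. e \<tau> \<in> (\<Union>\<sigma>\<in>S. B \<sigma>)"
    proof (rule ccontr)
      assume "\<nexists>M. \<forall>\<tau>\<in>R M. e \<tau> \<in> (\<Union>\<sigma>\<in>S. B \<sigma>)"
      then obtain \<tau> where \<tau>: "\<And>M. \<tau> M \<in> R M" "\<And>M. e (\<tau> M) \<in> - (\<Union>\<sigma>\<in>S. B \<sigma>)"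
        by (metis ComplI)
      obtain z r where z: "z \<in> Z" "(\<lambda>k. e (\<tau> (r k))) \<longlonglongrightarrow> z"
        using lim[OF \<tau>(1)] by blast
      have "closed (- (\<Union>\<sigma>\<in>S. B \<sigma>))"
        by (simp add: closed_def open_B open_UN)
      then have "z \<in> - (\<Union>\<sigma>\<in>S. B \<sigma>)"
        using closed_sequentially[OF _ _ z(2)] \<tau>(2) by blast
      with S z show False
        by blast
    qed
    then obtain M where M: "\<And>\<tau>. \<tau> \<in> R M \<Longrightarrow> e \<tau> \<in> (\<Union>\<sigma>\<in>S. B \<sigma>)"
      by blast
    obtain m' where m': "\<And>\<sigma> \<tau>. \<sigma> \<in> S \<Longrightarrow> \<tau> \<in> R (m' \<sigma>) \<Longrightarrow> \<sigma> + \<tau> \<in> R n"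
      using m S(1) by (metis subsetD)
    define N where "N = Max (insert M (m' ` S))"
    have N: "M \<le> N" "\<And>\<sigma>. \<sigma> \<in> S \<Longrightarrow> m' \<sigma> \<le> N"
      using S(2) by (auto simp: N_def)
    show ?thesis
    proof (rule relatively_dense_finite_shifts[OF dense[of N] S(2)])
      fix \<tau> assume \<tau>: "\<tau> \<in> R N"
      then obtain \<sigma> where \<sigma>: "\<sigma> \<in> S" "e \<tau> \<in> B \<sigma>"
        using M dec[OF N(1)] by blast
      then have "cmod (e (\<sigma> + \<tau>) - 1) \<le> d"
        by (simp add: B_def e_add mult.commute)
      moreover have "\<sigma> + \<tau> \<in> R n"
        using m'[OF \<sigma>(1)] dec[OF N(2)[OF \<sigma>(1)]] \<tau> by blast
      ultimately show "\<exists>\<sigma>\<in>S. \<sigma> + \<tau> \<in> R n \<inter> {\<tau>. cmod (e \<tau> - 1) \<le> 1 / (real n + 1)}"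
        using \<sigma>(1) unfolding d_def by blast
    qed
  qed
  show ?thesis
    unfolding return_chain_def e_def[symmetric]
  proof (intro conjI allI)
    show "decseq (\<lambda>n. R n \<inter> {\<tau>. cmod (e \<tau> - 1) \<le> 1 / (real n + 1)})"
    proof (rule decseq_SucI)
      fix n
      have "1 / (real (Suc n) + 1) \<le> 1 / (real n + 1)"
        by (simp add: frac_le)
      with dec[of n "Suc n"]
      show "R (Suc n) \<inter> {\<tau>. cmod (e \<tau> - 1) \<le> 1 / (real (Suc n) + 1)}
          \<le> R n \<inter> {\<tau>. cmod (e \<tau> - 1) \<le> 1 / (real n + 1)}"
        by fastforce
    qed
  next
    fix n
    show "relatively_dense (R n \<inter> {\<tau>. cmod (e \<tau> - 1) \<le> 1 / (real n + 1)})"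
      by (rule main)
  next
    fix n
    obtain m where m: "\<forall>\<sigma>\<in>R m. \<exists>m'. \<forall>\<tau>\<in>R m'. \<sigma> + \<tau> \<in> R n"
      using comp by blast
    \<comment> \<open>from index \<open>2 * n + 1\<close> on, two errors add up to at most \<open>1 / (n + 1)\<close>\<close>
    let ?m = "max m (2 * n + 1)"
    have half: "1 / (real k + 1) \<le> 1 / (real n + 1) / 2" if "2 * n + 1 \<le> k" for k
      using that by (simp add: field_simps)
    show "\<exists>m. \<forall>\<sigma>\<in>R m \<inter> {\<tau>. cmod (e \<tau> - 1) \<le> 1 / (real m + 1)}.
        \<exists>m'. \<forall>\<tau>\<in>R m' \<inter> {\<tau>. cmod (e \<tau> - 1) \<le> 1 / (real m' + 1)}.
          \<sigma> + \<tau> \<in> R n \<inter> {\<tau>. cmod (e \<tau> - 1) \<le> 1 / (real n + 1)}"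
    proof (rule exI[of _ ?m], rule ballI)
      fix \<sigma> assume \<sigma>: "\<sigma> \<in> R ?m \<inter> {\<tau>. cmod (e \<tau> - 1) \<le> 1 / (real ?m + 1)}"
      then have "\<sigma> \<in> R m"
        using dec[of m ?m] by auto
      then obtain m' where m': "\<forall>\<tau>\<in>R m'. \<sigma> + \<tau> \<in> R n"
        using m by blast
      let ?m' = "max m' (2 * n + 1)"
      show "\<exists>m'. \<forall>\<tau>\<in>R m' \<inter> {\<tau>. cmod (e \<tau> - 1) \<le> 1 / (real m' + 1)}.
          \<sigma> + \<tau> \<in> R n \<inter> {\<tau>. cmod (e \<tau> - 1) \<le> 1 / (real n + 1)}"
      proof (rule exI[of _ ?m'], rule ballI)
        fix \<tau> assume \<tau>: "\<tau> \<in> R ?m' \<inter> {\<tau>. cmod (e \<tau> - 1) \<le> 1 / (real ?m' + 1)}"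
        have "e (\<sigma> + \<tau>) - 1 = (e \<sigma> - 1) * e \<tau> + (e \<tau> - 1)"
          by (simp add: e_add algebra_simps)
        moreover have "cmod ((e \<sigma> - 1) * e \<tau> + (e \<tau> - 1)) \<le> cmod (e \<sigma> - 1) + cmod (e \<tau> - 1)"
          using norm_triangle_ineq[of "(e \<sigma> - 1) * e \<tau>" "e \<tau> - 1"]
          by (simp only: norm_mult e_norm mult_1_right)
        ultimately have "cmod (e (\<sigma> + \<tau>) - 1) \<le> cmod (e \<sigma> - 1) + cmod (e \<tau> - 1)"
          by (simp only:)
        also have "\<dots> \<le> 1 / (real n + 1) / 2 + 1 / (real n + 1) / 2"
        proof (rule add_mono)
          show "cmod (e \<sigma> - 1) \<le> 1 / (real n + 1) / 2"
            using \<sigma> half[of ?m] by (simp only: Int_iff mem_Collect_eq) (meson max.cobounded2 order_trans)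
          show "cmod (e \<tau> - 1) \<le> 1 / (real n + 1) / 2"
            using \<tau> half[of ?m'] by (simp only: Int_iff mem_Collect_eq) (meson max.cobounded2 order_trans)
        qed
        finally have "cmod (e (\<sigma> + \<tau>) - 1) \<le> 1 / (real n + 1)"
          by (simp only: field_sum_of_halves)
        moreover have "\<tau> \<in> R m'"
          using dec[of m' ?m'] \<tau> by auto
        then have "\<sigma> + \<tau> \<in> R n"
          using m' by blast
        ultimately show "\<sigma> + \<tau> \<in> R n \<inter> {\<tau>. cmod (e \<tau> - 1) \<le> 1 / (real n + 1)}"
          by blast
      qed
    qed
  qed
qed

lemma returns_mono: "F \<subseteq> F' \<Longrightarrow> K \<subseteq> K' \<Longrightarrow> e' \<le> e \<Longrightarrow> returns F' K' e' \<subseteq> returns F K e"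
  unfolding returns_def by (blast intro: order_trans)

lemma char_returns_mono: "\<Omega> \<subseteq> \<Omega>' \<Longrightarrow> e' \<le> e \<Longrightarrow> char_returns \<Omega>' e' \<subseteq> char_returns \<Omega> e"
  unfolding char_returns_def by (blast intro: order_trans)

lemma return_chain_returns:
  assumes dense: "\<And>K e. compact K \<Longrightarrow> e > 0 \<Longrightarrow> relatively_dense (returns F K e)"
  shows "return_chain (\<lambda>n. returns F {- real n..real n} (1 / (real n + 1)))"
  unfolding return_chain_def
proof (intro conjI allI)
  show "decseq (\<lambda>n. returns F {- real n..real n} (1 / (real n + 1)))"
    by (rule decseq_SucI, rule returns_mono) (auto simp: field_simps)
next
  fix n
  show "relatively_dense (returns F {- real n..real n} (1 / (real n + 1)))"
    by (rule dense) auto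
next
  fix n
  show "\<exists>m. \<forall>\<sigma>\<in>returns F {- real m..real m} (1 / (real m + 1)).
      \<exists>m'. \<forall>\<tau>\<in>returns F {- real m'..real m'} (1 / (real m' + 1)).
        \<sigma> + \<tau> \<in> returns F {- real n..real n} (1 / (real n + 1))"
  proof (rule exI[of _ "2 * n + 1"], rule ballI)
    fix \<sigma> assume \<sigma>: "\<sigma> \<in> returns F {- real (2*n+1)..real (2*n+1)} (1 / (real (2*n+1) + 1))"
    obtain m' :: nat where m': "real (2 * n + 1) + \<bar>\<sigma>\<bar> \<le> real m'"
      using real_arch_simple by blast
    show "\<exists>m'. \<forall>\<tau>\<in>returns F {- real m'..real m'} (1 / (real m' + 1)).
        \<sigma> + \<tau> \<in> returns F {- real n..real n} (1 / (real n + 1))"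
    proof (rule exI[of _ m'], rule ballI)
      fix \<tau> assume \<tau>: "\<tau> \<in> returns F {- real m'..real m'} (1 / (real m' + 1))"
      have half: "1 / (real k + 1) \<le> 1 / (real n + 1) / 2" if "real (2 * n + 1) \<le> real k" for k
        using that by (simp add: field_simps)
      show "\<sigma> + \<tau> \<in> returns F {- real n..real n} (1 / (real n + 1))"
        unfolding returns_def
      proof (intro CollectI ballI)
        fix t f assume t: "t \<in> {- real n..real n}" and f: "f \<in> F"
        have "norm (f (t + \<sigma>) - f t) \<le> 1 / (real (2*n+1) + 1)"
          using \<sigma> t f unfolding returns_def by auto
        moreover have "norm (f ((t + \<sigma>) + \<tau>) - f (t + \<sigma>)) \<le> 1 / (real m' + 1)"
        proof -
          have "t + \<sigma> \<in> {- real m'..real m'}"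
            using t m' by (simp add: abs_le_iff) linarith
          with \<tau> f show ?thesis
            unfolding returns_def by blast
        qed
        moreover have "norm (f (t + (\<sigma> + \<tau>)) - f t)
            \<le> norm (f ((t + \<sigma>) + \<tau>) - f (t + \<sigma>)) + norm (f (t + \<sigma>) - f t)"
          using norm_triangle_ineq[of "f ((t + \<sigma>) + \<tau>) - f (t + \<sigma>)" "f (t + \<sigma>) - f t"]
          by (simp add: add.assoc)
        moreover have "real (2 * n + 1) \<le> real m'"
          using m' by linarith
        ultimately show "norm (f (t + (\<sigma> + \<tau>)) - f t) \<le> 1 / (real n + 1)"
          using half[of "2*n+1"] half[of m'] by linarith
      qed
    qed
  qed
qed

text \<open>
  Adjoining a character to a chain gives a chain again, so finitely many characters can be adjoined
  one after the other.
\<close>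
lemma relatively_dense_returns_char_returns:
  assumes dense: "\<And>K e. compact K \<Longrightarrow> e > 0 \<Longrightarrow> relatively_dense (returns F K e)"
    and \<Omega>: "finite \<Omega>" and K: "compact K" and e: "e > 0"
  shows "relatively_dense (returns F K e \<inter> char_returns \<Omega> e)"
proof -
  let ?R = "\<lambda>\<Omega> n. returns F {- real n..real n} (1 / (real n + 1)) \<inter> char_returns \<Omega> (1 / (real n + 1))"
  have "return_chain (?R \<Omega>)"
    using \<Omega>
  proof (induction rule: finite_induct)
    case empty
    then show ?case
      using return_chain_returns[OF dense] by (simp add: char_returns_def)
  next
    case (insert \<omega> \<Omega>)
    have "?R (insert \<omega> \<Omega>) = (\<lambda>n. ?R \<Omega> n \<inter> {\<tau>. cmod (gamma_char \<omega> \<tau> - 1) \<le> 1 / (real n + 1)})"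
      by (auto simp: char_returns_def)
    with return_chain_inter_char[OF insert.IH, of \<omega>] show ?case
      by simp
  qed
  then have rd: "relatively_dense (?R \<Omega> n)" for n
    by (simp add: return_chain_def)
  obtain B where B: "\<And>x. x \<in> K \<Longrightarrow> \<bar>x\<bar> \<le> B"
    using compact_imp_bounded[OF K] by (auto simp: bounded_iff)
  obtain n :: nat where n: "max B (1 / e) \<le> real n"
    using real_arch_simple by blast
  have "1 / e \<le> real n + 1"
    using n by linarith
  then have "1 / (real n + 1) \<le> e"
    using e by (simp add: field_simps)
  moreover have "K \<subseteq> {- real n..real n}"
    using B n by (force simp: abs_le_iff)
  ultimately have "?R \<Omega> n \<subseteq> returns F K e \<inter> char_returns \<Omega> e"
    using returns_mono[of F F K "{- real n..real n}"] char_returns_mono[of \<Omega> \<Omega>] by blast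
  with rd[of n] show ?thesis
    by (rule relatively_dense_mono)
qed

section \<open>Maximal jointly recurrent families\<close>

definition maximal_star :: "(real \<Rightarrow> 'a::banach) set \<Rightarrow> bool"
  where "maximal_star A \<longleftrightarrow> A \<noteq> {} \<and> A \<subseteq> REC_urc \<and> condition_star A \<and>
    (\<forall>W. A \<subseteq> W \<and> W \<subseteq> REC_urc \<and> condition_star W \<longrightarrow> W = A)"

text \<open>
  These sets form a filter.  Its members are the coincidences that the family \<open>A\<close> and the characters
  can be made to respect simultaneously.
\<close>
definition return_nbhd :: "(real \<Rightarrow> 'a::banach) set \<Rightarrow> real set \<Rightarrow> bool"
  where "return_nbhd A N \<longleftrightarrow> (\<exists>F \<Omega> K e. finite F \<and> F \<subseteq> A \<and> finite \<Omega> \<and> compact K \<and> e > 0 \<and>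
    returns F K e \<inter> char_returns \<Omega> e \<subseteq> N)"

lemma return_nbhdI:
  assumes "finite F" "F \<subseteq> A" "finite \<Omega>" "compact K" "e > 0"
    "returns F K e \<inter> char_returns \<Omega> e \<subseteq> N"
  shows "return_nbhd A N"
  unfolding return_nbhd_def
  by (rule exI[of _ F], rule exI[of _ \<Omega>], rule exI[of _ K], rule exI[of _ e]) (intro conjI assms)

lemma return_nbhd_mono: "return_nbhd A N \<Longrightarrow> N \<subseteq> N' \<Longrightarrow> return_nbhd A N'"
  unfolding return_nbhd_def by (meson order_trans)

lemma return_nbhd_Int:
  assumes "return_nbhd A N" "return_nbhd A N'"
  shows "return_nbhd A (N \<inter> N')"
proof -
  obtain F \<Omega> K e where 1: "finite F" "F \<subseteq> A" "finite \<Omega>" "compact K" "e > 0"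
    "returns F K e \<inter> char_returns \<Omega> e \<subseteq> N"
    using assms(1) unfolding return_nbhd_def by blast
  obtain F' \<Omega>' K' e' where 2: "finite F'" "F' \<subseteq> A" "finite \<Omega>'" "compact K'" "e' > 0"
    "returns F' K' e' \<inter> char_returns \<Omega>' e' \<subseteq> N'"
    using assms(2) unfolding return_nbhd_def by blast
  let ?F = "F \<union> F'" and ?\<Omega> = "\<Omega> \<union> \<Omega>'" and ?K = "K \<union> K'" and ?e = "min e e'"
  have "returns ?F ?K ?e \<subseteq> returns F K e \<inter> returns F' K' e'"
    by (intro Int_greatest returns_mono) auto
  moreover have "char_returns ?\<Omega> ?e \<subseteq> char_returns \<Omega> e \<inter> char_returns \<Omega>' e'"
    by (intro Int_greatest char_returns_mono) auto
  ultimately have "returns ?F ?K ?e \<inter> char_returns ?\<Omega> ?e \<subseteq> N \<inter> N'"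
    using 1(6) 2(6) by blast
  moreover have "finite ?F" "?F \<subseteq> A" "finite ?\<Omega>" "compact ?K" "?e > 0"
    using 1 2 by (auto intro: compact_Un)
  ultimately show ?thesis
    by (intro return_nbhdI)
qed

lemma return_nbhd_UNIV: "return_nbhd A UNIV"
  by (rule return_nbhdI[of "{}" _ "{}" "{}" 1]) auto

lemma return_nbhd_INT:
  assumes "finite I" "\<And>i. i \<in> I \<Longrightarrow> return_nbhd A (N i)"
  shows "return_nbhd A (\<Inter>i\<in>I. N i)"
  using assms by (induction rule: finite_induct) (auto intro: return_nbhd_UNIV return_nbhd_Int)

lemma return_nbhd_returns:
  assumes "f \<in> A" "compact K" "e > 0"
  shows "return_nbhd A (returns {f} K e)"
  by (rule return_nbhdI[of "{f}" _ "{}" K e]) (use assms in auto)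

lemma return_nbhd_char_returns:
  assumes "finite \<Omega>" "e > 0"
  shows "return_nbhd A (char_returns \<Omega> e)"
  by (rule return_nbhdI[of "{}" _ \<Omega> "{}" e]) (use assms in auto)

lemma condition_star_returns:
  assumes A: "condition_star A" "A \<noteq> {}" and F: "finite F" "F \<subseteq> A"
    and K: "compact K" and e: "e > 0"
  shows "relatively_dense (returns F K e)"
proof -
  obtain a where "a \<in> A"
    using A(2) by blast
  let ?F = "insert a F"
  obtain h where h: "bij_betw h {1..card ?F} ?F"
    using ex_bij_betw_nat_finite_1[of ?F] F(1) by auto
  have "card ?F \<ge> 1"
    using F(1) by (simp add: Suc_le_eq card_gt_0_iff)
  moreover have "\<forall>i\<in>{1..card ?F}. h i \<in> A"
    using bij_betw_apply[OF h] F(2) \<open>a \<in> A\<close> by blast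
  ultimately have "REC_tuple {1..card ?F} h"
    using A(1) unfolding condition_star_def by blast
  then have "relatively_dense {\<tau>. \<forall>t\<in>K. \<forall>i\<in>{1..card ?F}. norm (h i (t + \<tau>) - h i t) \<le> e}"
    using K e unfolding REC_tuple_def by blast
  moreover have "{\<tau>. \<forall>t\<in>K. \<forall>i\<in>{1..card ?F}. norm (h i (t + \<tau>) - h i t) \<le> e} \<subseteq> returns F K e"
  proof
    fix \<tau> assume \<tau>: "\<tau> \<in> {\<tau>. \<forall>t\<in>K. \<forall>i\<in>{1..card ?F}. norm (h i (t + \<tau>) - h i t) \<le> e}"
    show "\<tau> \<in> returns F K e"
      unfolding returns_def
    proof (intro CollectI ballI)
      fix t f assume "t \<in> K" "f \<in> F"
      then obtain i where "i \<in> {1..card ?F}" "f = h i"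
        using h unfolding bij_betw_def by blast
      with \<tau> \<open>t \<in> K\<close> show "norm (f (t + \<tau>) - f t) \<le> e"
        by blast
    qed
  qed
  ultimately show ?thesis
    by (rule relatively_dense_mono)
qed

lemma return_nbhd_relatively_dense:
  assumes A: "condition_star A" "A \<noteq> {}" and N: "return_nbhd A N"
  shows "relatively_dense N"
proof -
  obtain F \<Omega> K e where 1: "finite F" "F \<subseteq> A" "finite \<Omega>" "compact K" "e > 0"
    "returns F K e \<inter> char_returns \<Omega> e \<subseteq> N"
    using N unfolding return_nbhd_def by blast
  have "relatively_dense (returns F K e \<inter> char_returns \<Omega> e)"
    using condition_star_returns[OF A 1(1,2)] 1
    by (intro relatively_dense_returns_char_returns) auto
  then show ?thesis
    using 1(6) by (rule relatively_dense_mono)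
qed

text \<open>
  A family enlarged by such a function still satisfies condition (*): every finite intersection of
  return sets of its members is a member of the filter, and hence relatively dense.
\<close>
lemma maximal_star_mem:
  assumes A: "maximal_star A" and h: "h \<in> C_urc"
    and nb: "\<And>K e. compact K \<Longrightarrow> e > 0 \<Longrightarrow> return_nbhd A (returns {h} K e)"
  shows "h \<in> A"
proof -
  have A': "condition_star A" "A \<noteq> {}" "A \<subseteq> REC_urc"
    using A by (auto simp: maximal_star_def)
  have cont_h: "continuous_on UNIV h"
    using h uniformly_continuous_imp_continuous by (auto simp: C_urc_def)
  have cont: "continuous_on UNIV f" if "f \<in> insert h A" for f
    using that cont_h A'(3) by (auto simp: REC_urc_def REC_def)
  have nb': "return_nbhd A (returns {f} K e)" if "f \<in> insert h A" "compact K" "e > 0" for f K e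
    using that nb return_nbhd_returns by blast
  have REC: "REC_tuple I f" if I: "finite I" and f: "\<And>i. i \<in> I \<Longrightarrow> f i \<in> insert h A" for I :: "nat set" and f
    unfolding REC_tuple_def
  proof (intro conjI ballI allI impI)
    show "continuous_on UNIV (f i)" if "i \<in> I" for i
      using f[OF that] cont by blast
  next
    fix K :: "real set" and e :: real
    assume Ke: "compact K \<and> e > 0"
    have "return_nbhd A (\<Inter>i\<in>I. returns {f i} K e)"
      using f Ke by (intro return_nbhd_INT I nb') auto
    then have "relatively_dense (\<Inter>i\<in>I. returns {f i} K e)"
      by (rule return_nbhd_relatively_dense[OF A'(1,2)])
    then show "relatively_dense {\<tau>. \<forall>t\<in>K. \<forall>i\<in>I. norm (f i (t + \<tau>) - f i t) \<le> e}"
      by (rule relatively_dense_mono) (auto simp: returns_def)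
  qed
  have "condition_star (insert h A)"
    unfolding condition_star_def using REC by blast
  moreover have "h \<in> REC"
    using REC[of "{0}" "\<lambda>_. h"] by (auto simp: REC_def REC_tuple_def)
  then have "insert h A \<subseteq> REC_urc"
    using h A'(3) by (auto simp: REC_urc_def)
  ultimately have "insert h A = A"
    using A unfolding maximal_star_def by (metis subset_insertI)
  then show ?thesis
    by blast
qed

section \<open>Uniformly continuous functions\<close>

lemma C_urcI:
  assumes "uniformly_continuous_on UNIV f" "compact C" "range f \<subseteq> C"
  shows "f \<in> C_urc"
proof -
  have "closure (range f) \<subseteq> C"
    using assms(2,3) by (simp add: closure_minimal compact_imp_closed)
  then have "compact (closure (range f))"
    using compact_Int_closed[OF assms(2) closed_closure, of "range f"] by (simp add: Int_absorb1)
  with assms(1) show ?thesis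
    by (simp add: C_urc_def)
qed

lemma C_urcD: "f \<in> C_urc \<Longrightarrow> uniformly_continuous_on UNIV f"
    "f \<in> C_urc \<Longrightarrow> compact (closure (range f))" "f \<in> C_urc \<Longrightarrow> f \<in> C_ub"
  using bounded_subset[OF compact_imp_bounded closure_subset]
  by (auto simp: C_urc_def C_ub_def)

lemma bounded_bilinear_scaleC: "bounded_bilinear ((*\<^sub>C) :: complex \<Rightarrow> 'a::complex_banach \<Rightarrow> 'a)"
proof
  show "(r *\<^sub>R c) *\<^sub>C x = r *\<^sub>R (c *\<^sub>C x)" for r c and x :: 'a
    by (metis scaleC_of_real scaleC_scaleC scaleR_conv_of_real)
  show "c *\<^sub>C (r *\<^sub>R x) = r *\<^sub>R (c *\<^sub>C x)" for r c and x :: 'a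
    by (metis scaleC_of_real scaleC_scaleC mult.commute)
  show "\<exists>K. \<forall>c (x::'a). norm (c *\<^sub>C x) \<le> cmod c * norm x * K"
    by (intro exI[of _ 1]) (simp add: norm_scaleC)
qed (simp_all add: scaleC_add_left scaleC_add_right)

interpretation scaleC: bounded_bilinear "(*\<^sub>C) :: complex \<Rightarrow> 'a::complex_banach \<Rightarrow> 'a"
  by (rule bounded_bilinear_scaleC)

lemmas continuous_on_scaleC [continuous_intros] = scaleC.continuous_on

lemma scaleC_one [simp]: "1 *\<^sub>C x = (x :: 'a::complex_banach)"
  using scaleC_of_real[of 1 x] by simp

lemma uniformly_continuous_modulus:
  assumes "uniformly_continuous_on UNIV (f :: real \<Rightarrow> 'b::real_normed_vector)" "e > 0"
  obtains d where "d > 0" "\<And>s t. \<bar>s - t\<bar> < d \<Longrightarrow> norm (f s - f t) < e"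
  using assms unfolding uniformly_continuous_on_def dist_norm by (metis UNIV_I real_norm_def)

lemma C_urc_add:
  assumes "f \<in> C_urc" "g \<in> C_urc" shows "(\<lambda>t. f t + g t) \<in> C_urc"
proof (rule C_urcI)
  let ?C = "{x + y | x y. x \<in> closure (range f) \<and> y \<in> closure (range g)}"
  show "compact ?C"
    by (rule compact_sums) (use assms C_urcD in auto)
  show "range (\<lambda>t. f t + g t) \<subseteq> ?C"
    using closure_subset[of "range f"] closure_subset[of "range g"] by blast
  show "uniformly_continuous_on UNIV (\<lambda>t. f t + g t)"
    using assms C_urcD by (intro uniformly_continuous_on_add) auto
qed

lemma uniformly_continuous_translate:
  fixes f :: "real \<Rightarrow> 'b::real_normed_vector"
  assumes f: "uniformly_continuous_on UNIV f"
  shows "uniformly_continuous_on UNIV (\<lambda>t. f (t + c))"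
  unfolding uniformly_continuous_on_def dist_norm
proof (intro allI impI)
  fix e :: real assume "e > 0"
  obtain d where "d > 0" "\<And>s t. \<bar>s - t\<bar> < d \<Longrightarrow> norm (f s - f t) < e"
    using uniformly_continuous_modulus[OF f \<open>e > 0\<close>] by blast
  then show "\<exists>d>0. \<forall>x\<in>UNIV. \<forall>x'\<in>UNIV. norm (x' - x) < d \<longrightarrow> norm (f (x' + c) - f (x + c)) < e"
    by (intro exI[of _ d]) auto
qed

lemma C_urc_translate:
  assumes "f \<in> C_urc" shows "(\<lambda>t. f (t + c)) \<in> C_urc"
proof (rule C_urcI)
  show "compact (closure (range f))"
    using assms C_urcD by blast
  show "range (\<lambda>t. f (t + c)) \<subseteq> closure (range f)"
    using closure_subset[of "range f"] by blast
  show "uniformly_continuous_on UNIV (\<lambda>t. f (t + c))"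
    by (rule uniformly_continuous_translate[OF C_urcD(1)[OF assms]])
qed

lemma uniformly_continuous_scaleC:
  fixes f :: "real \<Rightarrow> 'a::complex_banach"
  assumes b: "uniformly_continuous_on UNIV b" "bounded (range b)" and f: "f \<in> C_ub"
  shows "uniformly_continuous_on UNIV (\<lambda>t. b t *\<^sub>C f t)"
proof -
  have f': "uniformly_continuous_on UNIV f" "bounded (range f)"
    using f by (auto simp: C_ub_def)
  obtain B where B: "B > 0" "\<And>t. cmod (b t) \<le> B"
    using b(2) by (force simp: bounded_pos)
  obtain C where C: "C > 0" "\<And>t. norm (f t) \<le> C"
    using f'(2) by (force simp: bounded_pos)
  show ?thesis
    unfolding uniformly_continuous_on_def dist_norm
  proof (intro allI impI)
    fix e :: real assume e: "e > 0"
    obtain d1 where d1: "d1 > 0" "\<And>s t. \<bar>s - t\<bar> < d1 \<Longrightarrow> norm (b s - b t) < e / (2 * C)"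
      using uniformly_continuous_modulus[OF b(1), of "e / (2 * C)"] e C(1) by auto
    obtain d2 where d2: "d2 > 0" "\<And>s t. \<bar>s - t\<bar> < d2 \<Longrightarrow> norm (f s - f t) < e / (2 * B)"
      using uniformly_continuous_modulus[OF f'(1), of "e / (2 * B)"] e B(1) by auto
    have "norm (b s *\<^sub>C f s - b t *\<^sub>C f t) < e" if st: "\<bar>s - t\<bar> < min d1 d2" for s t
    proof -
      have "b s *\<^sub>C f s - b t *\<^sub>C f t = (b s - b t) *\<^sub>C f s + b t *\<^sub>C (f s - f t)"
        by (simp add: scaleC.diff_left scaleC.diff_right)
      then have "norm (b s *\<^sub>C f s - b t *\<^sub>C f t)
          \<le> cmod (b s - b t) * norm (f s) + cmod (b t) * norm (f s - f t)"
        by (metis norm_triangle_ineq norm_scaleC)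
      also have "\<dots> \<le> cmod (b s - b t) * C + B * norm (f s - f t)"
        by (intro add_mono mult_left_mono mult_right_mono B C) auto
      also have "\<dots> < e / (2 * C) * C + B * (e / (2 * B))"
        using st by (intro add_strict_mono mult_strict_left_mono mult_strict_right_mono d1 d2 B C) auto
      also have "\<dots> = e"
        using B(1) C(1) by simp
      finally show ?thesis .
    qed
    then show "\<exists>d>0. \<forall>s\<in>UNIV. \<forall>t\<in>UNIV. norm (t - s) < d \<longrightarrow> norm (b t *\<^sub>C f t - b s *\<^sub>C f s) < e"
      using d1(1) d2(1) by (intro exI[of _ "min d1 d2"]) auto
  qed
qed

lemma C_urc_scaleC:
  fixes f :: "real \<Rightarrow> 'a::complex_banach"
  assumes b: "uniformly_continuous_on UNIV b" "bounded (range b)" and f: "f \<in> C_urc"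
  shows "(\<lambda>t. b t *\<^sub>C f t) \<in> C_urc"
proof (rule C_urcI)
  let ?C = "(\<lambda>(c, x). c *\<^sub>C x) ` (closure (range b) \<times> closure (range f))"
  show "compact ?C"
    using b f C_urcD(2)[OF f] unfolding case_prod_beta
    by (intro compact_continuous_image compact_Times continuous_intros) (auto simp: compact_closure)
  show "range (\<lambda>t. b t *\<^sub>C f t) \<subseteq> ?C"
    using closure_subset[of "range b"] closure_subset[of "range f"] by fastforce
qed (use uniformly_continuous_scaleC[OF b C_urcD(3)[OF f]] in auto)

lemma gamma_char_uniformly_continuous: "uniformly_continuous_on UNIV (gamma_char \<omega>)"
proof -
  have "norm (gamma_char \<omega> s - gamma_char \<omega> t) \<le> \<bar>\<omega>\<bar> * norm (s - t)" for s t
  proof -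
    have "norm (gamma_char \<omega> s - gamma_char \<omega> t) = norm (gamma_char \<omega> (t + (s - t)) - gamma_char \<omega> t)"
      by simp
    also have "\<dots> = norm (gamma_char \<omega> t * (gamma_char \<omega> (s - t) - 1))"
      unfolding gamma_char_add by (simp add: algebra_simps)
    also have "\<dots> = norm (exp (\<i> * of_real (\<omega> * (s - t))) - 1)"
      by (simp add: norm_mult gamma_char_def)
    also have "\<dots> \<le> \<bar>\<omega> * (s - t)\<bar>"
      unfolding dist_exp_i_1 using abs_sin_x_le_abs_x[of "\<omega> * (s - t) / 2"] by simp
    finally show ?thesis
      by (simp add: abs_mult)
  qed
  then have "lipschitz_on \<bar>\<omega>\<bar> UNIV (gamma_char \<omega>)"
    by (auto simp: lipschitz_on_def dist_norm)
  then show ?thesis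
    by (rule lipschitz_on_uniformly_continuous)
qed

lemma gamma_char_bounded: "bounded (range (gamma_char \<omega>))"
  by (auto simp: bounded_iff intro: exI[of _ 1])

lemma uniformly_continuous_uniform_limit:
  fixes h :: "real \<Rightarrow> 'a::real_normed_vector"
  assumes lim: "\<And>e. e > 0 \<Longrightarrow> \<exists>f. uniformly_continuous_on UNIV f \<and> (\<forall>t. norm (f t - h t) \<le> e)"
  shows "uniformly_continuous_on UNIV h"
  unfolding uniformly_continuous_on_def dist_norm
proof (intro allI impI)
  fix e :: real assume e: "e > 0"
  obtain f where f: "uniformly_continuous_on UNIV f" "\<And>t. norm (f t - h t) \<le> e / 3"
    using lim[of "e / 3"] e by auto
  obtain d where d: "d > 0" "\<And>s t. \<bar>s - t\<bar> < d \<Longrightarrow> norm (f s - f t) < e / 3"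
    using uniformly_continuous_modulus[OF f(1), of "e / 3"] e by auto
  have "norm (h s - h t) < e" if "\<bar>s - t\<bar> < d" for s t
  proof -
    have "h s - h t = (f s - f t) - (f s - h s) + (f t - h t)"
      by simp
    then have "norm (h s - h t) \<le> norm (f s - f t) + norm (f s - h s) + norm (f t - h t)"
      using norm_triangle_ineq[of "f s - f t - (f s - h s)" "f t - h t"]
        norm_triangle_ineq4[of "f s - f t" "f s - h s"] by (simp only:)
    with d(2)[OF that] f(2)[of s] f(2)[of t] show ?thesis
      by linarith
  qed
  with d(1) show "\<exists>d>0. \<forall>s\<in>UNIV. \<forall>t\<in>UNIV. norm (t - s) < d \<longrightarrow> norm (h t - h s) < e"
    by (intro exI[of _ d]) auto
qed

lemma C_urc_uniform_limit:
  fixes h :: "real \<Rightarrow> 'a::banach"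
  assumes lim: "\<And>e. e > 0 \<Longrightarrow> \<exists>f\<in>C_urc. \<forall>t. norm (f t - h t) \<le> e"
  shows "h \<in> C_urc"
proof -
  have "uniformly_continuous_on UNIV h"
    using lim C_urcD(1) by (intro uniformly_continuous_uniform_limit) blast
  moreover have "compact (closure (range h))"
    unfolding compact_eq_totally_bounded
  proof (intro conjI allI impI)
    show "complete (closure (range h))"
      by (simp add: complete_eq_closed)
    fix e :: real assume e: "e > 0"
    obtain f where f: "f \<in> C_urc" "\<And>t. norm (f t - h t) \<le> e / 3"
      using lim[of "e / 3"] e by auto
    have "\<exists>k. finite k \<and> closure (range f) \<subseteq> (\<Union>x\<in>k. ball x (e / 3))"
      using C_urcD(2)[OF f(1)] e unfolding compact_eq_totally_bounded by simp
    then obtain k where k: "finite k" "closure (range f) \<subseteq> (\<Union>x\<in>k. ball x (e / 3))"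
      by (elim exE conjE)
    have "range h \<subseteq> (\<Union>x\<in>k. cball x (2 * e / 3))"
    proof (rule image_subsetI)
      fix t
      have "f t \<in> closure (range f)"
        by (rule subsetD[OF closure_subset]) simp
      then obtain x where x: "x \<in> k" "dist x (f t) < e / 3"
        using k(2) by (meson UN_E mem_ball subsetD)
      have "dist x (h t) \<le> dist x (f t) + dist (f t) (h t)"
        by (rule dist_triangle)
      also have "\<dots> \<le> e / 3 + e / 3"
        using x(2) f(2)[of t] by (intro add_mono) (auto simp: dist_norm)
      finally have "h t \<in> cball x (2 * e / 3)"
        by simp
      then show "h t \<in> (\<Union>x\<in>k. cball x (2 * e / 3))"
        using x(1) by blast
    qed
    then have "closure (range h) \<subseteq> (\<Union>x\<in>k. cball x (2 * e / 3))"
      by (intro closure_minimal) (use k(1) in auto)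
    also have "\<dots> \<subseteq> (\<Union>x\<in>k. ball x e)"
      using e by (intro UN_mono) auto
    finally show "\<exists>k. finite k \<and> closure (range h) \<subseteq> (\<Union>x\<in>k. ball x e)"
      using k(1) by blast
  qed
  ultimately show ?thesis
    by (simp add: C_urc_def)
qed

section \<open>Closure properties of maximal families\<close>

lemma maximal_starD:
  assumes "maximal_star A" "f \<in> A"
  shows "f \<in> C_urc" "f \<in> C_ub"
  using assms C_urcD(3) by (auto simp: maximal_star_def REC_urc_def)

lemma maximal_star_add:
  assumes A: "maximal_star A" and f: "f \<in> A" and g: "g \<in> A"
  shows "(\<lambda>t. f t + g t) \<in> A"
proof (rule maximal_star_mem[OF A])
  show "(\<lambda>t. f t + g t) \<in> C_urc"
    using A f g by (intro C_urc_add maximal_starD)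
  fix K :: "real set" and e :: real assume Ke: "compact K" "e > 0"
  then have "return_nbhd A (returns {f} K (e/2) \<inter> returns {g} K (e/2))"
    using f g by (intro return_nbhd_Int return_nbhd_returns) auto
  then show "return_nbhd A (returns {\<lambda>t. f t + g t} K e)"
  proof (rule return_nbhd_mono)
    show "returns {f} K (e/2) \<inter> returns {g} K (e/2) \<subseteq> returns {\<lambda>t. f t + g t} K e"
      unfolding returns_def
    proof clarsimp
      fix \<tau> t assume "\<forall>t\<in>K. norm (f (t + \<tau>) - f t) * 2 \<le> e" "\<forall>t\<in>K. norm (g (t + \<tau>) - g t) * 2 \<le> e" "t \<in> K"
      then have "norm (f (t + \<tau>) - f t) * 2 \<le> e" "norm (g (t + \<tau>) - g t) * 2 \<le> e"
        by auto
      with norm_triangle_ineq[of "f (t + \<tau>) - f t" "g (t + \<tau>) - g t"]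
      show "norm (f (t + \<tau>) + g (t + \<tau>) - (f t + g t)) \<le> e"
        by (simp add: algebra_simps)
    qed
  qed
qed

lemma maximal_star_translate:
  assumes A: "maximal_star A" and f: "f \<in> A"
  shows "(\<lambda>t. f (t + c)) \<in> A"
proof (rule maximal_star_mem[OF A])
  show "(\<lambda>t. f (t + c)) \<in> C_urc"
    using A f by (intro C_urc_translate maximal_starD)
  fix K :: "real set" and e :: real assume Ke: "compact K" "e > 0"
  then have "compact ((+) c ` K)"
    by (intro compact_translation)
  then have "return_nbhd A (returns {f} ((+) c ` K) e)"
    using f Ke by (intro return_nbhd_returns)
  then show "return_nbhd A (returns {\<lambda>t. f (t + c)} K e)"
    by (rule return_nbhd_mono) (auto simp: returns_def add_ac)
qed

lemma maximal_star_scaleC: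
  assumes A: "maximal_star A" and f: "f \<in> A"
  shows "(\<lambda>t. c *\<^sub>C f t) \<in> A"
proof (rule maximal_star_mem[OF A])
  show "(\<lambda>t. c *\<^sub>C f t) \<in> C_urc"
    using A f by (intro C_urc_scaleC maximal_starD uniformly_continuous_on_const) auto
  fix K :: "real set" and e :: real assume Ke: "compact K" "e > 0"
  then have "return_nbhd A (returns {f} K (e / (cmod c + 1)))"
    using f by (intro return_nbhd_returns) (auto simp: add_nonneg_pos)
  then show "return_nbhd A (returns {\<lambda>t. c *\<^sub>C f t} K e)"
  proof (rule return_nbhd_mono)
    show "returns {f} K (e / (cmod c + 1)) \<subseteq> returns {\<lambda>t. c *\<^sub>C f t} K e"
      unfolding returns_def
    proof clarsimp
      fix \<tau> t assume "\<forall>t\<in>K. norm (f (t + \<tau>) - f t) \<le> e / (cmod c + 1)" "t \<in> K"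
      then have "norm (f (t + \<tau>) - f t) \<le> e / (cmod c + 1)"
        by auto
      then have "(cmod c + 1) * norm (f (t + \<tau>) - f t) \<le> e"
        by (simp add: pos_le_divide_eq add_nonneg_pos mult.commute)
      moreover have "norm (c *\<^sub>C f (t + \<tau>) - c *\<^sub>C f t) = cmod c * norm (f (t + \<tau>) - f t)"
        by (simp add: norm_scaleC flip: scaleC.diff_right)
      ultimately show "norm (c *\<^sub>C f (t + \<tau>) - c *\<^sub>C f t) \<le> e"
        using norm_ge_zero[of "f (t + \<tau>) - f t"] unfolding distrib_right mult_1_left by linarith
    qed
  qed
qed

lemma maximal_star_gamma_char:
  assumes A: "maximal_star A" and f: "f \<in> A"
  shows "(\<lambda>t. gamma_char \<omega> t *\<^sub>C f t) \<in> A"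
proof (rule maximal_star_mem[OF A])
  show "(\<lambda>t. gamma_char \<omega> t *\<^sub>C f t) \<in> C_urc"
    using A f by (intro C_urc_scaleC maximal_starD gamma_char_uniformly_continuous gamma_char_bounded)
  have "bounded (range f)"
    using maximal_starD(2)[OF A f] by (simp add: C_ub_def)
  then obtain B where B: "B > 0" "\<And>t. norm (f t) \<le> B"
    by (force simp: bounded_pos)
  fix K :: "real set" and e :: real assume Ke: "compact K" "e > 0"
  then have "return_nbhd A (returns {f} K (e / 2) \<inter> char_returns {\<omega>} (e / (2 * B)))"
    using f B(1) by (intro return_nbhd_Int return_nbhd_returns return_nbhd_char_returns) auto
  then show "return_nbhd A (returns {\<lambda>t. gamma_char \<omega> t *\<^sub>C f t} K e)"
  proof (rule return_nbhd_mono, intro subsetI)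
    fix \<tau> assume \<tau>: "\<tau> \<in> returns {f} K (e / 2) \<inter> char_returns {\<omega>} (e / (2 * B))"
    have "norm (gamma_char \<omega> (t + \<tau>) *\<^sub>C f (t + \<tau>) - gamma_char \<omega> t *\<^sub>C f t) \<le> e" if "t \<in> K" for t
    proof -
      have "gamma_char \<omega> (t + \<tau>) *\<^sub>C f (t + \<tau>) - gamma_char \<omega> t *\<^sub>C f t
          = gamma_char \<omega> t *\<^sub>C ((gamma_char \<omega> \<tau> - 1) *\<^sub>C f (t + \<tau>) + (f (t + \<tau>) - f t))"
        by (simp add: gamma_char_add scaleC_add_right scaleC.diff_left scaleC.diff_right scaleC_scaleC)
      then have "norm (gamma_char \<omega> (t + \<tau>) *\<^sub>C f (t + \<tau>) - gamma_char \<omega> t *\<^sub>C f t)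
          \<le> cmod (gamma_char \<omega> \<tau> - 1) * norm (f (t + \<tau>)) + norm (f (t + \<tau>) - f t)"
        by (metis norm_scaleC norm_gamma_char mult_1 norm_triangle_ineq)
      also have "\<dots> \<le> e / (2 * B) * B + e / 2"
        using \<tau> that B Ke by (intro add_mono mult_mono) (auto simp: returns_def char_returns_def)
      finally show ?thesis
        using B(1) by simp
    qed
    then show "\<tau> \<in> returns {\<lambda>t. gamma_char \<omega> t *\<^sub>C f t} K e"
      by (simp add: returns_def)
  qed
qed

lemma maximal_star_uniform_limit:
  assumes A: "maximal_star A" and lim: "\<And>e. e > 0 \<Longrightarrow> \<exists>f\<in>A. \<forall>t. norm (f t - h t) \<le> e"
  shows "h \<in> A"
proof (rule maximal_star_mem[OF A])
  show "h \<in> C_urc"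
    using lim maximal_starD(1)[OF A] by (intro C_urc_uniform_limit) blast
  fix K :: "real set" and e :: real assume Ke: "compact K" "e > 0"
  then obtain f where f: "f \<in> A" "\<And>t. norm (f t - h t) \<le> e / 3"
    using lim[of "e / 3"] by auto
  then have "return_nbhd A (returns {f} K (e / 3))"
    using Ke by (intro return_nbhd_returns) auto
  then show "return_nbhd A (returns {h} K e)"
  proof (rule return_nbhd_mono, intro subsetI)
    fix \<tau> assume \<tau>: "\<tau> \<in> returns {f} K (e / 3)"
    have "norm (h (t + \<tau>) - h t) \<le> e" if "t \<in> K" for t
    proof -
      have "h (t + \<tau>) - h t = (f (t + \<tau>) - f t) - (f (t + \<tau>) - h (t + \<tau>)) + (f t - h t)"
        by simp
      then have "norm (h (t + \<tau>) - h t)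
          \<le> norm (f (t + \<tau>) - f t) + norm (f (t + \<tau>) - h (t + \<tau>)) + norm (f t - h t)"
        using norm_triangle_ineq[of "f (t + \<tau>) - f t - (f (t + \<tau>) - h (t + \<tau>))" "f t - h t"]
          norm_triangle_ineq4[of "f (t + \<tau>) - f t" "f (t + \<tau>) - h (t + \<tau>)"] by (simp only:)
      moreover have "norm (f (t + \<tau>) - f t) \<le> e / 3"
        using \<tau> that by (auto simp: returns_def)
      ultimately show ?thesis
        using f(2)[of t] f(2)[of "t + \<tau>"] by linarith
    qed
    then show "\<tau> \<in> returns {h} K e"
      by (simp add: returns_def)
  qed
qed

section \<open>The Bochner integral\<close>

abbreviation "sb_integrable \<equiv> Bochner_Integration.simple_bochner_integrable"
abbreviation "sb_integral \<equiv> Bochner_Integration.simple_bochner_integral"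

lemma sb_integrableD:
  assumes "sb_integrable M s"
  shows "simple_function M s" "finite (s ` space M)" "emeasure M {x \<in> space M. s x \<noteq> 0} \<noteq> \<infinity>"
  using assms by (auto elim!: Bochner_Integration.simple_bochner_integrable.cases simp: simple_function_def)

text \<open>
  In a nonseparable space the difference of two measurable functions need not be measurable.  Here one
  of them has finitely many values, and only differences with constants occur.
\<close>
lemma borel_measurable_norm_diff_simple:
  assumes F: "F \<in> borel_measurable M" and s: "simple_function M s"
  shows "(\<lambda>x. norm (F x - s x)) \<in> borel_measurable M"
proof -
  have 1: "(\<lambda>x. norm (F x - y)) \<in> borel_measurable M" for y
    by (rule borel_measurable_continuous_on[OF _ F]) (intro continuous_intros)
  have "s \<in> measurable M (count_space (s ` space M))"
    using s by (auto simp: measurable_count_space_eq2 simple_function_def)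
  then show ?thesis
    using s by (intro measurable_compose_countable'[OF 1]) (auto simp: simple_function_def countable_finite)
qed

text \<open>
  A variant of \<open>has_bochner\<close> in which measurable functions \<open>e i\<close> dominate the errors.  Measurability
  of \<open>f\<close> itself is not part of it, which makes sums and almost everywhere modifications harmless also
  for nonseparable ranges.
\<close>
definition mean_approx :: "'s measure \<Rightarrow> ('s \<Rightarrow> 'b::real_normed_vector) \<Rightarrow> 'b \<Rightarrow> bool"
  where "mean_approx M f x \<longleftrightarrow> (\<exists>s e. (\<forall>i::nat. sb_integrable M (s i)) \<and>
    (\<forall>i. e i \<in> borel_measurable M) \<and> (\<forall>i. AE u in M. ennreal (norm (f u - s i u)) \<le> e i u) \<and>
    (\<lambda>i. \<integral>\<^sup>+u. e i u \<partial>M) \<longlonglongrightarrow> 0 \<and> (\<lambda>i. sb_integral M (s i)) \<longlonglongrightarrow> x)"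

lemma mean_approxI:
  assumes "\<And>i::nat. sb_integrable M (s i)" "\<And>i. e i \<in> borel_measurable M"
    "\<And>i. AE u in M. ennreal (norm (f u - s i u)) \<le> e i u"
    "(\<lambda>i. \<integral>\<^sup>+u. e i u \<partial>M) \<longlonglongrightarrow> 0" "(\<lambda>i. sb_integral M (s i)) \<longlonglongrightarrow> x"
  shows "mean_approx M f x"
  unfolding mean_approx_def by (rule exI[of _ s], rule exI[of _ e]) (use assms in blast)

lemma mean_approxE:
  assumes "mean_approx M f x"
  obtains s e where "\<And>i::nat. sb_integrable M (s i)" "\<And>i. e i \<in> borel_measurable M"
    "\<And>i. AE u in M. ennreal (norm (f u - s i u)) \<le> e i u"
    "(\<lambda>i. \<integral>\<^sup>+u. e i u \<partial>M) \<longlonglongrightarrow> 0" "(\<lambda>i. sb_integral M (s i)) \<longlonglongrightarrow> x"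
  using assms unfolding mean_approx_def by blast

lemma has_bochner_imp_mean_approx:
  assumes "has_bochner M f x"
  shows "mean_approx M f x"
proof -
  obtain s where s: "\<And>i::nat. sb_integrable M (s i)"
    "(\<lambda>i. \<integral>\<^sup>+u. ennreal (norm (f u - s i u)) \<partial>M) \<longlonglongrightarrow> 0"
    "(\<lambda>i. sb_integral M (s i)) \<longlonglongrightarrow> x" and f: "f \<in> borel_measurable M"
    using assms unfolding has_bochner_def by blast
  have "(\<lambda>u. ennreal (norm (f u - s i u))) \<in> borel_measurable M" for i
    using borel_measurable_norm_diff_simple[OF f sb_integrableD(1)[OF s(1)]] by measurable
  then show ?thesis
    by (intro mean_approxI[OF s(1) _ _ s(2,3)]) auto
qed

lemma mean_approx_unique:
  assumes "mean_approx M f x" "mean_approx M f y"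
  shows "x = y"
proof -
  obtain s e where s: "\<And>i::nat. sb_integrable M (s i)" "\<And>i. e i \<in> borel_measurable M"
    "\<And>i. AE u in M. ennreal (norm (f u - s i u)) \<le> e i u"
    "(\<lambda>i. \<integral>\<^sup>+u. e i u \<partial>M) \<longlonglongrightarrow> 0" "(\<lambda>i. sb_integral M (s i)) \<longlonglongrightarrow> x"
    using mean_approxE[OF assms(1)] by blast
  obtain r d where r: "\<And>i::nat. sb_integrable M (r i)" "\<And>i. d i \<in> borel_measurable M"
    "\<And>i. AE u in M. ennreal (norm (f u - r i u)) \<le> d i u"
    "(\<lambda>i. \<integral>\<^sup>+u. d i u \<partial>M) \<longlonglongrightarrow> 0" "(\<lambda>i. sb_integral M (r i)) \<longlonglongrightarrow> y"
    using mean_approxE[OF assms(2)] by blast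
  have bound: "ennreal (norm (sb_integral M (s i) - sb_integral M (r i)))
      \<le> (\<integral>\<^sup>+u. e i u \<partial>M) + (\<integral>\<^sup>+u. d i u \<partial>M)" for i
  proof -
    have int: "sb_integrable M (\<lambda>u. s i u - r i u)" "sb_integrable M (\<lambda>u. norm (s i u - r i u))"
      using Bochner_Integration.simple_bochner_integrable_compose2[of "\<lambda>x y. x - y" M "s i" "r i"]
        Bochner_Integration.simple_bochner_integrable_compose2[of "\<lambda>x y. norm (x - y)" M "s i" "r i"]
        s(1) r(1) by auto
    have "norm (sb_integral M (s i) - sb_integral M (r i)) = norm (sb_integral M (\<lambda>u. s i u - r i u))"
      using Bochner_Integration.simple_bochner_integral_diff[OF s(1) r(1)] by simp
    also have "\<dots> \<le> sb_integral M (\<lambda>u. norm (s i u - r i u))"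
      by (rule Bochner_Integration.simple_bochner_integral_norm_bound[OF int(1)])
    finally have "ennreal (norm (sb_integral M (s i) - sb_integral M (r i)))
        \<le> ennreal (sb_integral M (\<lambda>u. norm (s i u - r i u)))"
      by (rule ennreal_leI)
    also have "\<dots> = (\<integral>\<^sup>+u. norm (s i u - r i u) \<partial>M)"
      by (rule Bochner_Integration.simple_bochner_integral_eq_nn_integral[OF int(2)]) simp
    also have "\<dots> \<le> (\<integral>\<^sup>+u. e i u + d i u \<partial>M)"
    proof (rule nn_integral_mono_AE)
      show "AE u in M. ennreal (norm (s i u - r i u)) \<le> e i u + d i u"
        using s(3)[of i] r(3)[of i]
      proof eventually_elim
        case (elim u)
        have "norm (s i u - r i u) \<le> norm (f u - s i u) + norm (f u - r i u)"
          by (metis dual_order.refl norm_diff_triangle_le norm_minus_commute)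
        then have "ennreal (norm (s i u - r i u)) \<le> ennreal (norm (f u - s i u)) + ennreal (norm (f u - r i u))"
          by (metis ennreal_leI ennreal_plus norm_ge_zero)
        then show ?case
          using add_mono[OF elim] order_trans by blast
      qed
    qed
    also have "\<dots> = (\<integral>\<^sup>+u. e i u \<partial>M) + (\<integral>\<^sup>+u. d i u \<partial>M)"
      by (rule nn_integral_add) (use s(2) r(2) in auto)
    finally show ?thesis .
  qed
  have "(\<lambda>i. (\<integral>\<^sup>+u. e i u \<partial>M) + (\<integral>\<^sup>+u. d i u \<partial>M)) \<longlonglongrightarrow> 0 + 0"
    by (intro tendsto_add s r)
  then have "(\<lambda>i. ennreal (norm (sb_integral M (s i) - sb_integral M (r i)))) \<longlonglongrightarrow> 0"
    using tendsto_sandwich[of "\<lambda>_. 0" "\<lambda>i. ennreal (norm (sb_integral M (s i) - sb_integral M (r i)))"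
        sequentially "\<lambda>i. (\<integral>\<^sup>+u. e i u \<partial>M) + (\<integral>\<^sup>+u. d i u \<partial>M)" 0] bound by simp
  then have "(\<lambda>i. ennreal (norm (sb_integral M (s i) - sb_integral M (r i)))) \<longlonglongrightarrow> ennreal 0"
    by simp
  then have "(\<lambda>i. norm (sb_integral M (s i) - sb_integral M (r i))) \<longlonglongrightarrow> 0"
    by (subst (asm) tendsto_ennreal_iff) auto
  moreover have "(\<lambda>i. norm (sb_integral M (s i) - sb_integral M (r i))) \<longlonglongrightarrow> norm (x - y)"
    by (intro tendsto_norm tendsto_diff s r)
  ultimately show ?thesis
    using LIMSEQ_unique by fastforce
qed

lemma has_bochner_unique: "has_bochner M f x \<Longrightarrow> has_bochner M f y \<Longrightarrow> x = y"
  using mean_approx_unique has_bochner_imp_mean_approx by blast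

lemma bochner_integral_eq: "has_bochner M f x \<Longrightarrow> bochner_integral M f = x"
  unfolding bochner_integral_def using has_bochner_unique by blast

lemma mean_approx_AE_cong:
  assumes "mean_approx M f x" "AE u in M. f u = g u"
  shows "mean_approx M g x"
proof -
  obtain s e where s: "\<And>i::nat. sb_integrable M (s i)" "\<And>i. e i \<in> borel_measurable M"
    "\<And>i. AE u in M. ennreal (norm (f u - s i u)) \<le> e i u"
    "(\<lambda>i. \<integral>\<^sup>+u. e i u \<partial>M) \<longlonglongrightarrow> 0" "(\<lambda>i. sb_integral M (s i)) \<longlonglongrightarrow> x"
    using mean_approxE[OF assms(1)] by blast
  have "AE u in M. ennreal (norm (g u - s i u)) \<le> e i u" for i
    using s(3)[of i] assms(2) by eventually_elim simp
  with s show ?thesis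
    by (intro mean_approxI[of M s e])
qed

lemma mean_approx_zero: "mean_approx M (\<lambda>_. 0) (0 :: 'a::real_normed_vector)"
proof (rule mean_approxI[of M "\<lambda>_ _. 0" "\<lambda>_ _. 0"])
  show "sb_integrable M (\<lambda>_. 0)"
    by (auto simp: Bochner_Integration.simple_bochner_integrable.simps)
  have "sb_integral M (\<lambda>_. 0::'a) = 0"
    unfolding Bochner_Integration.simple_bochner_integral_def by (rule sum.neutral) auto
  then show "(\<lambda>_. sb_integral M (\<lambda>_. 0)) \<longlonglongrightarrow> (0::'a)"
    by simp
qed simp_all

lemma mean_approx_add:
  assumes "mean_approx M f x" "mean_approx M g y"
  shows "mean_approx M (\<lambda>u. f u + g u) (x + y)"
proof -
  obtain s e where s: "\<And>i::nat. sb_integrable M (s i)" "\<And>i. e i \<in> borel_measurable M"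
    "\<And>i. AE u in M. ennreal (norm (f u - s i u)) \<le> e i u"
    "(\<lambda>i. \<integral>\<^sup>+u. e i u \<partial>M) \<longlonglongrightarrow> 0" "(\<lambda>i. sb_integral M (s i)) \<longlonglongrightarrow> x"
    using mean_approxE[OF assms(1)] by blast
  obtain r d where r: "\<And>i::nat. sb_integrable M (r i)" "\<And>i. d i \<in> borel_measurable M"
    "\<And>i. AE u in M. ennreal (norm (g u - r i u)) \<le> d i u"
    "(\<lambda>i. \<integral>\<^sup>+u. d i u \<partial>M) \<longlonglongrightarrow> 0" "(\<lambda>i. sb_integral M (r i)) \<longlonglongrightarrow> y"
    using mean_approxE[OF assms(2)] by blast
  show ?thesis
  proof (rule mean_approxI[of M "\<lambda>i u. s i u + r i u" "\<lambda>i u. e i u + d i u"])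
    fix i
    show "sb_integrable M (\<lambda>u. s i u + r i u)"
      using Bochner_Integration.simple_bochner_integrable_compose2[of "\<lambda>x y. x + y" M "s i" "r i"]
        s(1) r(1) by auto
    show "(\<lambda>u. e i u + d i u) \<in> borel_measurable M"
      using s(2) r(2) by auto
    show "AE u in M. ennreal (norm (f u + g u - (s i u + r i u))) \<le> e i u + d i u"
      using s(3)[of i] r(3)[of i]
    proof eventually_elim
      case (elim u)
      have "norm (f u + g u - (s i u + r i u)) \<le> norm (f u - s i u) + norm (g u - r i u)"
        by (rule norm_diff_triangle_ineq)
      then have "ennreal (norm (f u + g u - (s i u + r i u))) \<le> ennreal (norm (f u - s i u)) + ennreal (norm (g u - r i u))"
        by (metis ennreal_leI ennreal_plus norm_ge_zero)
      then show ?case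
        using add_mono[OF elim] order_trans by blast
    qed
  next
    have "(\<lambda>i. (\<integral>\<^sup>+u. e i u \<partial>M) + (\<integral>\<^sup>+u. d i u \<partial>M)) \<longlonglongrightarrow> 0 + 0"
      by (intro tendsto_add s r)
    moreover have "(\<integral>\<^sup>+u. e i u + d i u \<partial>M) = (\<integral>\<^sup>+u. e i u \<partial>M) + (\<integral>\<^sup>+u. d i u \<partial>M)" for i
      by (rule nn_integral_add) (use s(2) r(2) in auto)
    ultimately show "(\<lambda>i. \<integral>\<^sup>+u. e i u + d i u \<partial>M) \<longlonglongrightarrow> 0"
      by simp
    have "sb_integral M (\<lambda>u. s i u + r i u) = sb_integral M (s i) + sb_integral M (r i)" for i
      by (rule Bochner_Integration.simple_bochner_integral_add) (use s(1) r(1) in auto)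
    then show "(\<lambda>i. sb_integral M (\<lambda>u. s i u + r i u)) \<longlonglongrightarrow> x + y"
      using tendsto_add[OF s(5) r(5)] by simp
  qed
qed

lemma mean_approx_sum:
  assumes "finite I" "\<And>i. i \<in> I \<Longrightarrow> mean_approx M (f i) (x i)"
  shows "mean_approx M (\<lambda>u. \<Sum>i\<in>I. f i u) (\<Sum>i\<in>I. x i)"
  using assms by (induction rule: finite_induct) (auto intro: mean_approx_zero mean_approx_add)

lemma mean_approx_linear:
  assumes T: "bounded_linear T" and f: "mean_approx M f x"
  shows "mean_approx M (\<lambda>u. T (f u)) (T x)"
proof -
  interpret T: bounded_linear T by fact
  obtain s e where s: "\<And>i::nat. sb_integrable M (s i)" "\<And>i. e i \<in> borel_measurable M"
    "\<And>i. AE u in M. ennreal (norm (f u - s i u)) \<le> e i u"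
    "(\<lambda>i. \<integral>\<^sup>+u. e i u \<partial>M) \<longlonglongrightarrow> 0" "(\<lambda>i. sb_integral M (s i)) \<longlonglongrightarrow> x"
    using mean_approxE[OF f] by blast
  obtain C where C: "C > 0" "\<And>z. norm (T z) \<le> norm z * C"
    using T.pos_bounded by blast
  show ?thesis
  proof (rule mean_approxI[of M "\<lambda>i u. T (s i u)" "\<lambda>i u. ennreal C * e i u"])
    fix i
    show "sb_integrable M (\<lambda>u. T (s i u))"
      using Bochner_Integration.simple_bochner_integrable_compose2[of "\<lambda>x y. T x" M "s i" "s i"]
        s(1) by (auto simp: T.zero)
    show "(\<lambda>u. ennreal C * e i u) \<in> borel_measurable M"
      using s(2)[of i] by measurable
    show "AE u in M. ennreal (norm (T (f u) - T (s i u))) \<le> ennreal C * e i u"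
      using s(3)[of i]
    proof eventually_elim
      case (elim u)
      have "norm (T (f u) - T (s i u)) \<le> C * norm (f u - s i u)"
        using C(2)[of "f u - s i u"] by (simp add: T.diff mult.commute)
      then have "ennreal (norm (T (f u) - T (s i u))) \<le> ennreal C * ennreal (norm (f u - s i u))"
        by (metis C(1) ennreal_leI ennreal_mult' less_imp_le)
      also have "\<dots> \<le> ennreal C * e i u"
        by (intro mult_left_mono elim) simp
      finally show ?case .
    qed
  next
    have "(\<integral>\<^sup>+u. ennreal C * e i u \<partial>M) = ennreal C * (\<integral>\<^sup>+u. e i u \<partial>M)" for i
      by (rule nn_integral_cmult) (rule s(2))
    moreover have "(\<lambda>i. ennreal C * (\<integral>\<^sup>+u. e i u \<partial>M)) \<longlonglongrightarrow> ennreal C * 0"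
      by (intro ennreal_tendsto_cmult s(4)) simp
    ultimately show "(\<lambda>i. \<integral>\<^sup>+u. ennreal C * e i u \<partial>M) \<longlonglongrightarrow> 0"
      by simp
    have "sb_integral M (\<lambda>u. T (s i u)) = T (sb_integral M (s i))" for i
      by (rule Bochner_Integration.simple_bochner_integral_linear[OF T.linear_axioms s(1)])
    then show "(\<lambda>i. sb_integral M (\<lambda>u. T (s i u))) \<longlonglongrightarrow> T x"
      using T.tendsto[OF s(5)] by simp
  qed
qed

lemma distr_translation_lebesgue_on:
  fixes a b c :: real
  shows "(\<lambda>u. u + c) \<in> measurable (lebesgue_on {a - c..b - c}) (lebesgue_on {a..b})"
    and "distr (lebesgue_on {a - c..b - c}) (lebesgue_on {a..b}) (\<lambda>u. u + c) = lebesgue_on {a..b}"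
proof -
  have T: "(\<lambda>u. u + c) \<in> measurable lebesgue lebesgue"
    using lebesgue_affine_measurable[of "\<lambda>_. 1::real" c] by (simp add: add.commute)
  have D: "distr lebesgue lebesgue (\<lambda>u. u + c) = lebesgue"
    using lebesgue_real_affine[of 1 c] by (simp add: density_1 add.commute)
  show T': "(\<lambda>u. u + c) \<in> measurable (lebesgue_on {a - c..b - c}) (lebesgue_on {a..b})"
    using T by (intro measurable_restrict_space3) auto
  show "distr (lebesgue_on {a - c..b - c}) (lebesgue_on {a..b}) (\<lambda>u. u + c) = lebesgue_on {a..b}"
  proof (rule measure_eqI)
    fix A assume "A \<in> sets (distr (lebesgue_on {a - c..b - c}) (lebesgue_on {a..b}) (\<lambda>u. u + c))"
    then have A: "A \<in> sets (lebesgue_on {a..b})"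
      by simp
    then have A': "A \<in> sets lebesgue" "A \<subseteq> {a..b}"
      by (auto simp: sets_restrict_space)
    have "emeasure (distr (lebesgue_on {a - c..b - c}) (lebesgue_on {a..b}) (\<lambda>u. u + c)) A
        = emeasure (lebesgue_on {a - c..b - c}) ((\<lambda>u. u + c) -` A \<inter> {a - c..b - c})"
      by (subst emeasure_distr[OF T' A]) simp
    also have "(\<lambda>u. u + c) -` A \<inter> {a - c..b - c} = (\<lambda>u. u + c) -` A"
      using A'(2) by auto
    also have "emeasure (lebesgue_on {a - c..b - c}) ((\<lambda>u. u + c) -` A) = emeasure lebesgue ((\<lambda>u. u + c) -` A)"
      using A'(2) by (intro emeasure_restrict_space) auto
    also have "\<dots> = emeasure (distr lebesgue lebesgue (\<lambda>u. u + c)) A"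
      by (subst emeasure_distr[OF T A'(1)]) simp
    also have "\<dots> = emeasure lebesgue A"
      by (simp add: D)
    also have "\<dots> = emeasure (lebesgue_on {a..b}) A"
      using A'(2) by (intro emeasure_restrict_space[symmetric]) auto
    finally show "emeasure (distr (lebesgue_on {a - c..b - c}) (lebesgue_on {a..b}) (\<lambda>u. u + c)) A
        = emeasure (lebesgue_on {a..b}) A" .
  qed simp
qed

lemma has_bochner_distr:
  assumes T: "T \<in> measurable M' M" and D: "distr M' M T = M" and surj: "T ` space M' = space M"
    and f: "has_bochner M f x"
  shows "has_bochner M' (\<lambda>u. f (T u)) x"
proof -
  obtain s where s: "\<And>i::nat. sb_integrable M (s i)"
    "(\<lambda>i. \<integral>\<^sup>+u. ennreal (norm (f u - s i u)) \<partial>M) \<longlonglongrightarrow> 0"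
    "(\<lambda>i. sb_integral M (s i)) \<longlonglongrightarrow> x" and f_meas: "f \<in> borel_measurable M"
    using f unfolding has_bochner_def by blast
  have meas: "(\<lambda>u. ennreal (norm (f u - s i u))) \<in> borel_measurable M" for i
    using borel_measurable_norm_diff_simple[OF f_meas sb_integrableD(1)[OF s(1)]] by measurable
  have em: "emeasure M' (T -` A \<inter> space M') = emeasure M A" if "A \<in> sets M" for A
    using emeasure_distr[OF T that] D by simp
  have level: "{u \<in> space M'. s i (T u) = y} = T -` {u \<in> space M. s i u = y} \<inter> space M'"
      "{u \<in> space M'. s i (T u) \<noteq> y} = T -` {u \<in> space M. s i u \<noteq> y} \<inter> space M'" for i y
    using measurable_space[OF T] by auto
  have sets: "{u \<in> space M. s i u = y} \<in> sets M" "{u \<in> space M. s i u \<noteq> y} \<in> sets M" for i y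
  proof -
    have "s i \<in> measurable M (count_space UNIV)"
      by (rule measurable_simple_function) (rule sb_integrableD[OF s(1)])
    from measurable_sets[OF this, of "{y}"] measurable_sets[OF this, of "- {y}"]
    show "{u \<in> space M. s i u = y} \<in> sets M" "{u \<in> space M. s i u \<noteq> y} \<in> sets M"
      by (simp_all add: vimage_def Int_def conj_commute)
  qed
  have img: "(\<lambda>u. s i (T u)) ` space M' = s i ` space M" for i
    using surj by (metis image_image)
  have "sb_integrable M' (\<lambda>u. s i (T u))" for i
  proof (rule Bochner_Integration.simple_bochner_integrable.intros)
    show "simple_function M' (\<lambda>u. s i (T u))"
      unfolding simple_function_def
    proof (intro conjI ballI)
      show "finite ((\<lambda>u. s i (T u)) ` space M')"
        unfolding img by (rule sb_integrableD(2)[OF s(1)])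
      fix y
      have "(\<lambda>u. s i (T u)) -` {y} \<inter> space M' = T -` {u \<in> space M. s i u = y} \<inter> space M'"
        using measurable_space[OF T] by auto
      also have "\<dots> \<in> sets M'"
        by (rule measurable_sets[OF T sets(1)])
      finally show "(\<lambda>u. s i (T u)) -` {y} \<inter> space M' \<in> sets M'" .
    qed
    show "emeasure M' {u \<in> space M'. s i (T u) \<noteq> 0} \<noteq> \<infinity>"
      unfolding level using em[OF sets(2)] sb_integrableD(3)[OF s(1)] by simp
  qed
  moreover have "(\<integral>\<^sup>+u. ennreal (norm (f (T u) - s i (T u))) \<partial>M') = (\<integral>\<^sup>+u. ennreal (norm (f u - s i u)) \<partial>M)" for i
    using nn_integral_distr[OF T, of "\<lambda>u. ennreal (norm (f u - s i u))"] meas D by simp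
  moreover have "sb_integral M' (\<lambda>u. s i (T u)) = sb_integral M (s i)" for i
    unfolding Bochner_Integration.simple_bochner_integral_def img
    using em[OF sets(1)] by (simp add: level measure_def)
  moreover have "(\<lambda>u. f (T u)) \<in> borel_measurable M'"
    using measurable_compose[OF T f_meas] .
  ultimately show ?thesis
    unfolding has_bochner_def using s(2,3)
    by (intro conjI) (assumption, intro exI[of _ "\<lambda>i u. s i (T u)"] conjI allI, simp_all)
qed

lemma has_bochner_translate:
  fixes a b c :: real
  assumes "has_bochner (lebesgue_on {a..b}) f x"
  shows "has_bochner (lebesgue_on {a - c..b - c}) (\<lambda>u. f (u + c)) x"
proof (rule has_bochner_distr[OF distr_translation_lebesgue_on _ assms])
  show "(\<lambda>u. u + c) ` space (lebesgue_on {a - c..b - c}) = space (lebesgue_on {a..b})"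
    by (force simp: image_iff intro: bexI[of _ "_ - c"])
qed

text \<open>
  The link to the gauge integral, which offers the fundamental theorem of calculus and an exchange of
  integrals for continuous functions into arbitrary Banach spaces.
\<close>
lemma simple_bochner_has_integral:
  fixes s :: "real \<Rightarrow> 'b::banach"
  assumes S: "S \<in> sets lebesgue" and s: "sb_integrable (lebesgue_on S) s"
  shows "(s has_integral sb_integral (lebesgue_on S) s) S"
proof -
  define B where "B y = {x \<in> S. s x = y}" for y
  have fin: "finite (s ` S)"
    using sb_integrableD(2)[OF s] by simp
  have ind: "((\<lambda>x. indicat_real (B y) x *\<^sub>R y) has_integral measure (lebesgue_on S) (B y) *\<^sub>R y) UNIV"
    if y: "y \<in> s ` S" for y
  proof (cases "y = 0")
    case False
    have "s -` {y} \<inter> space (lebesgue_on S) \<in> sets (lebesgue_on S)"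
      using sb_integrableD(1)[OF s] y by (auto simp: simple_function_def)
    also have "s -` {y} \<inter> space (lebesgue_on S) = B y"
      by (auto simp: B_def)
    finally have B1: "B y \<in> sets (lebesgue_on S)" .
    then have B2: "B y \<in> sets lebesgue"
      using S by (auto simp: sets_restrict_space)
    have eq: "emeasure (lebesgue_on S) (B y) = emeasure lebesgue (B y)"
      using S by (intro emeasure_restrict_space) (auto simp: B_def)
    have "B y \<subseteq> {x \<in> space (lebesgue_on S). s x \<noteq> 0}"
      using False by (auto simp: B_def)
    moreover have "{x \<in> space (lebesgue_on S). s x \<noteq> 0} \<in> sets (lebesgue_on S)"
    proof -
      have "s \<in> measurable (lebesgue_on S) (count_space UNIV)"
        by (rule measurable_simple_function) (rule sb_integrableD[OF s])
      from measurable_sets[OF this, of "- {0}"] show ?thesis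
        by (simp add: vimage_def Int_def conj_commute)
    qed
    ultimately have "emeasure (lebesgue_on S) (B y) \<le> emeasure (lebesgue_on S) {x \<in> space (lebesgue_on S). s x \<noteq> 0}"
      by (rule emeasure_mono)
    also have "\<dots> < \<infinity>"
      using sb_integrableD(3)[OF s] by (simp add: less_top)
    finally have "B y \<in> lmeasurable"
      using B2 eq by (simp add: fmeasurable_def)
    then have "(indicat_real (B y) has_integral measure lebesgue (B y)) UNIV"
      by (simp add: lmeasurable_iff_indicator_has_integral[symmetric])
    moreover have "measure lebesgue (B y) = measure (lebesgue_on S) (B y)"
      using eq by (simp add: measure_def)
    ultimately show ?thesis
      using has_integral_scaleR_left by metis
  qed simp
  have "((\<lambda>x. \<Sum>y\<in>s ` S. indicat_real (B y) x *\<^sub>R y) has_integral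
      (\<Sum>y\<in>s ` S. measure (lebesgue_on S) (B y) *\<^sub>R y)) UNIV"
    by (intro has_integral_sum fin ind)
  moreover have "(\<Sum>y\<in>s ` S. measure (lebesgue_on S) (B y) *\<^sub>R y) = sb_integral (lebesgue_on S) s"
    by (simp add: Bochner_Integration.simple_bochner_integral_def B_def)
  moreover have "(\<Sum>y\<in>s ` S. indicat_real (B y) x *\<^sub>R y) = (if x \<in> S then s x else 0)" for x
  proof (cases "x \<in> S")
    case True
    then have "(\<Sum>y\<in>s ` S. indicat_real (B y) x *\<^sub>R y) = (\<Sum>y\<in>s ` S. if y = s x then y else 0)"
      by (intro sum.cong) (auto simp: B_def)
    also have "\<dots> = s x"
      using fin True by (simp add: sum.delta')
    finally show ?thesis
      using True by simp
  next
    case False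
    then have "indicat_real (B y) x = 0" for y
      by (simp add: B_def)
    with False show ?thesis
      by simp
  qed
  ultimately have "((\<lambda>x. if x \<in> S then s x else 0) has_integral sb_integral (lebesgue_on S) s) UNIV"
    by simp
  then show ?thesis
    by (simp add: has_integral_restrict_UNIV)
qed

lemma has_bochner_of_approx:
  fixes F :: "real \<Rightarrow> 'b::banach"
  assumes S: "S \<in> sets lebesgue" and F: "F \<in> borel_measurable (lebesgue_on S)" "F integrable_on S"
    and s: "\<And>i::nat. sb_integrable (lebesgue_on S) (s i)"
    and lim: "(\<lambda>i. \<integral>\<^sup>+u. ennreal (norm (F u - s i u)) \<partial>lebesgue_on S) \<longlonglongrightarrow> 0"
  shows "has_bochner (lebesgue_on S) F (integral S F)"
proof -
  let ?e = "\<lambda>i. \<integral>\<^sup>+u. ennreal (norm (F u - s i u)) \<partial>lebesgue_on S"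
  have bound: "norm (integral S F - sb_integral (lebesgue_on S) (s i)) \<le> enn2real (?e i)"
    if fin: "?e i < top" for i
  proof -
    have meas: "(\<lambda>u. norm (F u - s i u)) \<in> borel_measurable (lebesgue_on S)"
      by (rule borel_measurable_norm_diff_simple[OF F(1) sb_integrableD(1)[OF s]])
    have int: "integrable (lebesgue_on S) (\<lambda>u. norm (F u - s i u))"
      using fin by (intro integrableI_nonneg meas) auto
    have "integral\<^sup>L (lebesgue_on S) (\<lambda>u. norm (F u - s i u)) = enn2real (?e i)"
      by (rule integral_eq_nn_integral[OF meas]) simp
    then have hi: "((\<lambda>u. norm (F u - s i u)) has_integral enn2real (?e i)) S"
      using has_integral_integral_lebesgue_on[OF int S] by simp
    have d: "((\<lambda>u. F u - s i u) has_integral (integral S F - sb_integral (lebesgue_on S) (s i))) S"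
      by (intro has_integral_diff integrable_integral F(2) simple_bochner_has_integral S s)
    have "norm (integral S (\<lambda>u. F u - s i u)) \<le> integral S (\<lambda>u. norm (F u - s i u))"
      by (rule integral_norm_bound_integral) (use d hi in \<open>auto simp: has_integral_iff\<close>)
    then show ?thesis
      using d hi by (simp add: has_integral_iff)
  qed
  have ev: "\<forall>\<^sub>F i in sequentially. ?e i < top"
    using order_tendstoD(2)[OF lim, of top] by simp
  have "(\<lambda>i. enn2real (?e i)) \<longlonglongrightarrow> 0"
    by (rule tendsto_enn2real) (use lim in simp_all)
  then have "(\<lambda>i. sb_integral (lebesgue_on S) (s i) - integral S F) \<longlonglongrightarrow> 0"
  proof (rule Lim_null_comparison[rotated])
    show "\<forall>\<^sub>F i in sequentially. norm (sb_integral (lebesgue_on S) (s i) - integral S F) \<le> enn2real (?e i)"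
      using ev by eventually_elim (use bound norm_minus_commute in metis)
  qed
  then have "(\<lambda>i. sb_integral (lebesgue_on S) (s i)) \<longlonglongrightarrow> integral S F"
    by (simp add: LIM_zero_iff)
  then show ?thesis
    unfolding has_bochner_def using F(1) s lim by blast
qed

text \<open>
  A continuous function is the pointwise limit of its values at the grid points \<open>q N x\<close>, cut off where
  they are far out.  The majorant \<open>w\<close> controls \<open>F\<close> on all of \<open>[x - 1, x]\<close> because the grid point lies
  in this interval.
\<close>
lemma has_bochner_continuous:
  fixes F :: "real \<Rightarrow> 'b::banach"
  assumes S: "S \<in> sets lebesgue" and F: "continuous_on UNIV F" "F integrable_on S"
    and w: "integrable (lebesgue_on S) w" "\<And>x z. x \<in> S \<Longrightarrow> x - 1 \<le> z \<Longrightarrow> z \<le> x \<Longrightarrow> norm (F z) \<le> w x"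
  shows "has_bochner (lebesgue_on S) F (integral S F)"
proof -
  let ?M = "lebesgue_on S"
  define q where "q N x = of_int \<lfloor>real (Suc N) * x\<rfloor> / real (Suc N)" for N x
  define H where "H N k = (if \<bar>k\<bar> \<le> int (Suc N) ^ 2 then F (of_int k / real (Suc N)) else 0)" for N k
  define s where "s N x = H N \<lfloor>real (Suc N) * x\<rfloor>" for N x
  have q_le: "q N x \<le> x" "x - 1 / real (Suc N) \<le> q N x" for N x
  proof -
    have "of_int \<lfloor>real (Suc N) * x\<rfloor> \<le> real (Suc N) * x" "real (Suc N) * x - 1 \<le> of_int \<lfloor>real (Suc N) * x\<rfloor>"
      by linarith+
    then have "q N x \<le> real (Suc N) * x / real (Suc N)"
        "(real (Suc N) * x - 1) / real (Suc N) \<le> q N x"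
      unfolding q_def using divide_right_mono[of _ _ "real (Suc N)"] of_nat_0_le_iff by blast+
    then show "q N x \<le> x" "x - 1 / real (Suc N) \<le> q N x"
      by (simp_all add: diff_divide_distrib)
  qed
  have q_ge: "x - 1 \<le> q N x" for N x
  proof -
    have "1 / real (Suc N) \<le> 1"
      by simp
    with q_le(2)[of x N] show ?thesis
      by linarith
  qed
  have s_eq: "s N x = (if \<bar>\<lfloor>real (Suc N) * x\<rfloor>\<bar> \<le> int (Suc N) ^ 2 then F (q N x) else 0)" for N x
    by (simp add: s_def H_def q_def)
  have s_w: "norm (s N x) \<le> w x" if "x \<in> S" for N x
    using w(2)[OF that q_ge q_le(1), of N] unfolding s_eq
    by (auto intro: order_trans[OF norm_ge_zero])
  have F_meas: "F \<in> borel_measurable ?M"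
    using borel_measurable_continuous_onI[OF F(1)]
    by (intro measurable_restrict_space1 measurable_completion) simp
  have floor_meas: "(\<lambda>x. \<lfloor>real (Suc N) * x\<rfloor>) \<in> measurable ?M (count_space UNIV)" for N
    by (intro measurable_restrict_space1 measurable_completion) measurable
  have simple: "simple_function ?M (s N)" for N
    unfolding simple_function_def
  proof (intro conjI ballI)
    have "s N ` space ?M \<subseteq> insert 0 (H N ` {- (int (Suc N) ^ 2)..int (Suc N) ^ 2})"
      unfolding s_def by (auto simp: H_def abs_le_iff)
    then show "finite (s N ` space ?M)"
      by (rule finite_subset) auto
    fix y
    have "s N -` {y} \<inter> space ?M = (\<lambda>x. \<lfloor>real (Suc N) * x\<rfloor>) -` (H N -` {y}) \<inter> space ?M"
      by (auto simp: s_def)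
    also have "\<dots> \<in> sets ?M"
      by (rule measurable_sets[OF floor_meas]) simp
    finally show "s N -` {y} \<inter> space ?M \<in> sets ?M" .
  qed
  have w_fin: "(\<integral>\<^sup>+x. ennreal (norm (w x)) \<partial>?M) < \<infinity>"
    using w(1) by (simp add: integrable_iff_bounded)
  have w_nonneg: "0 \<le> w x" if "x \<in> S" for x
    using s_w[OF that] norm_ge_zero order_trans by blast
  have "sb_integrable ?M (s N)" for N
  proof (rule Bochner_Integration.simple_bochner_integrableI_bounded[OF simple])
    have "(\<integral>\<^sup>+x. ennreal (norm (s N x)) \<partial>?M) \<le> (\<integral>\<^sup>+x. ennreal (norm (w x)) \<partial>?M)"
      using s_w w_nonneg by (intro nn_integral_mono ennreal_leI) auto
    then show "(\<integral>\<^sup>+x. ennreal (norm (s N x)) \<partial>?M) < \<infinity>"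
      using w_fin by (rule le_less_trans)
  qed
  moreover have "(\<lambda>N. \<integral>\<^sup>+x. ennreal (norm (F x - s N x)) \<partial>?M) \<longlonglongrightarrow> (\<integral>\<^sup>+x. 0 \<partial>?M)"
  proof (rule nn_integral_dominated_convergence[where w = "\<lambda>x. 2 * ennreal (norm (w x))"])
    show "(\<lambda>x. ennreal (norm (F x - s N x))) \<in> borel_measurable ?M" for N
      using borel_measurable_norm_diff_simple[OF F_meas simple] by measurable
    show "(\<lambda>x. 2 * ennreal (norm (w x))) \<in> borel_measurable ?M"
      using w(1) by measurable
    show "(\<integral>\<^sup>+x. 2 * ennreal (norm (w x)) \<partial>?M) < \<infinity>"
      using w_fin w(1) by (subst nn_integral_cmult) (auto simp: ennreal_mult_less_top)
    show "AE x in ?M. ennreal (norm (F x - s N x)) \<le> 2 * ennreal (norm (w x))" for N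
    proof (rule AE_I2)
      fix x assume "x \<in> space ?M"
      then have x: "x \<in> S" by simp
      have "norm (F x - s N x) \<le> norm (F x) + norm (s N x)"
        by (rule norm_triangle_ineq4)
      also have "\<dots> \<le> 2 * norm (w x)"
        using s_w[OF x, of N] w(2)[OF x, of x] by (simp add: abs_of_nonneg[OF w_nonneg[OF x]])
      finally show "ennreal (norm (F x - s N x)) \<le> 2 * ennreal (norm (w x))"
        by (metis ennreal_leI ennreal_mult' ennreal_numeral zero_le_numeral)
    qed
    show "AE x in ?M. (\<lambda>N. ennreal (norm (F x - s N x))) \<longlonglongrightarrow> 0"
    proof (rule AE_I2)
      fix x
      have "(\<lambda>N. x - 1 / real (Suc N)) \<longlonglongrightarrow> x - 0"
        by (intro tendsto_intros LIMSEQ_Suc lim_1_over_n)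
      then have "(\<lambda>N. q N x) \<longlonglongrightarrow> x"
        using tendsto_sandwich[of "\<lambda>N. x - 1 / real (Suc N)" "\<lambda>N. q N x" sequentially "\<lambda>_. x" x] q_le
        by simp
      then have "(\<lambda>N. F (q N x)) \<longlonglongrightarrow> F x"
        using F(1) by (intro continuous_on_tendsto_compose[OF F(1)]) auto
      moreover have "\<forall>\<^sub>F N in sequentially. F (q N x) = s N x"
      proof -
        obtain N0 :: nat where N0: "\<bar>x\<bar> + 1 \<le> real N0"
          using real_arch_simple by blast
        have "\<bar>\<lfloor>real (Suc N) * x\<rfloor>\<bar> \<le> int (Suc N) ^ 2" if "N \<ge> N0" for N
        proof -
          have "\<bar>real_of_int \<lfloor>real (Suc N) * x\<rfloor>\<bar> \<le> \<bar>real (Suc N) * x\<bar> + 1"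
            by linarith
          also have "\<dots> \<le> real (Suc N) * (\<bar>x\<bar> + 1)"
            unfolding abs_mult abs_of_nat distrib_left mult_1_right by simp
          also have "\<dots> \<le> real (Suc N) * real (Suc N)"
            using N0 that by (intro mult_left_mono) auto
          finally have "of_int \<bar>\<lfloor>real (Suc N) * x\<rfloor>\<bar> \<le> (of_int (int (Suc N) ^ 2) :: real)"
            by (simp add: power2_eq_square)
          then show ?thesis
            by (simp only: of_int_le_iff)
        qed
        then show ?thesis
          unfolding eventually_sequentially s_eq by (intro exI[of _ N0]) auto
      qed
      ultimately have "(\<lambda>N. s N x) \<longlonglongrightarrow> F x"
        using tendsto_cong by fast
      then have "(\<lambda>N. norm (F x - s N x)) \<longlonglongrightarrow> norm (F x - F x)"
        by (intro tendsto_intros)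
      then show "(\<lambda>N. ennreal (norm (F x - s N x))) \<longlonglongrightarrow> 0"
        using tendsto_ennrealI by fastforce
    qed
  qed simp
  ultimately show ?thesis
    by (intro has_bochner_of_approx[OF S F_meas F(2), of s]) simp_all
qed

lemma has_bochner_continuous_Icc:
  fixes F :: "real \<Rightarrow> 'b::banach"
  assumes F: "continuous_on UNIV F"
  shows "has_bochner (lebesgue_on {a..b}) F (integral {a..b} F)"
proof -
  have "compact (F ` {a - 1..b})"
    using F continuous_on_subset by (intro compact_continuous_image) auto
  then have "bounded (F ` {a - 1..b})"
    by (rule compact_imp_bounded)
  then obtain C where "\<forall>y\<in>F ` {a - 1..b}. norm y \<le> C"
    unfolding bounded_iff by (elim exE)
  then have C: "norm (F x) \<le> C" if "x \<in> {a - 1..b}" for x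
    using that by blast
  show ?thesis
  proof (rule has_bochner_continuous[OF _ F])
    show "F integrable_on {a..b}"
      using F continuous_on_subset by (intro integrable_continuous_real) auto
    show "integrable (lebesgue_on {a..b}) (\<lambda>_. C)"
      by (intro finite_measure.integrable_const finite_measure_lebesgue_on) simp
  qed (use C in auto)
qed

lemma continuous_imp_L1loc: "continuous_on UNIV f \<Longrightarrow> f \<in> L1loc"
  unfolding L1loc_def bochner_integrable_def using has_bochner_continuous_Icc by blast

section \<open>Means of solutions\<close>

lemma bounded_linear_matrix_scaleC:
  fixes A :: "complex^'r^'r"
  shows "bounded_linear (\<lambda>x :: 'a::complex_banach^'r. A *v\<^sub>C x)"
proof (rule bounded_linear_intro[where K = "\<Sum>i\<in>UNIV. \<Sum>j\<in>UNIV. cmod (A $ i $ j)"])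
  fix x y :: "'a^'r" and c :: real
  show "A *v\<^sub>C (x + y) = A *v\<^sub>C x + A *v\<^sub>C y"
    by (simp add: matrix_scaleC_def vec_eq_iff scaleC_add_right sum.distrib)
  show "A *v\<^sub>C (c *\<^sub>R x) = c *\<^sub>R (A *v\<^sub>C x)"
    by (simp add: matrix_scaleC_def vec_eq_iff scaleC.scaleR_right scaleR_sum_right)
  have "norm (A *v\<^sub>C x) \<le> (\<Sum>i\<in>UNIV. norm ((A *v\<^sub>C x) $ i))"
    unfolding norm_vec_def by (rule L2_set_le_sum) simp
  also have "\<dots> \<le> (\<Sum>i\<in>UNIV. \<Sum>j\<in>UNIV. cmod (A $ i $ j) * norm x)"
  proof (rule sum_mono)
    fix i
    have "norm ((A *v\<^sub>C x) $ i) \<le> (\<Sum>j\<in>UNIV. norm (A $ i $ j *\<^sub>C x $ j))"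
      unfolding matrix_scaleC_def by simp (rule norm_sum)
    also have "\<dots> \<le> (\<Sum>j\<in>UNIV. cmod (A $ i $ j) * norm x)"
      unfolding norm_scaleC by (intro sum_mono mult_left_mono Finite_Cartesian_Product.norm_nth_le) simp
    finally show "norm ((A *v\<^sub>C x) $ i) \<le> (\<Sum>j\<in>UNIV. cmod (A $ i $ j) * norm x)" .
  qed
  finally show "norm (A *v\<^sub>C x) \<le> norm x * (\<Sum>i\<in>UNIV. \<Sum>j\<in>UNIV. cmod (A $ i $ j))"
    by (simp add: sum_distrib_left mult.commute)
qed

lemma has_vector_derivative_translate:
  assumes "(f has_vector_derivative D) (at (t + h :: real))"
  shows "((\<lambda>u. f (u + h)) has_vector_derivative D) (at t)"
proof -
  have "((\<lambda>u. u + h) has_vector_derivative 1 + 0) (at t)"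
    by (intro has_vector_derivative_add has_vector_derivative_id has_vector_derivative_const)
  then show ?thesis
    using vector_diff_chain_at[of "\<lambda>u. u + h" 1 t f D] assms by (simp add: o_def)
qed

text \<open>
  The integral over \<open>[t, t + h]\<close> is a difference of values of an antiderivative, which is needed only
  near \<open>t\<close>.
\<close>
lemma integral_translate_eq_antiderivative:
  fixes v :: "real \<Rightarrow> 'b::banach"
  assumes v: "continuous_on UNIV v" and h: "h > 0"
  shows "((\<lambda>t. integral {0..h} (\<lambda>s. v (t + s))) has_vector_derivative v (t + h) - v t) (at t)"
proof -
  obtain G where G: "\<And>x. x \<in> {t - 1..t + h + 1} \<Longrightarrow>
      (G has_vector_derivative v x) (at x within {t - 1..t + h + 1})"
    using antiderivative_continuous[OF continuous_on_subset[OF v subset_UNIV]] by blast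
  have eq: "integral {0..h} (\<lambda>s. v (u + s)) = G (u + h) - G u" if u: "u \<in> {t - 1<..<t + 1}" for u
  proof -
    have "(v has_integral (G (u + h) - G u)) {u..u + h}"
      using u h by (intro fundamental_theorem_of_calculus has_vector_derivative_within_subset[OF G]) auto
    then have "((\<lambda>s. v (s + u)) has_integral (G (u + h) - G u)) {u - u..u + h - u}"
      using has_integral_shift_Icc_real[of v u "G (u + h) - G u" 0 h] by (simp add: o_def add.commute)
    then show ?thesis
      by (simp add: has_integral_iff add.commute)
  qed
  have G': "(G has_vector_derivative v x) (at x)" if "x \<in> {t - 1<..<t + h + 1}" for x
  proof -
    have "(G has_vector_derivative v x) (at x within {t - 1<..<t + h + 1})"
      by (rule has_vector_derivative_within_subset[OF G]) (use that in auto)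
    then show ?thesis
      using at_within_open[OF that] by simp
  qed
  have "((\<lambda>u. G (u + h)) has_vector_derivative v (t + h)) (at t)"
    using G'[of "t + h"] h by (intro has_vector_derivative_translate) simp
  moreover have "(G has_vector_derivative v t) (at t)"
    using G'[of t] h by simp
  ultimately have "((\<lambda>u. G (u + h) - G u) has_vector_derivative v (t + h) - v t) (at t)"
    by (auto intro: has_vector_derivative_diff)
  then show ?thesis
    by (rule has_vector_derivative_transform_within_open[of _ _ _ "{t - 1<..<t + 1}"]) (use eq in auto)
qed

lemma has_bochner_mean:
  assumes v: "v \<in> L1loc" and h: "h > 0"
  shows "has_bochner (lebesgue_on {0..h}) (\<lambda>s. v (t + s)) (h *\<^sub>R mean h v t)"
proof -
  obtain x where "has_bochner (lebesgue_on {t..t + h}) v x"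
    using v by (auto simp: L1loc_def bochner_integrable_def)
  from has_bochner_translate[OF this, of t]
  have "has_bochner (lebesgue_on {0..h}) (\<lambda>s. v (t + s)) x"
    by (simp add: add.commute)
  moreover from this have "mean h v t = (1 / h) *\<^sub>R x"
    by (simp add: mean_def bochner_integral_eq)
  ultimately show ?thesis
    using h by simp
qed

lemma mean_continuous:
  assumes v: "continuous_on UNIV v"
  shows "mean h v t = (1 / h) *\<^sub>R integral {0..h} (\<lambda>s. v (t + s))"
proof -
  have "continuous_on UNIV (\<lambda>s. v (t + s))"
    by (intro continuous_on_compose2[OF v] continuous_intros) auto
  from bochner_integral_eq[OF has_bochner_continuous_Icc[OF this]] show ?thesis
    by (simp add: mean_def)
qed

lemma W1loc_continuous:
  assumes "W1loc_derivs n y D" "k < n"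
  shows "continuous_on UNIV (D k)"
proof (cases "k = n - 1")
  case True
  with assms show ?thesis
    by (simp add: W1loc_derivs_def)
next
  case False
  with assms have "(D k has_vector_derivative D (Suc k) t) (at t)" for t
    by (simp add: W1loc_derivs_def)
  then show ?thesis
    by (meson has_vector_derivative_continuous continuous_at_imp_continuous_on)
qed

lemma W1loc_has_bochner:
  assumes D: "W1loc_derivs n y D" and k: "k < n" and ab: "a \<le> b"
  shows "has_bochner (lebesgue_on {a..b}) (D (Suc k)) (D k b - D k a)"
proof (cases "Suc k = n")
  case True
  then have "k = n - 1"
    by simp
  with True D ab show ?thesis
    by (simp add: W1loc_derivs_def)
next
  case False
  then have k': "Suc k < n" "k < n - 1"
    using k by auto
  then have der: "(D k has_vector_derivative D (Suc k) t) (at t)" for t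
    using D by (auto simp: W1loc_derivs_def)
  have "(D (Suc k) has_integral (D k b - D k a)) {a..b}"
    by (rule fundamental_theorem_of_calculus[OF ab has_vector_derivative_at_within[OF der]])
  with has_bochner_continuous_Icc[OF W1loc_continuous[OF D k'(1)], of a b] show ?thesis
    by (simp add: has_integral_iff)
qed

text \<open>
  The derivatives of \<open>mean h y\<close> for derivatives \<open>D\<close> of \<open>y\<close>: the mean of a derivative is a difference
  quotient, which gains one order of differentiability.
\<close>
definition mean_derivs :: "real \<Rightarrow> (real \<Rightarrow> 'b::banach) \<Rightarrow> (nat \<Rightarrow> real \<Rightarrow> 'b) \<Rightarrow> nat \<Rightarrow> real \<Rightarrow> 'b"
  where "mean_derivs h y D k = (case k of 0 \<Rightarrow> mean h y | Suc k \<Rightarrow> \<lambda>t. (1 / h) *\<^sub>R (D k (t + h) - D k t))"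

lemma mean_derivs_simps [simp]:
  "mean_derivs h y D 0 = mean h y"
  "mean_derivs h y D (Suc k) = (\<lambda>t. (1 / h) *\<^sub>R (D k (t + h) - D k t))"
  by (simp_all add: mean_derivs_def)

lemma mean_derivs_has_derivative:
  assumes D: "W1loc_derivs n y D" and h: "h > 0" and k: "k < n"
  shows "(mean_derivs h y D k has_vector_derivative mean_derivs h y D (Suc k) t) (at t)"
proof (cases k)
  case 0
  then have cont: "continuous_on UNIV y"
    using W1loc_continuous[OF D, of 0] k D by (simp add: W1loc_derivs_def)
  have D0: "D 0 = y"
    using D by (simp add: W1loc_derivs_def)
  have "((\<lambda>t. (1 / h) *\<^sub>R integral {0..h} (\<lambda>s. y (t + s))) has_vector_derivative
      (1 / h) *\<^sub>R (y (t + h) - y t)) (at t)"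
    using bounded_linear.has_vector_derivative[OF bounded_linear_scaleR_right
        integral_translate_eq_antiderivative[OF cont h]] by simp
  moreover have "mean h y = (\<lambda>t. (1 / h) *\<^sub>R integral {0..h} (\<lambda>s. y (t + s)))"
    by (rule ext) (rule mean_continuous[OF cont])
  ultimately show ?thesis
    by (simp add: 0 D0)
next
  case (Suc q)
  with k have der: "(D q has_vector_derivative D k t) (at t)" for t
    using D by (auto simp: W1loc_derivs_def)
  have "((\<lambda>t. D q (t + h)) has_vector_derivative D k (t + h)) (at t)"
    by (intro has_vector_derivative_translate der)
  then have "((\<lambda>t. D q (t + h) - D q t) has_vector_derivative D k (t + h) - D k t) (at t)"
    using der[of t] by (auto intro: has_vector_derivative_diff)
  then have "((\<lambda>t. (1 / h) *\<^sub>R (D q (t + h) - D q t)) has_vector_derivative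
      (1 / h) *\<^sub>R (D k (t + h) - D k t)) (at t)"
    by (rule bounded_linear.has_vector_derivative[OF bounded_linear_scaleR_right])
  then show ?thesis
    by (simp add: Suc)
qed

lemma mean_derivs_continuous:
  assumes D: "W1loc_derivs n y D" and h: "h > 0" and k: "k \<le> n" "n \<ge> 1"
  shows "continuous_on UNIV (mean_derivs h y D k)"
proof (cases k)
  case 0
  then show ?thesis
    using mean_derivs_has_derivative[OF D h, of 0] k
    by (meson has_vector_derivative_continuous continuous_at_imp_continuous_on less_le_trans zero_less_one)
next
  case (Suc q)
  then have "continuous_on UNIV (D q)"
    using W1loc_continuous[OF D, of q] k by simp
  then show ?thesis
    unfolding Suc mean_derivs_simps
    by (intro continuous_intros continuous_on_compose2[of UNIV "D q" UNIV "\<lambda>t. t + h"]) auto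
qed

lemma W1loc_mean:
  assumes D: "W1loc_derivs n y D" and h: "h > 0" and y: "n = 0 \<Longrightarrow> mean h y \<in> L1loc"
  shows "W1loc_derivs n (mean h y) (mean_derivs h y D)"
proof (cases n)
  case 0
  with y show ?thesis
    by (simp add: W1loc_derivs_def)
next
  case (Suc m)
  have der: "(mean_derivs h y D k has_vector_derivative mean_derivs h y D (Suc k) t) (at t)" if "k < n" for k t
    using mean_derivs_has_derivative[OF D h that] .
  have cont: "continuous_on UNIV (mean_derivs h y D k)" if "k \<le> n" for k
    using mean_derivs_continuous[OF D h that] Suc by simp
  have "has_bochner (lebesgue_on {a..b}) (mean_derivs h y D n) (mean_derivs h y D m b - mean_derivs h y D m a)"
    if "a \<le> b" for a b
  proof -
    have "(mean_derivs h y D m has_vector_derivative mean_derivs h y D n x) (at x within {a..b})" for x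
      using has_vector_derivative_at_within[OF der[of m x]] Suc by (simp del: mean_derivs_simps)
    then have "(mean_derivs h y D n has_integral (mean_derivs h y D m b - mean_derivs h y D m a)) {a..b}"
      by (rule fundamental_theorem_of_calculus[OF that])
    with has_bochner_continuous_Icc[OF cont[of n], of a b] show ?thesis
      by (simp add: has_integral_iff)
  qed
  with der cont continuous_imp_L1loc[OF cont[of n]] Suc show ?thesis
    by (simp add: W1loc_derivs_def del: mean_derivs_simps(2))
qed

text \<open>
  Both sides of the equation are integrated over \<open>[s, s + h]\<close>.  The right-hand side is Bochner
  integrable by assumption, so a \<open>mean_approx\<close> value of the left-hand side identifies its integral.
\<close>
lemma mean_equation:
  fixes y f :: "real \<Rightarrow> 'a::complex_banach^'r" and t :: "nat \<Rightarrow> real"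
  assumes D: "W1loc_derivs n y D" and h: "h > 0" and y: "y \<in> L1loc" and f: "f \<in> L1loc"
    and eq: "AE s in lebesgue. (\<Sum>k=0..n. \<Sum>j=1..m. a j k *v\<^sub>C D k (s + t j)) = f s"
  shows "(\<Sum>k=0..n. \<Sum>j=1..m. a j k *v\<^sub>C mean_derivs h y D k (s + t j)) = mean h f s"
proof -
  have D0: "D 0 = y"
    using D by (simp add: W1loc_derivs_def)
  have piece: "mean_approx (lebesgue_on {0..h}) (\<lambda>u. D k ((s + t j) + u)) (h *\<^sub>R mean_derivs h y D k (s + t j))"
    if "k \<le> n" for k j
  proof (cases k)
    case 0
    then show ?thesis
      using has_bochner_imp_mean_approx[OF has_bochner_mean[OF y h]] D0 by simp
  next
    case (Suc q)
    then have "q < n"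
      using that by simp
    from has_bochner_translate[OF W1loc_has_bochner[OF D this, of "s + t j" "s + t j + h"], of "s + t j"] h
    have "has_bochner (lebesgue_on {0..h}) (\<lambda>u. D k ((s + t j) + u)) (D q (s + t j + h) - D q (s + t j))"
      by (simp add: Suc add.commute)
    from has_bochner_imp_mean_approx[OF this] show ?thesis
      using h by (simp add: Suc)
  qed
  have piece': "mean_approx (lebesgue_on {0..h}) (\<lambda>u. a j k *v\<^sub>C D k ((s + t j) + u))
      (a j k *v\<^sub>C (h *\<^sub>R mean_derivs h y D k (s + t j)))" if "k \<le> n" for k j
    using mean_approx_linear[OF bounded_linear_matrix_scaleC[of "a j k"] piece[OF that, of j]] .
  have "mean_approx (lebesgue_on {0..h}) (\<lambda>u. \<Sum>k=0..n. \<Sum>j=1..m. a j k *v\<^sub>C D k ((s + t j) + u))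
      (\<Sum>k=0..n. \<Sum>j=1..m. a j k *v\<^sub>C (h *\<^sub>R mean_derivs h y D k (s + t j)))"
    by (intro mean_approx_sum piece') auto
  moreover have "AE u in lebesgue_on {0..h}. (\<Sum>k=0..n. \<Sum>j=1..m. a j k *v\<^sub>C D k ((s + t j) + u)) = f (s + u)"
  proof -
    define N where "N = {u. (\<Sum>k=0..n. \<Sum>j=1..m. a j k *v\<^sub>C D k (u + t j)) \<noteq> f u}"
    have "negligible N"
    proof -
      obtain N' where N': "{u \<in> space lebesgue. \<not> (\<Sum>k=0..n. \<Sum>j=1..m. a j k *v\<^sub>C D k (u + t j)) = f u} \<subseteq> N'"
          "emeasure lebesgue N' = 0" "N' \<in> sets lebesgue"
        using AE_E[OF eq] .
      then have "negligible N'"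
        by (simp add: negligible_iff_null_sets null_sets_def)
      then show ?thesis
        by (rule negligible_subset) (use N'(1) in \<open>simp add: N_def\<close>)
    qed
    then have "negligible ((+) (- s) ` N)"
      by (rule negligible_translation)
    then have "AE u in lebesgue. u \<notin> (+) (- s) ` N"
      by (intro AE_not_in) (simp add: negligible_iff_null_sets)
    then have "AE u in lebesgue. (\<Sum>k=0..n. \<Sum>j=1..m. a j k *v\<^sub>C D k ((s + t j) + u)) = f (s + u)"
    proof eventually_elim
      case (elim u)
      have "s + u \<notin> N"
      proof
        assume "s + u \<in> N"
        then have "- s + (s + u) \<in> (+) (- s) ` N"
          by blast
        with elim show False
          by simp
      qed
      then show ?case
        by (simp add: N_def add_ac)
    qed
    then show ?thesis
      by (subst AE_restrict_space_iff) auto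
  qed
  ultimately have "mean_approx (lebesgue_on {0..h}) (\<lambda>u. f (s + u))
      (\<Sum>k=0..n. \<Sum>j=1..m. a j k *v\<^sub>C (h *\<^sub>R mean_derivs h y D k (s + t j)))"
    by (rule mean_approx_AE_cong)
  then have "(\<Sum>k=0..n. \<Sum>j=1..m. a j k *v\<^sub>C (h *\<^sub>R mean_derivs h y D k (s + t j))) = h *\<^sub>R mean h f s"
    using has_bochner_imp_mean_approx[OF has_bochner_mean[OF f h]] mean_approx_unique by blast
  then have "h *\<^sub>R (\<Sum>k=0..n. \<Sum>j=1..m. a j k *v\<^sub>C mean_derivs h y D k (s + t j)) = h *\<^sub>R mean h f s"
    by (simp add: scaleR_sum_right linear_cmul[OF bounded_linear.linear[OF bounded_linear_matrix_scaleC]])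
  then show ?thesis
    using h by simp
qed

lemma is_solution_mean:
  fixes y f :: "real \<Rightarrow> 'a::complex_banach^'r"
  assumes sol: "is_solution m n t a f y" and h: "h > 0" and y: "y \<in> L1loc" "mean h y \<in> L1loc"
    and f: "f \<in> L1loc"
  shows "is_solution m n t a (mean h f) (mean h y)"
proof -
  obtain D where D: "W1loc_derivs n y D"
    "AE s in lebesgue. (\<Sum>k=0..n. \<Sum>j=1..m. a j k *v\<^sub>C D k (s + t j)) = f s"
    using sol by (auto simp: is_solution_def)
  show ?thesis
    unfolding is_solution_def
    by (rule exI[of _ "mean_derivs h y D"], intro conjI AE_I2 W1loc_mean[OF D(1) h y(2)] mean_equation[OF D(1) h y(1) f D(2)])
qed

section \<open>Integration of functions of quadratic decay\<close>

definition weight :: "real \<Rightarrow> real"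
  where "weight s = 1 / (1 + s\<^sup>2)"

lemma weight_pos: "weight s > 0"
  by (simp add: weight_def add_pos_nonneg)

lemma weight_continuous: "continuous_on S weight"
proof -
  have "1 + s\<^sup>2 \<noteq> (0::real)" for s
    using zero_le_power2[of s] by linarith
  then show ?thesis
    unfolding weight_def by (intro continuous_intros) auto
qed

text \<open>
  The integrals over \<open>[-k, k]\<close> are differences of arctangents, hence bounded.
\<close>
lemma weight_integrable: "weight integrable_on UNIV"
proof -
  have arctan: "(weight has_integral (arctan b - arctan a)) {a..b}" if "a \<le> b" for a b
    by (rule fundamental_theorem_of_calculus[OF that])
      (auto simp: weight_def inverse_eq_divide has_real_derivative_iff_has_vector_derivative[symmetric]
        intro!: derivative_eq_intros)
  let ?f = "\<lambda>k s. if s \<in> {- real k..real k} then weight s else 0"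
  have int: "(?f k has_integral (arctan (real k) - arctan (- real k))) UNIV" for k
    using arctan[of "- real k" "real k"] by (subst has_integral_restrict_UNIV) simp
  show ?thesis
  proof (rule conjunct1[OF monotone_convergence_increasing[of ?f]])
    show "?f k integrable_on UNIV" for k
      using int has_integral_integrable by blast
    show "?f k s \<le> ?f (Suc k) s" for k s
      using weight_pos[of s] by auto
    show "(\<lambda>k. ?f k s) \<longlonglongrightarrow> weight s" for s
    proof (rule tendsto_eventually)
      obtain N :: nat where "\<bar>s\<bar> \<le> real N"
        using real_arch_simple by blast
      then show "\<forall>\<^sub>F k in sequentially. ?f k s = weight s"
        unfolding eventually_sequentially by (intro exI[of _ N]) auto
    qed
    have "\<bar>integral UNIV (?f k)\<bar> \<le> 2 * pi" for k
      using int[of k] arctan_bounded[of "real k"] arctan_bounded[of "- real k"]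
      by (simp only: has_integral_iff) linarith
    then show "bounded (range (\<lambda>k. integral UNIV (?f k)))"
      unfolding bounded_iff by (intro exI[of _ "2 * pi"]) auto
  qed
qed

lemma weight_shift:
  assumes "\<bar>x\<bar> \<le> 1"
  shows "weight (s + x) \<le> 3 * weight s"
proof -
  have lin: "1 + S \<le> 3 * (1 + A)" if "Y \<le> 1" "S \<le> 2 * A + 2 * Y" "0 \<le> A" for A S Y :: real
    using that by (simp add: distrib_left)
  have "x\<^sup>2 \<le> 1"
    using assms by (simp add: abs_square_le_1)
  moreover have "s\<^sup>2 \<le> 2 * (s + x)\<^sup>2 + 2 * x\<^sup>2"
    using zero_le_power2[of "(s + x) + x"] by (simp add: power2_eq_square algebra_simps)
  moreover have "0 \<le> (s + x)\<^sup>2"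
    by simp
  ultimately have "1 + s\<^sup>2 \<le> 3 * (1 + (s + x)\<^sup>2)"
    using lin by blast
  then show ?thesis
    unfolding weight_def by (simp add: divide_simps add_pos_nonneg add_nonneg_eq_0_iff)
qed

definition tail :: "real \<Rightarrow> real"
  where "tail R = integral UNIV weight - integral {-R..R} weight"

lemma weight_integrable_Icc: "weight integrable_on {a..b}"
  by (intro integrable_continuous_real weight_continuous)

lemma outside_has_integral:
  fixes F :: "real \<Rightarrow> 'b::banach"
  assumes "F integrable_on UNIV" "F integrable_on {a..b}"
  shows "((\<lambda>s. if s \<in> {a..b} then 0 else F s) has_integral (integral UNIV F - integral {a..b} F)) UNIV"
proof -
  have "((\<lambda>s. if s \<in> {a..b} then F s else 0) has_integral integral {a..b} F) UNIV"
    by (subst has_integral_restrict_UNIV) (rule integrable_integral[OF assms(2)])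
  then have "((\<lambda>s. F s - (if s \<in> {a..b} then F s else 0)) has_integral (integral UNIV F - integral {a..b} F)) UNIV"
    by (intro has_integral_diff integrable_integral assms)
  then show ?thesis
    by (rule has_integral_eq[rotated]) simp
qed

lemma tail_nonneg: "0 \<le> tail R"
  unfolding tail_def
  by (rule has_integral_nonneg[OF outside_has_integral[OF weight_integrable weight_integrable_Icc]])
    (simp add: less_imp_le weight_pos)

lemma tail_small:
  assumes "e > 0"
  shows "\<exists>R>0. \<forall>R'\<ge>R. tail R' < e"
proof -
  have "(weight has_integral integral UNIV weight) UNIV"
    by (rule integrable_integral[OF weight_integrable])
  then obtain B where B: "B > 0" "\<And>a b. ball 0 B \<subseteq> cbox a b \<Longrightarrow>
      norm (integral (cbox a b) weight - integral UNIV weight) < e"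
    unfolding has_integral_alt'[of weight] using assms by auto
  have "tail R' < e" if "R' \<ge> B" for R'
  proof -
    have "ball 0 B \<subseteq> cbox (-R') R'"
      using that by (auto simp: dist_real_def)
    from B(2)[OF this] show ?thesis
      unfolding tail_def by (simp add: abs_if split: if_splits)
  qed
  with B(1) show ?thesis
    by blast
qed

lemma tail_tendsto: "(\<lambda>n. tail (real n)) \<longlonglongrightarrow> 0"
proof (rule LIMSEQ_I)
  fix e :: real assume "e > 0"
  from tail_small[OF this] obtain R where R: "\<And>R'. R' \<ge> R \<Longrightarrow> tail R' < e"
    by blast
  obtain N :: nat where "R \<le> real N"
    using real_arch_simple by blast
  then have "tail (real n) < e" if "n \<ge> N" for n
    using R[of "real n"] that by simp
  then show "\<exists>N. \<forall>n\<ge>N. norm (tail (real n) - 0) < e"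
    using tail_nonneg by (intro exI[of _ N]) (simp add: abs_of_nonneg)
qed

context
  fixes F :: "real \<Rightarrow> 'b::banach" and C :: real
  assumes F: "continuous_on UNIV F" and bound: "\<And>s. norm (F s) \<le> C * weight s"
begin

lemma weighted_integrable: "F integrable_on UNIV"
proof (rule integrable_on_all_intervals_UNIV[OF _ bound])
  show "F integrable_on cbox a b" for a b
    using continuous_on_subset[OF F] by (intro integrable_continuous) auto
  show "(\<lambda>s. C * weight s) integrable_on UNIV"
    by (intro integrable_on_mult_right weight_integrable)
qed

lemma weighted_integrable_Icc: "F integrable_on {a..b}"
  using continuous_on_subset[OF F] by (intro integrable_continuous_real) auto

lemma weighted_constant_nonneg: "0 \<le> C"
  using order_trans[OF norm_ge_zero bound[of 0]] by (simp add: weight_def)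

lemma weighted_tail: "norm (integral UNIV F - integral {-R..R} F) \<le> C * tail R"
proof -
  have 1: "((\<lambda>s. if s \<in> {-R..R} then 0 else F s) has_integral (integral UNIV F - integral {-R..R} F)) UNIV"
    by (rule outside_has_integral[OF weighted_integrable weighted_integrable_Icc])
  have 2: "((\<lambda>s. C * (if s \<in> {-R..R} then 0 else weight s)) has_integral C * tail R) UNIV"
    unfolding tail_def
    by (intro has_integral_mult_right outside_has_integral weight_integrable weight_integrable_Icc)
  have "norm (integral UNIV (\<lambda>s. if s \<in> {-R..R} then 0 else F s))
      \<le> integral UNIV (\<lambda>s. C * (if s \<in> {-R..R} then 0 else weight s))"
    by (rule integral_norm_bound_integral) (use 1 2 bound in \<open>auto simp: has_integral_iff\<close>)
  then show ?thesis
    using 1 2 by (simp only: has_integral_iff)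
qed

lemma weighted_limit: "(\<lambda>n. integral {- real n..real n} F) \<longlonglongrightarrow> integral UNIV F"
proof -
  have "(\<lambda>n. C * tail (real n)) \<longlonglongrightarrow> C * 0"
    by (intro tendsto_intros tail_tendsto)
  then have "(\<lambda>n. C * tail (real n)) \<longlonglongrightarrow> 0"
    by simp
  then have "(\<lambda>n. integral {- real n..real n} F - integral UNIV F) \<longlonglongrightarrow> 0"
  proof (rule Lim_null_comparison[rotated])
    show "\<forall>\<^sub>F n in sequentially. norm (integral {- real n..real n} F - integral UNIV F) \<le> C * tail (real n)"
      using weighted_tail by (intro always_eventually allI) (simp only: norm_minus_commute)
  qed  then show ?thesis
    by (simp add: LIM_zero_iff)
qed

end

lemma has_bochner_weighted:
  fixes F :: "real \<Rightarrow> 'b::banach"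
  assumes F: "continuous_on UNIV F" and bound: "\<And>s. norm (F s) \<le> C * weight s"
  shows "has_bochner lebesgue F (integral UNIV F)"
proof -
  have C: "0 \<le> C"
    by (rule weighted_constant_nonneg[OF F bound])
  have "has_bochner (lebesgue_on UNIV) F (integral UNIV F)"
  proof (rule has_bochner_continuous[OF _ F weighted_integrable[OF F bound]])
    have "(\<lambda>s. C * (3 * weight s)) absolutely_integrable_on UNIV"
      using C by (intro nonnegative_absolutely_integrable_1 integrable_on_mult_right weight_integrable)
        (simp add: less_imp_le weight_pos)
    then show "integrable (lebesgue_on UNIV) (\<lambda>s. C * (3 * weight s))"
      by (rule absolutely_integrable_imp_integrable) simp
    fix x z :: real assume "x - 1 \<le> z" "z \<le> x"
    then have "weight (x + (z - x)) \<le> 3 * weight x"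
      by (intro weight_shift) auto
    with bound[of z] mult_left_mono[OF this C] show "norm (F z) \<le> C * (3 * weight x)"
      by simp
  qed simp
  then show ?thesis
    by (simp add: lebesgue_on_UNIV_eq)
qed

lemma has_integral_affine_UNIV:
  fixes F :: "real \<Rightarrow> 'b::banach"
  assumes F: "(F has_integral I) UNIV" and m: "m > 0"
  shows "((\<lambda>x. F (m * x + c)) has_integral (1 / m) *\<^sub>R I) UNIV"
proof -
  have sub: "((\<lambda>x. F (m * x + c)) has_integral (1 / m) *\<^sub>R integral {m * a + c..m * b + c} F) {a..b}"
    if int: "F integrable_on {m * a + c..m * b + c}" for a b
  proof -
    have e: "(m * a + c - c) /\<^sub>R m = a" "(m * b + c - c) /\<^sub>R m = b"
      using m by simp_all
    have "((\<lambda>x. F (m *\<^sub>R x + c)) has_integral (integral {m * a + c..m * b + c} F /\<^sub>R m ^ DIM(real)))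
      (cbox ((m * a + c - c) /\<^sub>R m) ((m * b + c - c) /\<^sub>R m))"
      by (subst has_integral_affinity_iff[OF m]) (simp add: integrable_integral[OF int])
    then show ?thesis
      unfolding e by (simp add: divide_inverse)
  qed
  have int: "F integrable_on {a..b}" for a b
    using integrable_on_subcbox[of F UNIV a b] F by (auto simp: has_integral_integrable)
  show ?thesis
    unfolding has_integral_alt'[of "\<lambda>x. F (m * x + c)"]
  proof (intro conjI allI impI)
    show "(\<lambda>x. if x \<in> UNIV then F (m * x + c) else 0) integrable_on cbox a b" for a b
      using sub[OF int] by (auto simp: has_integral_integrable)
    fix e :: real assume e: "e > 0"
    then have "e * m > 0"
      using m by simp
    with F obtain B where B: "B > 0" "\<And>a b. ball 0 B \<subseteq> cbox a b \<Longrightarrow> norm (integral (cbox a b) F - I) < e * m"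
      unfolding has_integral_alt'[of F] by auto
    let ?B = "(B + \<bar>c\<bar>) / m"
    have B'pos: "?B > 0"
      using B(1) m by (simp add: add_pos_nonneg)
    have "norm (integral (cbox a b) (\<lambda>x. F (m * x + c)) - (1 / m) *\<^sub>R I) < e" if ab: "ball 0 ?B \<subseteq> cbox a b" for a b
    proof -
      have le: "a \<le> - ?B" "?B \<le> b"
      proof -
        have "closure (ball 0 ?B) \<subseteq> cbox a b"
          using ab by (rule closure_minimal) simp
        then have "cball 0 ?B \<subseteq> cbox a b"
          using B'pos closure_ball[of ?B "0::real"] by simp
        moreover have "- ?B \<in> cball 0 ?B" "?B \<in> cball 0 ?B"
          using B'pos by auto
        ultimately have "- ?B \<in> cbox a b" "?B \<in> cbox a b"
          by blast+
        then show "a \<le> - ?B" "?B \<le> b"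
          by simp_all
      qed
      have "m * a \<le> m * (- ?B)" "m * ?B \<le> m * b"
        using m le by (intro mult_left_mono; simp)+
      then have "m * a \<le> - (B + \<bar>c\<bar>)" "B + \<bar>c\<bar> \<le> m * b"
        using m by simp_all
      then have "ball 0 B \<subseteq> cbox (m * a + c) (m * b + c)"
        by (auto simp: dist_real_def)
      from B(2)[OF this] have "norm (integral {m * a + c..m * b + c} F - I) < e * m"
        by simp
      moreover have "integral (cbox a b) (\<lambda>x. F (m * x + c)) = (1 / m) *\<^sub>R integral {m * a + c..m * b + c} F"
        using sub[OF int] by (simp add: has_integral_iff)
      moreover have "norm ((1 / m) *\<^sub>R integral {m * a + c..m * b + c} F - (1 / m) *\<^sub>R I)
          = (1 / m) * norm (integral {m * a + c..m * b + c} F - I)"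
        using m by (simp flip: scaleR_diff_right)
      moreover have "(1 / m) * z < e" if "z < e * m" for z
        using that m by (simp add: pos_divide_less_eq)
      ultimately show ?thesis
        by (simp only:)
    qed
    with B'pos show "\<exists>B>0. \<forall>a b. ball 0 B \<subseteq> cbox a b \<longrightarrow>
        norm (integral (cbox a b) (\<lambda>x. if x \<in> UNIV then F (m * x + c) else 0) - (1 / m) *\<^sub>R I) < e"
      by (intro exI[of _ ?B]) simp
  qed
qed

text \<open>
  On \<open>[-n, n]\<close> the integrands are continuous on a rectangle; the remainders are at most
  \<open>C * tail n\<close>, uniformly in \<open>x\<close>.
\<close>
lemma integral_swap_weighted:
  fixes H :: "real \<Rightarrow> real \<Rightarrow> 'b::banach"
  assumes H: "continuous_on UNIV (\<lambda>(s, x). H s x)"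
    and bound: "\<And>s x. x \<in> {0..1} \<Longrightarrow> norm (H s x) \<le> C * weight s"
  shows "integral {0..1} (\<lambda>x. integral UNIV (\<lambda>s. H s x)) = integral UNIV (\<lambda>s. integral {0..1} (H s))"
proof -
  have C: "0 \<le> C"
    using order_trans[OF norm_ge_zero bound[of 0 0]] by (simp add: weight_def)
  have Hs: "continuous_on UNIV (\<lambda>s. H s x)" for x
  proof -
    have "continuous_on UNIV (\<lambda>s. (s, x))"
      by (intro continuous_on_Pair continuous_on_id continuous_on_const)
    from continuous_on_compose2[OF H this] show ?thesis
      by simp
  qed
  have Hx: "continuous_on S (H s)" for s S
  proof -
    have "continuous_on S (\<lambda>x. (s, x))"
      by (intro continuous_on_Pair continuous_on_id continuous_on_const)
    from continuous_on_compose2[OF H this] show ?thesis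
      by simp
  qed
  have inner: "continuous_on UNIV (\<lambda>s. integral {0..1} (H s))"
    using integral_continuous_on_param[of UNIV 0 "1::real" H] continuous_on_subset[OF H] by simp
  have inner_bound: "norm (integral {0..1} (H s)) \<le> C * weight s" for s
    using integral_bound[of 0 "1::real" "H s" "C * weight s"] Hx bound by simp
  let ?I = "\<lambda>n x. integral {- real n..real n} (\<lambda>s. H s x)"
  have swap: "integral {0..1} (?I n) = integral {- real n..real n} (\<lambda>s. integral {0..1} (H s))" for n
    using integral_swap_continuous[of "- real n" 0 "real n" 1 H] continuous_on_subset[OF H] by simp
  have cont: "continuous_on {0..1} (?I n)" for n
  proof -
    have "continuous_on ({0..1} \<times> cbox (- real n) (real n)) (\<lambda>(x, s). H s x)"
    proof -
      have "continuous_on ({0..1} \<times> cbox (- real n) (real n)) (\<lambda>p. (snd p, fst p))"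
        by (intro continuous_on_Pair continuous_on_fst continuous_on_snd continuous_on_id)
      from continuous_on_compose2[OF H this] show ?thesis
        by (simp add: case_prod_beta)
    qed
    from integral_continuous_on_param[OF this] show ?thesis
      by simp
  qed
  have unif: "uniform_limit {0..1} ?I (\<lambda>x. integral UNIV (\<lambda>s. H s x)) sequentially"
    unfolding uniform_limit_sequentially_iff
  proof (intro allI impI)
    fix e :: real assume e: "e > 0"
    have "(\<lambda>n. C * tail (real n)) \<longlonglongrightarrow> C * 0"
      by (intro tendsto_intros tail_tendsto)
    from LIMSEQ_D[OF this e] obtain N where "\<forall>n\<ge>N. norm (C * tail (real n) - C * 0) < e"
      by blast
    then have N: "norm (C * tail (real n)) < e" if "n \<ge> N" for n
      using that by simp
    have "dist (?I n x) (integral UNIV (\<lambda>s. H s x)) < e" if "n \<ge> N" "x \<in> {0..1}" for n x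
      using weighted_tail[OF Hs bound[OF that(2)], of "real n"] N[OF that(1)]
      by (simp add: dist_norm norm_minus_commute)
    then show "\<exists>N. \<forall>n\<ge>N. \<forall>x\<in>{0..1}. dist (?I n x) (integral UNIV (\<lambda>s. H s x)) < e"
      by blast
  qed
  obtain I J where IJ: "\<And>n. (?I n has_integral I n) {0..1}"
    "((\<lambda>x. integral UNIV (\<lambda>s. H s x)) has_integral J) {0..1}" "I \<longlonglongrightarrow> J"
    using uniform_limit_integral[OF unif cont] by auto
  have "I = (\<lambda>n. integral {- real n..real n} (\<lambda>s. integral {0..1} (H s)))"
  proof
    show "I n = integral {- real n..real n} (\<lambda>s. integral {0..1} (H s))" for n
      using IJ(1)[of n] swap[of n] by (simp add: has_integral_iff)
  qed
  then have "I \<longlonglongrightarrow> integral UNIV (\<lambda>s. integral {0..1} (H s))"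
    using weighted_limit[OF inner inner_bound] by simp
  with IJ(3) have "J = integral UNIV (\<lambda>s. integral {0..1} (H s))"
    using LIMSEQ_unique by blast
  with IJ(2) show ?thesis
    by (simp add: has_integral_iff)
qed

section \<open>Convolution\<close>

definition decaying :: "(real \<Rightarrow> complex) \<Rightarrow> bool"
  where "decaying \<kappa> \<longleftrightarrow> continuous_on UNIV \<kappa> \<and> (\<exists>C. \<forall>s. cmod (\<kappa> s) \<le> C * weight s)"

definition conv :: "(real \<Rightarrow> complex) \<Rightarrow> (real \<Rightarrow> 'a::complex_banach) \<Rightarrow> real \<Rightarrow> 'a"
  where "conv \<kappa> v t = integral UNIV (\<lambda>s. \<kappa> s *\<^sub>C v (t - s))"

lemma C_ub_bound:
  assumes "v \<in> C_ub"
  shows "\<exists>B>0. \<forall>t. norm (v t) \<le> B"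
  using assms by (auto simp: C_ub_def bounded_pos)

lemma C_ub_continuous:
  assumes "v \<in> C_ub" "continuous_on S f"
  shows "continuous_on S (\<lambda>x. v (f x))"
proof -
  have "continuous_on UNIV v"
    using assms(1) uniformly_continuous_imp_continuous by (auto simp: C_ub_def)
  from continuous_on_compose2[OF this assms(2)] show ?thesis
    by simp
qed

lemma conv_integrand:
  assumes \<kappa>: "continuous_on UNIV \<kappa>" "\<And>s. cmod (\<kappa> s) \<le> C * weight s"
    and v: "v \<in> C_ub" "\<And>t. norm (v t) \<le> B"
  shows "continuous_on UNIV (\<lambda>s. \<kappa> s *\<^sub>C v (t - s))" "\<And>s. norm (\<kappa> s *\<^sub>C v (t - s)) \<le> (C * B) * weight s"
proof -
  show "continuous_on UNIV (\<lambda>s. \<kappa> s *\<^sub>C v (t - s))"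
    by (intro continuous_on_scaleC \<kappa>(1) C_ub_continuous[OF v(1)] continuous_intros)
  fix s
  have "0 \<le> C * weight s"
    using \<kappa>(2)[of s] norm_ge_zero order_trans by blast
  then have "cmod (\<kappa> s) * norm (v (t - s)) \<le> (C * weight s) * B"
    by (intro mult_mono \<kappa>(2) v(2)) auto
  then show "norm (\<kappa> s *\<^sub>C v (t - s)) \<le> (C * B) * weight s"
    by (simp add: norm_scaleC mult_ac)
qed

lemma conv_integrable:
  assumes "decaying \<kappa>" "v \<in> C_ub"
  shows "(\<lambda>s. \<kappa> s *\<^sub>C v (t - s)) integrable_on UNIV"
proof -
  obtain C where C: "continuous_on UNIV \<kappa>" "\<And>s. cmod (\<kappa> s) \<le> C * weight s"
    using assms(1) unfolding decaying_def by blast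
  obtain B where B: "\<And>t. norm (v t) \<le> B"
    using C_ub_bound[OF assms(2)] by blast
  show ?thesis
    by (rule weighted_integrable[OF conv_integrand[OF C assms(2) B]])
qed

lemma convolution_eq_conv:
  assumes "decaying \<kappa>" "v \<in> C_ub"
  shows "convolution v \<kappa> = conv \<kappa> v"
proof
  fix t
  obtain C where C: "continuous_on UNIV \<kappa>" "\<And>s. cmod (\<kappa> s) \<le> C * weight s"
    using assms(1) unfolding decaying_def by blast
  obtain B where B: "\<And>t. norm (v t) \<le> B"
    using C_ub_bound[OF assms(2)] by blast
  show "convolution v \<kappa> t = conv \<kappa> v t"
    unfolding convolution_def conv_def
    by (rule bochner_integral_eq[OF has_bochner_weighted[OF conv_integrand[OF C assms(2) B]]])
qed

lemma conv_add_kernel: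
  assumes "decaying \<kappa>" "decaying \<mu>" "v \<in> C_ub"
  shows "conv (\<lambda>s. \<kappa> s + \<mu> s) v t = conv \<kappa> v t + conv \<mu> v t"
  unfolding conv_def scaleC_add_left
  by (rule integral_add[OF conv_integrable conv_integrable]) (use assms in auto)

lemma conv_scaleC_kernel: "conv (\<lambda>s. c * \<kappa> s) v t = c *\<^sub>C conv \<kappa> v t" if "decaying \<kappa>" "v \<in> C_ub"
proof -
  have "integral UNIV ((\<lambda>x. c *\<^sub>C x) \<circ> (\<lambda>s. \<kappa> s *\<^sub>C v (t - s))) = c *\<^sub>C integral UNIV (\<lambda>s. \<kappa> s *\<^sub>C v (t - s))"
    by (rule integral_linear[OF conv_integrable[OF that] scaleC.bounded_linear_right])
  then show ?thesis
    by (simp add: conv_def o_def scaleC_scaleC)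
qed

lemma conv_translate: "conv \<kappa> (\<lambda>x. v (x + c)) t = conv \<kappa> v (t + c)"
  by (simp add: conv_def algebra_simps)

lemma conv_add:
  assumes "decaying \<kappa>" "v \<in> C_ub" "w \<in> C_ub"
  shows "conv \<kappa> (\<lambda>x. v x + w x) t = conv \<kappa> v t + conv \<kappa> w t"
  unfolding conv_def scaleC_add_right
  by (rule integral_add[OF conv_integrable conv_integrable]) (use assms in auto)

lemma conv_scaleC: "conv \<kappa> (\<lambda>x. c *\<^sub>C v x) t = c *\<^sub>C conv \<kappa> v t" if "decaying \<kappa>" "v \<in> C_ub"
proof -
  have "conv \<kappa> (\<lambda>x. c *\<^sub>C v x) t = conv (\<lambda>s. c * \<kappa> s) v t"
    by (simp add: conv_def scaleC_scaleC mult.commute)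
  then show ?thesis
    using conv_scaleC_kernel[OF that] by simp
qed

lemma conv_translate_kernel:
  assumes "decaying \<kappa>" "v \<in> C_ub"
  shows "conv (\<lambda>s. \<kappa> (s + c)) v t = conv \<kappa> v (t + c)"
proof -
  have "((\<lambda>s. \<kappa> s *\<^sub>C v (t + c - s)) has_integral conv \<kappa> v (t + c)) UNIV"
    unfolding conv_def by (rule integrable_integral[OF conv_integrable[OF assms]])
  from has_integral_affine_UNIV[OF this, of 1 c] show ?thesis
    by (simp add: conv_def has_integral_iff)
qed

text \<open>
  Averaging the translates of \<open>v\<close> amounts to averaging the translates of the kernel.
\<close>
lemma conv_window:
  assumes \<kappa>: "decaying \<kappa>" and v: "v \<in> C_ub"
  shows "conv \<kappa> (\<lambda>t. integral {0..1} (\<lambda>x. v (t + x))) t = conv (\<lambda>s. integral {0..1} (\<lambda>x. \<kappa> (s + x))) v t"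
proof -
  obtain C where C: "continuous_on UNIV \<kappa>" "\<And>s. cmod (\<kappa> s) \<le> C * weight s"
    using \<kappa> unfolding decaying_def by blast
  obtain B where B: "B > 0" "\<And>t. norm (v t) \<le> B"
    using C_ub_bound[OF v] by blast
  have C0: "0 \<le> C"
    by (rule weighted_constant_nonneg[OF C])
  have bl: "bounded_linear (\<lambda>x. c *\<^sub>C (x::'a))" "bounded_linear (\<lambda>c. c *\<^sub>C (x::'a))" for c x
    by (rule scaleC.bounded_linear_right scaleC.bounded_linear_left)+
  have "conv \<kappa> (\<lambda>t. integral {0..1} (\<lambda>x. v (t + x))) t
      = integral UNIV (\<lambda>s. integral {0..1} (\<lambda>x. \<kappa> s *\<^sub>C v (t - s + x)))"
    unfolding conv_def
  proof (rule arg_cong[where f = "integral UNIV"], rule ext)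
    fix s
    have "(\<lambda>x. v (t - s + x)) integrable_on {0..1}"
      by (intro integrable_continuous_real C_ub_continuous[OF v] continuous_intros)
    from integral_linear[OF this bl(1)[of "\<kappa> s"]]
    show "\<kappa> s *\<^sub>C integral {0..1} (\<lambda>x. v (t - s + x)) = integral {0..1} (\<lambda>x. \<kappa> s *\<^sub>C v (t - s + x))"
      by (simp add: o_def)
  qed
  also have "\<dots> = integral {0..1} (\<lambda>x. integral UNIV (\<lambda>s. \<kappa> s *\<^sub>C v (t - s + x)))"
  proof (rule integral_swap_weighted[symmetric, where C = "C * B"])
    show "continuous_on UNIV (\<lambda>(s, x). \<kappa> s *\<^sub>C v (t - s + x))"
      unfolding case_prod_beta
      by (intro continuous_on_scaleC C_ub_continuous[OF v] continuous_on_compose2[OF C(1)] continuous_intros) auto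
    fix s x :: real
    have "cmod (\<kappa> s) * norm (v (t - s + x)) \<le> (C * weight s) * B"
      using C0 weight_pos[of s] by (intro mult_mono C B) auto
    then show "norm (\<kappa> s *\<^sub>C v (t - s + x)) \<le> (C * B) * weight s"
      by (simp add: norm_scaleC mult_ac)
  qed
  also have "(\<lambda>x. integral UNIV (\<lambda>s. \<kappa> s *\<^sub>C v (t - s + x))) = (\<lambda>x. conv (\<lambda>s. \<kappa> (s + x)) v t)"
    unfolding conv_translate_kernel[OF \<kappa> v] by (simp add: conv_def algebra_simps)
  also have "integral {0..1} (\<lambda>x. conv (\<lambda>s. \<kappa> (s + x)) v t)
      = integral UNIV (\<lambda>s. integral {0..1} (\<lambda>x. \<kappa> (s + x) *\<^sub>C v (t - s)))"
    unfolding conv_def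
  proof (rule integral_swap_weighted[where C = "3 * C * B"])
    show "continuous_on UNIV (\<lambda>(s, x). \<kappa> (s + x) *\<^sub>C v (t - s))"
      unfolding case_prod_beta
      by (intro continuous_on_scaleC C_ub_continuous[OF v] continuous_on_compose2[OF C(1)] continuous_intros) auto
    fix s x :: real assume "x \<in> {0..1}"
    then have "C * weight (s + x) \<le> C * (3 * weight s)"
      by (intro mult_left_mono weight_shift C0) auto
    then have "cmod (\<kappa> (s + x)) \<le> C * (3 * weight s)"
      using C(2)[of "s + x"] by linarith
    then have "cmod (\<kappa> (s + x)) * norm (v (t - s)) \<le> (C * (3 * weight s)) * B"
      using C0 weight_pos[of s] by (intro mult_mono B) auto
    then show "norm (\<kappa> (s + x) *\<^sub>C v (t - s)) \<le> (3 * C * B) * weight s"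
      by (simp add: norm_scaleC mult_ac)
  qed
  also have "\<dots> = conv (\<lambda>s. integral {0..1} (\<lambda>x. \<kappa> (s + x))) v t"
    unfolding conv_def
  proof (rule arg_cong[where f = "integral UNIV"], rule ext)
    fix s
    have "(\<lambda>x. \<kappa> (s + x)) integrable_on {0..1}"
      by (intro integrable_continuous_real continuous_on_compose2[OF C(1)] continuous_intros) auto
    from integral_linear[OF this bl(2)[of "v (t - s)"]]
    show "integral {0..1} (\<lambda>x. \<kappa> (s + x) *\<^sub>C v (t - s)) = integral {0..1} (\<lambda>x. \<kappa> (s + x)) *\<^sub>C v (t - s)"
      by (simp add: o_def)
  qed
  finally show ?thesis .
qed

section \<open>Closed translation-invariant spaces\<close>

definition invariant_space :: "(real \<Rightarrow> 'a::complex_banach) set \<Rightarrow> bool"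
  where "invariant_space A \<longleftrightarrow> A \<noteq> {} \<and> A \<subseteq> C_ub \<and>
    (\<forall>f\<in>A. \<forall>g\<in>A. (\<lambda>t. f t + g t) \<in> A) \<and> (\<forall>f\<in>A. \<forall>c. (\<lambda>t. c *\<^sub>C f t) \<in> A) \<and>
    (\<forall>f\<in>A. \<forall>c. (\<lambda>t. f (t + c)) \<in> A) \<and>
    (\<forall>h. (\<forall>e>0. \<exists>f\<in>A. \<forall>t. norm (f t - h t) \<le> e) \<longrightarrow> h \<in> A)"

lemma invariant_spaceD:
  assumes "invariant_space A"
  shows "A \<noteq> {}" "f \<in> A \<Longrightarrow> f \<in> C_ub" "f \<in> A \<Longrightarrow> g \<in> A \<Longrightarrow> (\<lambda>t. f t + g t) \<in> A"
    "f \<in> A \<Longrightarrow> (\<lambda>t. c *\<^sub>C f t) \<in> A" "f \<in> A \<Longrightarrow> (\<lambda>t. f (t + b)) \<in> A"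
    "(\<And>e. e > 0 \<Longrightarrow> \<exists>f\<in>A. \<forall>t. norm (f t - h t) \<le> e) \<Longrightarrow> h \<in> A"
  using assms unfolding invariant_space_def by blast+

lemma invariant_space_maximal_star:
  assumes "maximal_star A"
  shows "invariant_space A"
  unfolding invariant_space_def
proof (intro conjI ballI allI impI)
  show "A \<noteq> {}"
    using assms by (simp add: maximal_star_def)
  show "A \<subseteq> C_ub"
    using maximal_starD(2)[OF assms] by blast
  show "h \<in> A" if "\<forall>e>0. \<exists>f\<in>A. \<forall>t. norm (f t - h t) \<le> e" for h
    using that by (intro maximal_star_uniform_limit[OF assms]) blast
qed (use maximal_star_add[OF assms] maximal_star_scaleC[OF assms] maximal_star_translate[OF assms] in blast)+

lemma invariant_space_zero: "invariant_space A \<Longrightarrow> (\<lambda>_. 0) \<in> A"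
  using invariant_spaceD(1)[of A] invariant_spaceD(4)[of A _ 0] by (auto simp: scaleC.zero_left)

lemma invariant_space_sum:
  assumes A: "invariant_space A" and f: "\<And>i. i \<in> I \<Longrightarrow> f i \<in> A"
  shows "(\<lambda>t. \<Sum>i\<in>I. f i t) \<in> A"
  using f
  by (induction I rule: infinite_finite_induct)
    (auto intro: invariant_space_zero[OF A] invariant_spaceD(3)[OF A])

lemma C_ub_add:
  assumes "f \<in> C_ub" "g \<in> C_ub" shows "(\<lambda>t. f t + g t) \<in> C_ub"
proof -
  have "bounded (range (\<lambda>t. f t + g t))"
  proof -
    obtain B C where "\<And>t. norm (f t) \<le> B" "\<And>t. norm (g t) \<le> C"
      using C_ub_bound[OF assms(1)] C_ub_bound[OF assms(2)] by blast
    then have "norm (f t + g t) \<le> B + C" for t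
      by (meson add_mono norm_triangle_le)
    then show ?thesis
      by (auto simp: bounded_iff)
  qed
  then show ?thesis
    using assms by (auto simp: C_ub_def intro: uniformly_continuous_on_add)
qed

lemma C_ub_translate:
  assumes "f \<in> C_ub" shows "(\<lambda>t. f (t + c)) \<in> C_ub"
proof -
  have "uniformly_continuous_on UNIV (\<lambda>t. f (t + c))"
    using assms by (intro uniformly_continuous_translate) (simp add: C_ub_def)
  moreover have "bounded (range (\<lambda>t. f (t + c)))"
    by (rule bounded_subset[of "range f"]) (use assms in \<open>auto simp: C_ub_def\<close>)
  ultimately show ?thesis
    by (simp add: C_ub_def)
qed

lemma invariant_space_C_ub: "invariant_space (C_ub :: (real \<Rightarrow> 'a::complex_banach) set)"
  unfolding invariant_space_def
proof (intro conjI ballI allI impI)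
  have "(\<lambda>_. 0) \<in> (C_ub :: (real \<Rightarrow> 'a) set)"
    by (simp add: C_ub_def uniformly_continuous_on_const)
  then show "(C_ub :: (real \<Rightarrow> 'a) set) \<noteq> {}"
    by blast
next
  fix f :: "real \<Rightarrow> 'a" and c assume f: "f \<in> C_ub"
  then obtain B where "\<And>t. norm (f t) \<le> B"
    using C_ub_bound by blast
  then have "norm (c *\<^sub>C f t) \<le> cmod c * B" for t
    by (simp add: norm_scaleC mult_left_mono)
  then have "bounded (range (\<lambda>t. c *\<^sub>C f t))"
    by (auto simp: bounded_iff)
  then show "(\<lambda>t. c *\<^sub>C f t) \<in> C_ub"
    using uniformly_continuous_scaleC[OF uniformly_continuous_on_const _ f, of c] by (auto simp: C_ub_def)
next
  fix h :: "real \<Rightarrow> 'a" assume lim: "\<forall>e>0. \<exists>f\<in>C_ub. \<forall>t. norm (f t - h t) \<le> e"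
  obtain f where f: "f \<in> C_ub" "\<And>t. norm (f t - h t) \<le> 1"
    using lim zero_less_one by blast
  obtain B where "\<And>t. norm (f t) \<le> B"
    using C_ub_bound[OF f(1)] by blast
  then have "norm (h t) \<le> B + 1" for t
    using f(2)[of t] norm_triangle_ineq2[of "h t" "f t"] by (smt (verit) norm_minus_commute)
  then have "bounded (range h)"
    by (auto simp: bounded_iff)
  moreover have "uniformly_continuous_on UNIV h"
    by (rule uniformly_continuous_uniform_limit) (use lim in \<open>auto simp: C_ub_def\<close>)
  ultimately show "h \<in> C_ub"
    by (simp add: C_ub_def)
qed (use C_ub_add C_ub_translate in auto)

lemma riemann_sum:
  fixes F :: "real \<Rightarrow> 'b::banach"
  assumes F: "continuous_on UNIV F" and d: "d \<ge> 0"
    and osc: "\<And>i s. i < N \<Longrightarrow> s \<in> {a + real i * d..a + (real i + 1) * d} \<Longrightarrow> norm (F s - F (a + real i * d)) \<le> \<omega>"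
  shows "norm (integral {a..a + real N * d} F - (\<Sum>i<N. d *\<^sub>R F (a + real i * d))) \<le> real N * d * \<omega>"
  using osc
proof (induction N)
  case (Suc N)
  have int: "F integrable_on {x..y}" for x y
    using continuous_on_subset[OF F] by (intro integrable_continuous_real) auto
  let ?b = "a + real N * d" and ?c = "a + real (Suc N) * d"
  have bc: "a \<le> ?b" "?b \<le> ?c" "?c - ?b = d"
    using d by (auto simp: algebra_simps)
  have "norm (integral {?b..?c} F - d *\<^sub>R F ?b) \<le> d * \<omega>"
  proof -
    have "((\<lambda>s. F s - F ?b) has_integral (integral {?b..?c} F - d *\<^sub>R F ?b)) {?b..?c}"
      using has_integral_diff[OF integrable_integral[OF int[of ?b ?c]] has_integral_const_real[of "F ?b" ?b ?c]]
        bc by simp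
    moreover have "norm (F s - F ?b) \<le> \<omega>" if "s \<in> {?b..?c}" for s
      using Suc.prems[of N s] that by (simp add: algebra_simps)
    moreover have "0 \<le> \<omega>"
      using Suc.prems[of N ?b] d by (simp add: algebra_simps)
    ultimately show ?thesis
      using has_integral_bound[of \<omega> "\<lambda>s. F s - F ?b" _ ?b ?c] bc by (simp add: mult.commute)
  qed
  moreover have "norm (integral {a..?b} F - (\<Sum>i<N. d *\<^sub>R F (a + real i * d))) \<le> real N * d * \<omega>"
    by (rule Suc.IH) (use Suc.prems in auto)
  moreover have "integral {a..?c} F = integral {a..?b} F + integral {?b..?c} F"
    by (rule Henstock_Kurzweil_Integration.integral_combine[symmetric]) (use bc int in auto)
  then have "integral {a..?c} F - (\<Sum>i<Suc N. d *\<^sub>R F (a + real i * d))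
      = (integral {a..?b} F - (\<Sum>i<N. d *\<^sub>R F (a + real i * d))) + (integral {?b..?c} F - d *\<^sub>R F ?b)"
    by simp
  ultimately have "norm (integral {a..?c} F - (\<Sum>i<Suc N. d *\<^sub>R F (a + real i * d)))
      \<le> real N * d * \<omega> + d * \<omega>"
    by (metis norm_triangle_mono)
  then show ?case
    by (simp add: algebra_simps)
qed simp

text \<open>
  A convolution is a uniform limit of linear combinations of translates, namely of Riemann sums: by
  uniform continuity of \<open>v\<close> one mesh size serves all \<open>t\<close>.
\<close>
lemma invariant_space_conv:
  assumes A: "invariant_space A" and v: "v \<in> A" and \<kappa>: "decaying \<kappa>"
  shows "conv \<kappa> v \<in> A"
proof (rule invariant_spaceD(6)[OF A])
  fix e :: real assume e: "e > 0"
  have v': "v \<in> C_ub"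
    by (rule invariant_spaceD(2)[OF A v])
  obtain C where C: "continuous_on UNIV \<kappa>" "\<And>s. cmod (\<kappa> s) \<le> C * weight s"
    using \<kappa> unfolding decaying_def by blast
  have C0: "0 \<le> C"
    by (rule weighted_constant_nonneg[OF C])
  obtain B where B: "B > 0" "\<And>t. norm (v t) \<le> B"
    using C_ub_bound[OF v'] by blast
  have C1: "cmod (\<kappa> s) \<le> C + 1" for s
  proof -
    have "C * weight s \<le> C * 1"
      by (intro mult_left_mono C0) (simp add: weight_def divide_simps add_pos_nonneg)
    with C(2)[of s] show ?thesis
      by simp
  qed
  have "C * B + 1 > 0"
    using C0 B(1) by (simp add: add_nonneg_pos)
  then have "e / 2 / (C * B + 1) > 0"
    using e by simp
  from tail_small[OF this] obtain R where R: "R > 0" "tail R < e / 2 / (C * B + 1)"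
    by blast
  have tail: "norm (conv \<kappa> v t - integral {-R..R} (\<lambda>s. \<kappa> s *\<^sub>C v (t - s))) \<le> e / 2" for t
  proof -
    have "norm (conv \<kappa> v t - integral {-R..R} (\<lambda>s. \<kappa> s *\<^sub>C v (t - s))) \<le> (C * B) * tail R"
      unfolding conv_def by (rule weighted_tail[OF conv_integrand[OF C v' B(2)]])
    also have "\<dots> \<le> (C * B + 1) * tail R"
      by (intro mult_right_mono tail_nonneg) simp
    also have "\<dots> \<le> (C * B + 1) * (e / 2 / (C * B + 1))"
      using R(2) C0 B(1) by (intro mult_left_mono) auto
    also have "\<dots> = e / 2"
    proof -
      have "q * (z / q) = z" if "q > 0" for q z :: real
        using that by simp
      from this[of "C * B + 1" "e / 2"] show ?thesis
        using C0 B(1) by (simp add: add_nonneg_pos)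
    qed
    finally show ?thesis .
  qed
  \<comment> \<open>an oscillation of at most \<open>\<omega>\<close> on an interval of length \<open>2 * R\<close> costs \<open>e / 2\<close>\<close>
  define \<omega> where "\<omega> = e / (4 * R)"
  have \<omega>: "\<omega> > 0"
    using e R(1) by (simp add: \<omega>_def)
  have "uniformly_continuous_on {-R..R} \<kappa>"
    by (rule compact_uniformly_continuous[OF continuous_on_subset[OF C(1)]]) auto
  then obtain d1 where d1: "d1 > 0" "\<And>s r. s \<in> {-R..R} \<Longrightarrow> r \<in> {-R..R} \<Longrightarrow> \<bar>s - r\<bar> < d1 \<Longrightarrow> cmod (\<kappa> s - \<kappa> r) < \<omega> / (2 * B)"
    unfolding uniformly_continuous_on_def dist_norm using \<omega> B(1)
    by (metis divide_pos_pos mult_pos_pos real_norm_def zero_less_numeral)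
  have "uniformly_continuous_on UNIV v"
    using v' by (simp add: C_ub_def)
  moreover have "\<omega> / (2 * (C + 1)) > 0"
    using \<omega> C0 by simp
  ultimately obtain d2 where d2: "d2 > 0" "\<And>s r. \<bar>s - r\<bar> < d2 \<Longrightarrow> norm (v s - v r) < \<omega> / (2 * (C + 1))"
    using uniformly_continuous_modulus by blast
  obtain N :: nat where N: "2 * R / min d1 d2 < real N"
    using reals_Archimedean2 by blast
  have "2 * R / min d1 d2 > 0"
    using R(1) d1(1) d2(1) by simp
  with N have N0: "real N > 0"
    by linarith
  define d where "d = 2 * R / real N"
  have d: "d > 0" "d < min d1 d2" "- R + real N * d = R"
  proof -
    show "d > 0" "- R + real N * d = R"
      using R(1) N0 by (simp_all add: d_def)
    have "2 * R < real N * min d1 d2"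
      using N d1(1) d2(1) by (simp add: pos_divide_less_eq)
    then show "d < min d1 d2"
      unfolding d_def by (subst pos_divide_less_eq[OF N0], subst mult.commute)
  qed
  define p where "p i = - R + real i * d" for i :: nat
  define S where "S t = (\<Sum>i<N. (of_real d * \<kappa> (p i)) *\<^sub>C v (t + - p i))" for t
  have "S \<in> A"
    unfolding S_def
    by (intro invariant_space_sum[OF A] invariant_spaceD(4)[OF A] invariant_spaceD(5)[OF A] v)
  moreover have "norm (S t - conv \<kappa> v t) \<le> e" for t
  proof -
    let ?F = "\<lambda>s. \<kappa> s *\<^sub>C v (t - s)"
    have "norm (integral {-R..-R + real N * d} ?F - (\<Sum>i<N. d *\<^sub>R ?F (- R + real i * d))) \<le> real N * d * \<omega>"
    proof (rule riemann_sum)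
      show "continuous_on UNIV ?F"
        by (rule conv_integrand[OF C v' B(2)])
      fix i s assume i: "i < N" and s: "s \<in> {- R + real i * d..- R + (real i + 1) * d}"
      have "(real i + 1) * d \<le> real N * d"
        using i d(1) by (intro mult_right_mono) auto
      then have in1: "s \<in> {-R..R}" "p i \<in> {-R..R}"
        using s d(1,3) by (auto simp: p_def algebra_simps) (smt (verit) mult_nonneg_nonneg of_nat_0_le_iff)+
      have close: "\<bar>s - p i\<bar> < d1" "\<bar>(t - s) - (t - p i)\<bar> < d2"
        using s d by (auto simp: p_def algebra_simps abs_if)
      have "?F s - ?F (p i) = (\<kappa> s - \<kappa> (p i)) *\<^sub>C v (t - s) + \<kappa> (p i) *\<^sub>C (v (t - s) - v (t - p i))"
        by (simp add: scaleC.diff_left scaleC.diff_right)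
      then have "norm (?F s - ?F (p i)) \<le> cmod (\<kappa> s - \<kappa> (p i)) * norm (v (t - s)) + cmod (\<kappa> (p i)) * norm (v (t - s) - v (t - p i))"
        by (metis norm_scaleC norm_triangle_ineq)
      also have "\<dots> \<le> \<omega> / (2 * B) * B + (C + 1) * (\<omega> / (2 * (C + 1)))"
        using d1(2)[OF in1 close(1)] d2(2)[OF close(2)] B C1[of "p i"] C0 \<omega>
        by (intro add_mono mult_mono) auto
      also have "\<dots> = \<omega>"
        using B(1) C0 by (simp add: field_simps)
      finally show "norm (?F s - ?F (- R + real i * d)) \<le> \<omega>"
        by (simp add: p_def)
    qed (use d in auto)
    moreover have "(\<Sum>i<N. d *\<^sub>R ?F (- R + real i * d)) = S t"
      unfolding S_def p_def[symmetric]
      by (intro sum.cong) (simp_all add: scaleC_scaleC[symmetric] scaleC_of_real)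
    moreover have "real N * d * \<omega> = e / 2"
      using R(1) d(3) by (simp add: \<omega>_def field_simps)
    ultimately have "norm (integral {-R..R} ?F - S t) \<le> e / 2"
      using d(3) by simp
    then show ?thesis
      using tail[of t] norm_triangle_ineq[of "S t - integral {-R..R} ?F" "integral {-R..R} ?F - conv \<kappa> v t"]
      by (simp add: norm_minus_commute)
  qed
  ultimately show "\<exists>f\<in>A. \<forall>t. norm (f t - conv \<kappa> v t) \<le> e"
    by blast
qed

text \<open>
  After the substitution \<open>s \<mapsto> s / n\<close> the integrand is \<open>\<kappa> s *\<^sub>C v (t - s / n)\<close>: for \<open>\<bar>s\<bar> \<le> R\<close> the
  function \<open>v\<close> is almost constant, and the rest of the kernel is small.
\<close>
lemma conv_approximate_identity:
  assumes \<kappa>: "decaying \<kappa>" and v: "v \<in> C_ub" and e: "e > 0"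
  shows "\<exists>n::nat. n \<ge> 1 \<and> (\<forall>t. norm (conv (\<lambda>s. of_nat n * \<kappa> (real n * s)) v t - integral UNIV \<kappa> *\<^sub>C v t) \<le> e)"
proof -
  obtain C where C: "continuous_on UNIV \<kappa>" "\<And>s. cmod (\<kappa> s) \<le> C * weight s"
    using \<kappa> unfolding decaying_def by blast
  have C0: "0 \<le> C"
    by (rule weighted_constant_nonneg[OF C])
  obtain B where B: "B > 0" "\<And>t. norm (v t) \<le> B"
    using C_ub_bound[OF v] by blast
  define I where "I = integral UNIV weight"
  have I0: "I \<ge> 0"
    unfolding I_def by (intro integral_nonneg weight_integrable) (simp add: weight_pos less_imp_le)
  have "2 * B * C + 1 > 0"
    using C0 B(1) by (simp add: add_nonneg_pos)
  then have "e / 2 / (2 * B * C + 1) > 0"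
    using e by simp
  from tail_small[OF this] obtain R where R: "R > 0" "tail R < e / 2 / (2 * B * C + 1)"
    by blast
  define \<omega> where "\<omega> = e / 2 / (C * I + 1)"
  have CI: "C * I + 1 > 0"
    using C0 I0 by (simp add: add_nonneg_pos)
  have \<omega>: "\<omega> > 0"
    using e CI by (simp add: \<omega>_def)
  have "uniformly_continuous_on UNIV v"
    using v by (simp add: C_ub_def)
  then obtain d where d: "d > 0" "\<And>s r. \<bar>s - r\<bar> < d \<Longrightarrow> norm (v s - v r) < \<omega>"
    using uniformly_continuous_modulus \<omega> by blast
  obtain n0 :: nat where "R / d < real n0"
    using reals_Archimedean2 by blast
  moreover have "R / d > 0"
    using R d by simp
  ultimately have n0': "real n0 > 0" "R < real n0 * d"
    using d(1) by (linarith, simp add: pos_divide_less_eq)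
  then have n0: "n0 \<ge> 1" "R / real n0 < d"
    by (simp_all add: pos_divide_less_eq mult.commute Suc_le_eq)
  show ?thesis
  proof (intro exI[of _ n0] conjI allI n0(1))
    fix t
    let ?n = "real n0"
    have v_scaled: "continuous_on UNIV (\<lambda>s. v (t - s / ?n))"
      by (intro C_ub_continuous[OF v] continuous_intros) (use n0 in auto)
    have int1: "continuous_on UNIV (\<lambda>s. \<kappa> s *\<^sub>C v (t - s / ?n))"
      "\<And>s. norm (\<kappa> s *\<^sub>C v (t - s / ?n)) \<le> (C * B) * weight s"
    proof -
      show "continuous_on UNIV (\<lambda>s. \<kappa> s *\<^sub>C v (t - s / ?n))"
        by (intro continuous_on_scaleC C v_scaled)
      show "norm (\<kappa> s *\<^sub>C v (t - s / ?n)) \<le> (C * B) * weight s" for s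
        using mult_mono[OF C(2)[of s] B(2)[of "t - s / ?n"]] C0 weight_pos[of s] by (simp add: norm_scaleC mult_ac)
    qed
    have h1: "((\<lambda>s. \<kappa> s *\<^sub>C v (t - s / ?n)) has_integral integral UNIV (\<lambda>s. \<kappa> s *\<^sub>C v (t - s / ?n))) UNIV"
      by (rule integrable_integral[OF weighted_integrable[OF int1]])
    have "((\<lambda>s. \<kappa> (?n * s + 0) *\<^sub>C v (t - (?n * s + 0) / ?n)) has_integral
        (1 / ?n) *\<^sub>R integral UNIV (\<lambda>s. \<kappa> s *\<^sub>C v (t - s / ?n))) UNIV"
      using has_integral_affine_UNIV[OF h1, of ?n 0] n0 by simp
    then have "((\<lambda>s. \<kappa> (?n * s) *\<^sub>C v (t - s)) has_integral
        (1 / ?n) *\<^sub>R integral UNIV (\<lambda>s. \<kappa> s *\<^sub>C v (t - s / ?n))) UNIV"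
      using n0 by simp
    from has_integral_linear[OF this bounded_linear_scaleR_right[of ?n]]
    have "((\<lambda>s. ?n *\<^sub>R \<kappa> (?n * s) *\<^sub>C v (t - s)) has_integral integral UNIV (\<lambda>s. \<kappa> s *\<^sub>C v (t - s / ?n))) UNIV"
      using n0 by (simp add: o_def)
    moreover have "?n *\<^sub>R \<kappa> (?n * s) *\<^sub>C v (t - s) = (of_nat n0 * \<kappa> (?n * s)) *\<^sub>C v (t - s)" for s
      using scaleC_of_real[of ?n "\<kappa> (?n * s) *\<^sub>C v (t - s)"] by (simp add: scaleC_scaleC)
    ultimately have c1: "conv (\<lambda>s. of_nat n0 * \<kappa> (?n * s)) v t = integral UNIV (\<lambda>s. \<kappa> s *\<^sub>C v (t - s / ?n))"
      by (simp add: conv_def has_integral_iff)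
    have h2: "((\<lambda>s. \<kappa> s *\<^sub>C v t) has_integral integral UNIV \<kappa> *\<^sub>C v t) UNIV"
      using has_integral_linear[OF integrable_integral[OF weighted_integrable[OF C]] scaleC.bounded_linear_left[of "v t"]]
      by (simp add: o_def)
    have h3: "((\<lambda>s. \<kappa> s *\<^sub>C (v (t - s / ?n) - v t)) has_integral
        (conv (\<lambda>s. of_nat n0 * \<kappa> (?n * s)) v t - integral UNIV \<kappa> *\<^sub>C v t)) UNIV"
      using has_integral_diff[OF h1 h2] by (simp add: c1 scaleC.diff_right)
    have h4: "((\<lambda>s. C * \<omega> * weight s + 2 * B * C * (if s \<in> {-R..R} then 0 else weight s)) has_integral
        (C * \<omega> * I + 2 * B * C * tail R)) UNIV"
      unfolding I_def tail_def
      by (intro has_integral_add has_integral_mult_right outside_has_integral weight_integrable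
          weight_integrable_Icc integrable_integral)
    have "norm (\<kappa> s *\<^sub>C (v (t - s / ?n) - v t)) \<le> C * \<omega> * weight s + 2 * B * C * (if s \<in> {-R..R} then 0 else weight s)" for s
    proof (cases "s \<in> {-R..R}")
      case True
      have "\<bar>s / ?n\<bar> \<le> R / ?n"
        using True by (simp add: abs_le_iff divide_right_mono)
      then have "\<bar>(t - s / ?n) - t\<bar> < d"
        using n0(2) by simp
      then have "norm (v (t - s / ?n) - v t) \<le> \<omega>"
        using d(2) less_imp_le by blast
      then have "cmod (\<kappa> s) * norm (v (t - s / ?n) - v t) \<le> (C * weight s) * \<omega>"
        using C0 weight_pos[of s] by (intro mult_mono C) auto
      then show ?thesis
        using True by (simp add: norm_scaleC mult_ac)
    next
      case False
      have "norm (v (t - s / ?n) - v t) \<le> 2 * B"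
        using norm_triangle_ineq4[of "v (t - s / ?n)" "v t"] B(2)[of "t - s / ?n"] B(2)[of t] by linarith
      then have "cmod (\<kappa> s) * norm (v (t - s / ?n) - v t) \<le> (C * weight s) * (2 * B)"
        using C0 weight_pos[of s] by (intro mult_mono C) auto
      moreover have "0 \<le> C * \<omega> * weight s"
        using C0 \<omega> weight_pos[of s] by simp
      moreover have "norm (\<kappa> s *\<^sub>C (v (t - s / ?n) - v t)) = cmod (\<kappa> s) * norm (v (t - s / ?n) - v t)"
        by (rule norm_scaleC)
      moreover have "2 * B * C * (if s \<in> {-R..R} then 0 else weight s) = (C * weight s) * (2 * B)"
        unfolding if_not_P[OF False] by simp
      ultimately show ?thesis
        by linarith
    qed
    then have "norm (integral UNIV (\<lambda>s. \<kappa> s *\<^sub>C (v (t - s / ?n) - v t)))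
        \<le> integral UNIV (\<lambda>s. C * \<omega> * weight s + 2 * B * C * (if s \<in> {-R..R} then 0 else weight s))"
      by (intro integral_norm_bound_integral) (use h3 h4 in \<open>auto simp: has_integral_iff\<close>)
    then have "norm (conv (\<lambda>s. of_nat n0 * \<kappa> (?n * s)) v t - integral UNIV \<kappa> *\<^sub>C v t)
        \<le> C * \<omega> * I + 2 * B * C * tail R"
      using h3 h4 by (simp only: has_integral_iff)
    also have "\<dots> \<le> (C * I + 1) * \<omega> + (2 * B * C + 1) * tail R"
      using \<omega> tail_nonneg[of R] by (simp add: algebra_simps)
    also have "\<dots> \<le> e / 2 + e / 2"
    proof (rule add_mono)
      have "q * (z / q) \<le> z" if "q > 0" for q z :: real
        using that by simp
      from this[OF CI] show "(C * I + 1) * \<omega> \<le> e / 2"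
        by (simp only: \<omega>_def)
      have "q * r \<le> z" if "q > 0" "r < z / q" for q r z :: real
        using that by (simp add: pos_less_divide_eq mult.commute)
      from this[OF _ R(2)] show "(2 * B * C + 1) * tail R \<le> e / 2"
        using B(1) C0 by (simp add: add_nonneg_pos)
    qed
    finally show "norm (conv (\<lambda>s. of_nat n0 * \<kappa> (real n0 * s)) v t - integral UNIV \<kappa> *\<^sub>C v t) \<le> e"
      by simp
  qed
qed

section \<open>Smooth functions of compact support\<close>

primrec smooth_n :: "nat \<Rightarrow> (real \<Rightarrow> complex) \<Rightarrow> bool"
  where
    "smooth_n 0 f \<longleftrightarrow> True"
  | "smooth_n (Suc n) f \<longleftrightarrow> (\<exists>f'. (\<forall>t. (f has_vector_derivative f' t) (at t)) \<and> smooth_n n f')"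

definition smooth :: "(real \<Rightarrow> complex) \<Rightarrow> bool"
  where "smooth f \<longleftrightarrow> (\<forall>n. smooth_n n f)"

lemma smooth_n_SucI:
  "(\<And>t. (f has_vector_derivative f' t) (at t)) \<Longrightarrow> smooth_n n f' \<Longrightarrow> smooth_n (Suc n) f"
  by auto

lemma smooth_n_Suc: "smooth_n (Suc n) f \<Longrightarrow> smooth_n n f"
proof (induction n arbitrary: f)
  case (Suc n)
  then obtain f' where "\<forall>t. (f has_vector_derivative f' t) (at t)" "smooth_n (Suc n) f'"
    by auto
  with Suc.IH[of f'] show ?case
    by auto
qed simp

lemma smooth_derivE:
  assumes "smooth f"
  obtains f' where "\<And>t. (f has_vector_derivative f' t) (at t)" "smooth f'"
proof -
  have "smooth_n 1 f"
    using assms by (simp add: smooth_def)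
  then obtain f' where f': "\<forall>t. (f has_vector_derivative f' t) (at t)"
    by auto
  have "smooth_n n f'" for n
  proof -
    have "smooth_n (Suc n) f"
      using assms by (simp only: smooth_def)
    then obtain g where g: "\<forall>t. (f has_vector_derivative g t) (at t)" "smooth_n n g"
      by auto
    have "g = f'"
      using g(1) f' vector_derivative_unique_at by blast
    with g(2) show ?thesis
      by simp
  qed
  then have "smooth f'"
    by (simp add: smooth_def)
  with f' show thesis
    using that by blast
qed

lemma smooth_continuous: "smooth f \<Longrightarrow> continuous_on S f"
  by (meson smooth_derivE has_vector_derivative_continuous continuous_at_imp_continuous_on)

lemma smooth_n_const: "smooth_n n (\<lambda>_. c)"
  by (induction n arbitrary: c) (auto intro!: exI[of _ "\<lambda>_. 0"])

lemma smooth_n_add: "smooth_n n f \<Longrightarrow> smooth_n n g \<Longrightarrow> smooth_n n (\<lambda>t. f t + g t)"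
proof (induction n arbitrary: f g)
  case (Suc n)
  obtain f' where f': "\<forall>t. (f has_vector_derivative f' t) (at t)" "smooth_n n f'"
    using Suc.prems(1) by auto
  obtain g' where g': "\<forall>t. (g has_vector_derivative g' t) (at t)" "smooth_n n g'"
    using Suc.prems(2) by auto
  have "((\<lambda>t. f t + g t) has_vector_derivative f' t + g' t) (at t)" for t
    using f' g' by (intro has_vector_derivative_add) auto
  from smooth_n_SucI[OF this Suc.IH[OF f'(2) g'(2)]] show ?case .
qed simp

lemma smooth_n_mult: "smooth_n n f \<Longrightarrow> smooth_n n g \<Longrightarrow> smooth_n n (\<lambda>t. f t * g t)"
proof (induction n arbitrary: f g)
  case (Suc n)
  obtain f' where f': "\<forall>t. (f has_vector_derivative f' t) (at t)" "smooth_n n f'"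
    using Suc.prems(1) by auto
  obtain g' where g': "\<forall>t. (g has_vector_derivative g' t) (at t)" "smooth_n n g'"
    using Suc.prems(2) by auto
  have "((\<lambda>t. f t * g t) has_vector_derivative f t * g' t + f' t * g t) (at t)" for t
    using f' g' by (intro has_vector_derivative_mult) auto
  moreover have "smooth_n n (\<lambda>t. f t * g' t + f' t * g t)"
    by (intro smooth_n_add Suc.IH f' g' smooth_n_Suc[OF Suc.prems(1)] smooth_n_Suc[OF Suc.prems(2)])
  ultimately show ?case
    by (rule smooth_n_SucI)
qed simp

lemma smooth_n_affine: "smooth_n n f \<Longrightarrow> smooth_n n (\<lambda>t. f (a * t + b))"
proof (induction n arbitrary: f)
  case (Suc n)
  obtain f' where f': "\<forall>t. (f has_vector_derivative f' t) (at t)" "smooth_n n f'"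
    using Suc.prems by auto
  have "((\<lambda>t. f (a * t + b)) has_vector_derivative of_real a * f' (a * t + b)) (at t)" for t
  proof -
    have "((\<lambda>t. a * t + b) has_vector_derivative a) (at t)"
      by (auto intro!: derivative_eq_intros simp: has_real_derivative_iff_has_vector_derivative[symmetric])
    from vector_diff_chain_at[OF this, of f "f' (a * t + b)"] f' show ?thesis
      by (simp add: o_def scaleR_conv_of_real)
  qed
  moreover have "smooth_n n (\<lambda>t. of_real a * f' (a * t + b))"
    by (intro smooth_n_mult smooth_n_const Suc.IH f')
  ultimately show ?case
    by (rule smooth_n_SucI)
qed simp

lemma smooth_const: "smooth (\<lambda>_. c)" and smooth_add: "smooth f \<Longrightarrow> smooth g \<Longrightarrow> smooth (\<lambda>t. f t + g t)"
  and smooth_mult: "smooth f \<Longrightarrow> smooth g \<Longrightarrow> smooth (\<lambda>t. f t * g t)"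
  and smooth_affine: "smooth f \<Longrightarrow> smooth (\<lambda>t. f (a * t + b))"
  by (simp_all add: smooth_def smooth_n_const smooth_n_add smooth_n_mult smooth_n_affine)

lemma smooth_entire:
  assumes "F holomorphic_on UNIV"
  shows "smooth (\<lambda>t. F (of_real t))"
proof -
  have "smooth_n n (\<lambda>t. F (of_real t))" for n
    using assms
  proof (induction n arbitrary: F)
    case (Suc n)
    have "((\<lambda>t. F (of_real t)) has_vector_derivative deriv F (of_real t)) (at t)" for t
      using Suc.prems by (intro has_vector_derivative_real_field holomorphic_derivI[of _ UNIV]) auto
    moreover have "deriv F holomorphic_on UNIV"
      using Suc.prems by (intro holomorphic_deriv) auto
    ultimately show ?case
      using smooth_n_SucI[OF _ Suc.IH[of "deriv F"]] by blast
  qed simp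
  then show ?thesis
    by (simp add: smooth_def)
qed

definition vanishes_beyond :: "real \<Rightarrow> (real \<Rightarrow> complex) \<Rightarrow> bool"
  where "vanishes_beyond R \<psi> \<longleftrightarrow> (\<forall>l. \<bar>l\<bar> > R \<longrightarrow> \<psi> l = 0)"

definition test_fun :: "(real \<Rightarrow> complex) \<Rightarrow> bool"
  where "test_fun \<psi> \<longleftrightarrow> smooth \<psi> \<and> (\<exists>R. vanishes_beyond R \<psi>)"

lemma open_outside: "open {l::real. \<bar>l\<bar> > R}"
  by (intro open_Collect_less continuous_intros)

lemma vanishes_beyond_deriv:
  assumes "vanishes_beyond R f" "\<And>t. (f has_vector_derivative f' t) (at t)"
  shows "vanishes_beyond R f'"
  unfolding vanishes_beyond_def
proof (intro allI impI)
  fix l :: real assume l: "\<bar>l\<bar> > R"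
  have "(f has_vector_derivative 0) (at l)"
    by (rule has_vector_derivative_transform_within_open[OF has_vector_derivative_const open_outside[of R]])
      (use l assms(1) in \<open>auto simp: vanishes_beyond_def\<close>)
  then show "f' l = 0"
    using assms(2) vector_derivative_unique_at by blast
qed

text \<open>
  The derivative of \<open>\<psi> / q\<close> is again a quotient of this form, with denominator \<open>q\<^sup>2\<close>.  Zeros of \<open>q\<close> beyond
  \<open>R\<close> are harmless: there the quotient is locally zero, because \<open>x / 0 = 0\<close>.
\<close>
lemma smooth_n_divide:
  assumes "smooth \<psi>" "vanishes_beyond R \<psi>" "smooth q" "\<And>l. \<bar>l\<bar> \<le> R \<Longrightarrow> q l \<noteq> 0"
  shows "smooth_n n (\<lambda>l. \<psi> l / q l)"
  using assms
proof (induction n arbitrary: \<psi> q)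
  case (Suc n)
  obtain \<psi>' where \<psi>': "\<And>t. (\<psi> has_vector_derivative \<psi>' t) (at t)" "smooth \<psi>'"
    using smooth_derivE[OF Suc.prems(1)] by blast
  obtain q' where q': "\<And>t. (q has_vector_derivative q' t) (at t)" "smooth q'"
    using smooth_derivE[OF Suc.prems(3)] by blast
  define p where "p l = \<psi>' l * q l + (- 1) * (\<psi> l * q' l)" for l
  have supp': "vanishes_beyond R \<psi>'"
    by (rule vanishes_beyond_deriv[OF Suc.prems(2) \<psi>'(1)])
  have "((\<lambda>l. \<psi> l / q l) has_vector_derivative p l / (q l * q l)) (at l)" for l
  proof (cases "\<bar>l\<bar> \<le> R")
    case True
    then have nz: "q l \<noteq> 0"
      using Suc.prems(4) by blast
    have "((inverse \<circ> q) has_vector_derivative q' l * - (inverse (q l) ^ Suc (Suc 0))) (at l)"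
      by (rule field_vector_diff_chain_at[OF q'(1) DERIV_inverse[OF nz]])
    from has_vector_derivative_mult[OF \<psi>'(1)[of l] this]
    show ?thesis
      using nz by (simp add: p_def field_simps divide_inverse[symmetric])
  next
    case False
    have "((\<lambda>l. \<psi> l / q l) has_vector_derivative 0) (at l)"
      by (rule has_vector_derivative_transform_within_open[OF has_vector_derivative_const open_outside[of R]])
        (use False Suc.prems(2) in \<open>auto simp: vanishes_beyond_def\<close>)
    moreover have "p l = 0"
      using False Suc.prems(2) supp' by (auto simp: p_def vanishes_beyond_def)
    ultimately show ?thesis
      by simp
  qed
  moreover have "smooth_n n (\<lambda>l. p l / (q l * q l))"
  proof (rule Suc.IH)
    show "smooth p" "smooth (\<lambda>l. q l * q l)"
      unfolding p_def[abs_def] by (intro smooth_add smooth_mult smooth_const \<psi>' q' Suc.prems)+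
    show "vanishes_beyond R p"
      using Suc.prems(2) supp' by (auto simp: p_def vanishes_beyond_def)
    show "\<And>l. \<bar>l\<bar> \<le> R \<Longrightarrow> q l * q l \<noteq> 0"
      using Suc.prems(4) by simp
  qed
  ultimately show ?case
    by (rule smooth_n_SucI)
qed simp

lemma test_fun_divide:
  assumes "smooth \<psi>" "vanishes_beyond R \<psi>" "smooth q" "\<And>l. \<bar>l\<bar> \<le> R \<Longrightarrow> q l \<noteq> 0"
  shows "smooth (\<lambda>l. \<psi> l / q l)" "vanishes_beyond R (\<lambda>l. \<psi> l / q l)"
  using smooth_n_divide[OF assms] assms(2) by (auto simp: smooth_def vanishes_beyond_def)

lemma test_fun_mult: "test_fun \<psi> \<Longrightarrow> smooth f \<Longrightarrow> test_fun (\<lambda>l. f l * \<psi> l)"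
  unfolding test_fun_def vanishes_beyond_def by (auto intro: smooth_mult)

lemma test_fun_add:
  assumes "test_fun \<psi>" "test_fun \<theta>" shows "test_fun (\<lambda>l. \<psi> l + \<theta> l)"
proof -
  obtain R R' where "vanishes_beyond R \<psi>" "vanishes_beyond R' \<theta>"
    using assms by (auto simp: test_fun_def)
  then have "vanishes_beyond (max R R') (\<lambda>l. \<psi> l + \<theta> l)"
    by (auto simp: vanishes_beyond_def)
  with assms show ?thesis
    by (auto simp: test_fun_def intro: smooth_add)
qed

lemma test_fun_affine:
  assumes "test_fun \<psi>" "a \<noteq> 0" shows "test_fun (\<lambda>l. \<psi> (a * l + b))"
proof -
  obtain R where R: "vanishes_beyond R \<psi>"
    using assms by (auto simp: test_fun_def)
  have "vanishes_beyond ((R + \<bar>b\<bar>) / \<bar>a\<bar>) (\<lambda>l. \<psi> (a * l + b))"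
    unfolding vanishes_beyond_def
  proof (intro allI impI)
    fix l assume "(R + \<bar>b\<bar>) / \<bar>a\<bar> < \<bar>l\<bar>"
    then have "R + \<bar>b\<bar> < \<bar>a * l\<bar>"
      using assms(2) by (simp add: pos_divide_less_eq abs_mult mult.commute)
    then have "R < \<bar>a * l + b\<bar>"
      by linarith
    with R show "\<psi> (a * l + b) = 0"
      by (simp add: vanishes_beyond_def)
  qed
  with assms show ?thesis
    by (auto simp: test_fun_def intro: smooth_affine)
qed

section \<open>Kernels of compact spectrum\<close>

text \<open>
  Up to normalisation the inverse Fourier transform.  The kernels \<open>FT \<psi>\<close> with \<open>\<psi>\<close> smooth of compact
  support are those on which translations, differences and means act by multiplication of \<open>\<psi>\<close>.
\<close>
definition FT :: "(real \<Rightarrow> complex) \<Rightarrow> real \<Rightarrow> complex"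
  where "FT \<psi> t = integral UNIV (\<lambda>l. \<psi> l * gamma_char t l)"

lemma gamma_char_commute: "gamma_char s t = gamma_char t s"
  by (simp add: gamma_char_def mult.commute)

lemma gamma_char_add_left: "gamma_char (s + t) l = gamma_char s l * gamma_char t l"
  using gamma_char_add[of l s t] by (simp only: gamma_char_commute)

lemma gamma_char_continuous: "continuous_on S f \<Longrightarrow> continuous_on S g \<Longrightarrow> continuous_on S (\<lambda>x. gamma_char (f x) (g x))"
  unfolding gamma_char_def by (intro continuous_intros)

lemma gamma_char_deriv: "((\<lambda>l. gamma_char t l) has_vector_derivative \<i> * of_real t * gamma_char t l) (at l)"
proof -
  have "((\<lambda>z. exp (\<i> * of_real t * z)) has_field_derivative \<i> * of_real t * exp (\<i> * of_real t * of_real l)) (at (of_real l))"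
    by (auto intro!: derivative_eq_intros)
  from has_vector_derivative_real_field[OF this] show ?thesis
    by (simp add: gamma_char_def mult.assoc)
qed

lemma FT_has_integral:
  assumes \<psi>: "continuous_on UNIV \<psi>" "vanishes_beyond R \<psi>" and R': "R \<le> R'"
  shows "((\<lambda>l. \<psi> l * gamma_char t l) has_integral FT \<psi> t) UNIV"
    and "FT \<psi> t = integral {-R'..R'} (\<lambda>l. \<psi> l * gamma_char t l)"
proof -
  let ?f = "\<lambda>l. \<psi> l * gamma_char t l"
  have "?f integrable_on {-R'..R'}"
    using continuous_on_subset[OF \<psi>(1)]
    by (intro integrable_continuous_real continuous_on_mult gamma_char_continuous continuous_intros) auto
  then have "(?f has_integral integral {-R'..R'} ?f) {-R'..R'}"
    by (rule integrable_integral)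
  moreover have "(\<lambda>l. if l \<in> {-R'..R'} then ?f l else 0) = ?f"
    using \<psi>(2) R' by (auto simp: vanishes_beyond_def fun_eq_iff abs_le_iff)
  ultimately have "(?f has_integral integral {-R'..R'} ?f) UNIV"
    using has_integral_restrict_UNIV[of "{-R'..R'}" ?f] by simp
  then show "FT \<psi> t = integral {-R'..R'} ?f" "(?f has_integral FT \<psi> t) UNIV"
    by (auto simp: FT_def has_integral_iff)
qed

lemma test_funD:
  assumes "test_fun \<psi>"
  shows "continuous_on S \<psi>" "\<exists>R>0. vanishes_beyond R \<psi>" "smooth \<psi>"
proof -
  show "continuous_on S \<psi>" "smooth \<psi>"
    using assms smooth_continuous by (auto simp: test_fun_def)
  obtain R where "vanishes_beyond R \<psi>"
    using assms by (auto simp: test_fun_def)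
  then have "vanishes_beyond (max R 1) \<psi>"
    by (auto simp: vanishes_beyond_def)
  then show "\<exists>R>0. vanishes_beyond R \<psi>"
    by (intro exI[of _ "max R 1"]) auto
qed

lemma FT_integrable: "test_fun \<psi> \<Longrightarrow> ((\<lambda>l. \<psi> l * gamma_char t l) has_integral FT \<psi> t) UNIV"
  using FT_has_integral(1)[OF test_funD(1)] test_funD(2) by blast

lemma FT_add: "test_fun \<psi> \<Longrightarrow> test_fun \<theta> \<Longrightarrow> FT (\<lambda>l. \<psi> l + \<theta> l) t = FT \<psi> t + FT \<theta> t"
  using has_integral_add[OF FT_integrable FT_integrable, of \<psi> \<theta> t t]
  by (simp add: FT_def has_integral_iff distrib_right)

lemma FT_cmult: "test_fun \<psi> \<Longrightarrow> FT (\<lambda>l. c * \<psi> l) t = c * FT \<psi> t"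
  using has_integral_mult_right[OF FT_integrable, of \<psi> c t] by (simp add: FT_def has_integral_iff mult.assoc)

lemma FT_modulate: "FT (\<lambda>l. gamma_char c l * \<psi> l) t = FT \<psi> (t + c)"
  by (simp add: FT_def gamma_char_add_left mult_ac)

lemma FT_shift:
  assumes "test_fun \<psi>"
  shows "FT (\<lambda>l. \<psi> (l + a)) t = gamma_char (- a) t * FT \<psi> t"
proof -
  have "((\<lambda>l. \<psi> (l + a) * gamma_char t (l + a)) has_integral FT \<psi> t) UNIV"
    using has_integral_affine_UNIV[OF FT_integrable[OF assms], of 1 a t] by simp
  from has_integral_mult_right[OF this, of "gamma_char (- a) t"]
  have "((\<lambda>l. gamma_char (- a) t * (\<psi> (l + a) * gamma_char t (l + a))) has_integral gamma_char (- a) t * FT \<psi> t) UNIV" .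
  moreover have "gamma_char (- a) t * (\<psi> (l + a) * gamma_char t (l + a)) = \<psi> (l + a) * gamma_char t l" for l
  proof -
    have "gamma_char (- a) t * gamma_char t (l + a) = gamma_char t (- a + (l + a))"
      by (simp only: gamma_char_add gamma_char_commute[of "- a" t])
    then show ?thesis
      by (simp add: mult_ac)
  qed
  ultimately show ?thesis
    by (simp add: FT_def has_integral_iff)
qed

lemma FT_scale:
  assumes "test_fun \<psi>" "m > 0"
  shows "FT (\<lambda>l. \<psi> (l / m)) t = of_real m * FT \<psi> (m * t)"
proof -
  have "((\<lambda>l. \<psi> (l / m) * gamma_char (m * t) (l / m)) has_integral m *\<^sub>R FT \<psi> (m * t)) UNIV"
    using has_integral_affine_UNIV[OF FT_integrable[OF assms(1)], of "1 / m" 0 "m * t"] assms(2) by simp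
  moreover have "gamma_char (m * t) (l / m) = gamma_char t l" for l
    using assms(2) by (simp add: gamma_char_def)
  ultimately show ?thesis
    by (simp add: FT_def has_integral_iff scaleR_conv_of_real)
qed

lemma FT_deriv:
  assumes \<psi>: "test_fun \<psi>"
  shows "(FT \<psi> has_vector_derivative FT (\<lambda>l. \<i> * of_real l * \<psi> l) t) (at t)"
proof -
  obtain R where R: "R > 0" "vanishes_beyond R \<psi>"
    using test_funD(2)[OF \<psi>] by blast
  have supp: "vanishes_beyond R (\<lambda>l. \<i> * of_real l * \<psi> l)"
    using R(2) by (simp add: vanishes_beyond_def)
  have cont: "continuous_on UNIV (\<lambda>l. \<i> * of_real l * \<psi> l)"
    by (intro continuous_intros test_funD[OF \<psi>])
  have c: "continuous_on (UNIV \<times> cbox (-R) R) (\<lambda>(x, l). \<i> * of_real l * \<psi> l * gamma_char x l)"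
    unfolding case_prod_beta
    by (intro continuous_on_mult gamma_char_continuous continuous_on_compose2[OF test_funD(1)[OF \<psi>, of UNIV]]
        continuous_intros) auto
  have "((\<lambda>x. integral (cbox (-R) R) (\<lambda>l. \<psi> l * gamma_char x l)) has_vector_derivative
      integral (cbox (-R) R) (\<lambda>l. \<i> * of_real l * \<psi> l * gamma_char t l)) (at t within UNIV)"
  proof (rule leibniz_rule_vector_derivative[OF _ _ c])
    fix x l :: real
    have "((\<lambda>x. \<psi> l * gamma_char l x) has_vector_derivative \<psi> l * (\<i> * of_real l * gamma_char l x)) (at x)"
      by (intro has_vector_derivative_mult_right gamma_char_deriv)
    then show "((\<lambda>x. \<psi> l * gamma_char x l) has_vector_derivative \<i> * of_real l * \<psi> l * gamma_char x l) (at x within UNIV)"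
      by (simp add: gamma_char_commute[of _ l] mult_ac)
    show "(\<lambda>l. \<psi> l * gamma_char x l) integrable_on cbox (- R) R"
      by (intro integrable_continuous continuous_on_mult gamma_char_continuous test_funD[OF \<psi>] continuous_intros)
  qed auto
  moreover have "FT \<psi> = (\<lambda>x. integral (cbox (-R) R) (\<lambda>l. \<psi> l * gamma_char x l))"
    using FT_has_integral(2)[OF test_funD(1)[OF \<psi>] R(2) order_refl] by (simp add: fun_eq_iff)
  ultimately show ?thesis
    using FT_has_integral(2)[OF cont supp order_refl, of t] by simp
qed

text \<open>
  Integration by parts, without boundary terms as \<open>\<psi>\<close> has compact support.  Differentiating \<open>\<psi>\<close>
  repeatedly thus bounds every power of \<open>t\<close> times the transform.
\<close>
lemma FT_of_deriv:
  assumes \<psi>: "test_fun \<psi>" and \<psi>': "\<And>t. (\<psi> has_vector_derivative \<psi>' t) (at t)" "smooth \<psi>'"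
  shows "FT \<psi>' t = - (\<i> * of_real t * FT \<psi> t)"
proof -
  obtain R where R: "R > 0" "vanishes_beyond R \<psi>"
    using test_funD(2)[OF \<psi>] by blast
  have supp: "vanishes_beyond R \<psi>'"
    by (rule vanishes_beyond_deriv[OF R(2) \<psi>'(1)])
  let ?R = "R + 1"
  have "((\<lambda>l. \<psi> l * gamma_char t l) has_vector_derivative
      \<psi> l * (\<i> * of_real t * gamma_char t l) + \<psi>' l * gamma_char t l) (at l within {-?R..?R})" for l
    by (rule has_vector_derivative_at_within[OF has_vector_derivative_mult[OF \<psi>'(1) gamma_char_deriv]])
  then have "((\<lambda>l. \<psi> l * (\<i> * of_real t * gamma_char t l) + \<psi>' l * gamma_char t l) has_integral
      (\<psi> ?R * gamma_char t ?R - \<psi> (- ?R) * gamma_char t (- ?R))) {-?R..?R}"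
    using R(1) by (intro fundamental_theorem_of_calculus) auto
  moreover have "\<psi> ?R = 0" "\<psi> (- ?R) = 0"
    using R by (auto simp: vanishes_beyond_def)
  ultimately have "((\<lambda>l. \<i> * of_real t * (\<psi> l * gamma_char t l) + \<psi>' l * gamma_char t l) has_integral 0) {-?R..?R}"
    by (simp add: mult_ac)
  moreover have "((\<lambda>l. \<i> * of_real t * (\<psi> l * gamma_char t l) + \<psi>' l * gamma_char t l) has_integral
      \<i> * of_real t * FT \<psi> t + FT \<psi>' t) {-?R..?R}"
  proof (intro has_integral_add has_integral_mult_right)
    have c: "(\<lambda>l. \<theta> l * gamma_char t l) integrable_on {-?R..?R}" if "smooth \<theta>" for \<theta>
      by (intro integrable_continuous_real continuous_on_mult gamma_char_continuous smooth_continuous that continuous_intros)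
    show "((\<lambda>l. \<psi> l * gamma_char t l) has_integral FT \<psi> t) {-?R..?R}"
      using FT_has_integral(2)[OF test_funD(1)[OF \<psi>] R(2), of ?R t] c[OF test_funD(3)[OF \<psi>]] R(1)
      by (simp add: integrable_integral)
    show "((\<lambda>l. \<psi>' l * gamma_char t l) has_integral FT \<psi>' t) {-?R..?R}"
      using FT_has_integral(2)[OF smooth_continuous[OF \<psi>'(2)] supp, of ?R t] c[OF \<psi>'(2)] R(1)
      by (simp add: integrable_integral)
  qed
  ultimately have "\<i> * of_real t * FT \<psi> t + FT \<psi>' t = 0"
    by (rule has_integral_unique[symmetric])
  then show ?thesis
    by (simp add: eq_neg_iff_add_eq_0 add.commute)
qed

lemma FT_bounded:
  assumes \<psi>: "test_fun \<psi>"
  shows "\<exists>B. \<forall>t. cmod (FT \<psi> t) \<le> B"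
proof -
  obtain R where R: "R > 0" "vanishes_beyond R \<psi>"
    using test_funD(2)[OF \<psi>] by blast
  have "compact (\<psi> ` {-R..R})"
    by (intro compact_continuous_image test_funD[OF \<psi>]) auto
  then have "bounded (\<psi> ` {-R..R})"
    by (rule compact_imp_bounded)
  then obtain M where "\<forall>z\<in>\<psi> ` {-R..R}. norm z \<le> M"
    unfolding bounded_iff by (elim exE)
  then have M: "cmod (\<psi> l) \<le> M" if "l \<in> {-R..R}" for l
    using that by blast
  have "cmod (FT \<psi> t) \<le> M * (R - (- R))" for t
    unfolding FT_has_integral(2)[OF test_funD(1)[OF \<psi>] R(2) order_refl]
    by (rule integral_bound, use R in simp,
        intro continuous_on_mult gamma_char_continuous test_funD[OF \<psi>] continuous_intros)
      (use M in \<open>auto simp: norm_mult\<close>)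
  then show ?thesis
    by blast
qed

lemma FT_rapid_decay:
  assumes "test_fun \<psi>"
  shows "\<exists>B. \<forall>t. \<bar>t\<bar> ^ j * cmod (FT \<psi> t) \<le> B"
  using assms
proof (induction j arbitrary: \<psi>)
  case 0
  then show ?case
    using FT_bounded by simp
next
  case (Suc j)
  obtain \<psi>' where \<psi>': "\<And>t. (\<psi> has_vector_derivative \<psi>' t) (at t)" "smooth \<psi>'"
    using smooth_derivE[OF test_funD(3)[OF Suc.prems]] by blast
  have "test_fun \<psi>'"
    using \<psi>' vanishes_beyond_deriv[OF _ \<psi>'(1)] test_funD(2)[OF Suc.prems] by (auto simp: test_fun_def)
  from Suc.IH[OF this] obtain B where "\<forall>t. \<bar>t\<bar> ^ j * cmod (FT \<psi>' t) \<le> B"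
    by blast
  then have "\<bar>t\<bar> ^ Suc j * cmod (FT \<psi> t) \<le> B" for t
    unfolding FT_of_deriv[OF Suc.prems \<psi>'] by (simp add: norm_mult mult_ac)
  then show ?case
    by blast
qed

lemma smooth_polynomial: "smooth (\<lambda>l. \<i> * of_real l)"
  using smooth_entire[of "\<lambda>z. \<i> * z"] by (simp add: holomorphic_intros)

lemma FT_schwartz:
  assumes \<psi>: "test_fun \<psi>"
  shows "FT \<psi> \<in> schwartz"
proof -
  define D where "D k = FT (\<lambda>l. (\<i> * of_real l) ^ k * \<psi> l)" for k
  have test: "test_fun (\<lambda>l. (\<i> * of_real l) ^ k * \<psi> l)" for k
  proof (induction k)
    case (Suc k)
    from test_fun_mult[OF this smooth_polynomial] show ?case
      by (simp add: mult.assoc)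
  qed (use \<psi> in simp)
  have "(D k has_vector_derivative D (Suc k) t) (at t)" for k t
    using FT_deriv[OF test[of k], of t] by (simp add: D_def mult.assoc)
  moreover have "bounded (range (\<lambda>t. \<bar>t\<bar> ^ j *\<^sub>R D k t))" for j k
    using FT_rapid_decay[OF test[of k], of j] by (auto simp: bounded_iff D_def)
  moreover have "D 0 = FT \<psi>"
    by (simp add: D_def)
  ultimately show ?thesis
    unfolding schwartz_def by blast
qed

lemma FT_continuous: "test_fun \<psi> \<Longrightarrow> continuous_on S (FT \<psi>)"
  by (meson FT_deriv has_vector_derivative_continuous continuous_at_imp_continuous_on)

lemma FT_decaying:
  assumes \<psi>: "test_fun \<psi>"
  shows "decaying (FT \<psi>)"
  unfolding decaying_def
proof (intro conjI FT_continuous[OF \<psi>])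
  obtain B where B: "\<forall>t. \<bar>t\<bar> ^ 0 * cmod (FT \<psi> t) \<le> B"
    using FT_rapid_decay[OF \<psi>] by blast
  obtain C where C: "\<forall>t. \<bar>t\<bar> ^ 2 * cmod (FT \<psi> t) \<le> C"
    using FT_rapid_decay[OF \<psi>] by blast
  have "cmod (FT \<psi> s) \<le> (B + C) * weight s" for s
  proof -
    have "(1 + s\<^sup>2) * cmod (FT \<psi> s) \<le> B + C"
      using B[rule_format, of s] C[rule_format, of s] by (simp add: distrib_right)
    moreover have "1 + s\<^sup>2 > 0"
      by (simp add: add_pos_nonneg)
    ultimately show ?thesis
      by (simp add: weight_def pos_le_divide_eq mult.commute)
  qed
  then show "\<exists>C. \<forall>s. cmod (FT \<psi> s) \<le> C * weight s"
    by blast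
qed

text \<open>
  The Fourier multiplier of the unit mean.
\<close>
definition mean_symbol :: "complex \<Rightarrow> complex"
  where "mean_symbol z = (if z = 0 then 1 else (exp (\<i> * z) - 1) / (\<i> * z))"

lemma mean_symbol_holomorphic: "mean_symbol holomorphic_on UNIV"
proof -
  let ?f = "\<lambda>z. exp (\<i> * z) / \<i>"
  have "(\<lambda>z. if z = 0 then deriv ?f 0 else (?f z - ?f 0) / (z - 0)) holomorphic_on UNIV"
    by (intro pole_lemma holomorphic_intros) auto
  moreover have "deriv ?f 0 = 1"
    by (rule DERIV_imp_deriv) (auto intro!: derivative_eq_intros)
  moreover have "(if z = 0 then 1 else (?f z - ?f 0) / (z - 0)) = mean_symbol z" for z
    by (cases "z = 0") (simp_all add: mean_symbol_def field_simps)
  ultimately show ?thesis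
    by (simp only:)
qed

text \<open>
  In terms of multipliers: the unit mean of a derivative is a unit difference.
\<close>
lemma mean_symbol_mult: "\<i> * z * mean_symbol z = exp (\<i> * z) - 1"
  by (simp add: mean_symbol_def)

lemma mean_symbol_integral: "((\<lambda>x. gamma_char x l) has_integral mean_symbol (of_real l)) {0..1}"
proof (cases "l = 0")
  case True
  then show ?thesis
    using has_integral_const_real[of "1::complex" 0 1] by (simp add: gamma_char_def mean_symbol_def)
next
  case False
  have "((\<lambda>x. gamma_char l x / (\<i> * of_real l)) has_vector_derivative gamma_char l x) (at x within {0..1})" for x
    using has_vector_derivative_at_within[OF has_vector_derivative_divide[OF gamma_char_deriv[of l x], of "\<i> * of_real l"]] False
    by simp
  then have "((\<lambda>x. gamma_char l x) has_integral (gamma_char l 1 / (\<i> * of_real l) - gamma_char l 0 / (\<i> * of_real l))) {0..1}"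
    by (intro fundamental_theorem_of_calculus) auto
  then show ?thesis
    using False by (simp add: gamma_char_commute[of _ l] mean_symbol_def diff_divide_distrib) (simp add: gamma_char_def)
qed

lemma FT_window:
  assumes \<psi>: "test_fun \<psi>"
  shows "integral {0..1} (\<lambda>x. FT \<psi> (s + x)) = FT (\<lambda>l. mean_symbol (of_real l) * \<psi> l) s"
proof -
  obtain R where R: "R > 0" "vanishes_beyond R \<psi>"
    using test_funD(2)[OF \<psi>] by blast
  let ?H = "\<lambda>x l. \<psi> l * gamma_char (s + x) l"
  have "integral {0..1} (\<lambda>x. FT \<psi> (s + x)) = integral {0..1} (\<lambda>x. integral {-R..R} (?H x))"
    using FT_has_integral(2)[OF test_funD(1)[OF \<psi>] R(2) order_refl] by simp
  also have "\<dots> = integral {-R..R} (\<lambda>l. integral {0..1} (\<lambda>x. ?H x l))"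
  proof -
    have "continuous_on (cbox (0, -R) (1, R)) (\<lambda>(x, l). ?H x l)"
      unfolding case_prod_beta
      by (intro continuous_on_mult gamma_char_continuous continuous_on_compose2[OF test_funD(1)[OF \<psi>, of UNIV]]
          continuous_intros) auto
    from integral_swap_continuous[OF this] show ?thesis
      by simp
  qed
  also have "(\<lambda>l. integral {0..1} (\<lambda>x. ?H x l)) = (\<lambda>l. mean_symbol (of_real l) * \<psi> l * gamma_char s l)"
  proof
    fix l
    have "((\<lambda>x. (\<psi> l * gamma_char s l) * gamma_char x l) has_integral (\<psi> l * gamma_char s l) * mean_symbol (of_real l)) {0..1}"
      by (intro has_integral_mult_right mean_symbol_integral)
    then show "integral {0..1} (\<lambda>x. ?H x l) = mean_symbol (of_real l) * \<psi> l * gamma_char s l"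
      by (simp add: has_integral_iff gamma_char_add_left mult_ac)
  qed
  also have "integral {-R..R} (\<lambda>l. mean_symbol (of_real l) * \<psi> l * gamma_char s l) = FT (\<lambda>l. mean_symbol (of_real l) * \<psi> l) s"
  proof (rule FT_has_integral(2)[symmetric, OF _ _ order_refl])
    show "continuous_on UNIV (\<lambda>l. mean_symbol (of_real l) * \<psi> l)"
      by (intro smooth_continuous smooth_mult smooth_entire mean_symbol_holomorphic test_funD[OF \<psi>])
    show "vanishes_beyond R (\<lambda>l. mean_symbol (of_real l) * \<psi> l)"
      using R(2) by (simp add: vanishes_beyond_def)
  qed
  finally show ?thesis .
qed

section \<open>A kernel of nonzero integral\<close>

text \<open>
  For \<open>p = 1\<close> the classical smooth function that vanishes on the negative half-line; the polynomial
  factor makes the family closed under differentiation.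
\<close>
definition flat :: "real poly \<Rightarrow> real \<Rightarrow> real"
  where "flat p x = (if x > 0 then poly p (1 / x) * exp (- (1 / x)) else 0)"

lemma poly_times_exp_minus: "((\<lambda>y. poly p y * exp (- y)) \<longlongrightarrow> (0::real)) at_top"
proof -
  have "((\<lambda>y. \<Sum>i\<le>degree p. coeff p i * (y ^ i / exp y)) \<longlongrightarrow> (\<Sum>i\<le>degree p. coeff p i * 0)) at_top"
    by (intro tendsto_intros tendsto_power_div_exp_0)
  moreover have "(\<Sum>i\<le>degree p. coeff p i * (y ^ i / exp y)) = poly p y * exp (- y)" for y
    by (simp add: poly_altdef sum_distrib_right exp_minus divide_inverse mult.assoc)
  ultimately show ?thesis
    by simp
qed

lemma flat_deriv: "(flat p has_real_derivative flat (pCons 0 (pCons 0 (p - pderiv p))) x) (at x)"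
proof -
  consider "x > 0" | "x < 0" | "x = 0"
    by linarith
  then show ?thesis
  proof cases
    case 1
    have "((\<lambda>x. poly p (1 / x) * exp (- (1 / x))) has_real_derivative
        poly p (1 / x) * (exp (- (1 / x)) * (1 / x\<^sup>2)) + (poly (pderiv p) (1 / x) * (- (1 / x\<^sup>2))) * exp (- (1 / x))) (at x)"
      using 1 by (auto intro!: derivative_eq_intros DERIV_chain2[OF poly_DERIV] simp: power2_eq_square divide_inverse)
    moreover have "poly p (1 / x) * (exp (- (1 / x)) * (1 / x\<^sup>2)) + (poly (pderiv p) (1 / x) * (- (1 / x\<^sup>2))) * exp (- (1 / x))
        = flat (pCons 0 (pCons 0 (p - pderiv p))) x"
      using 1 by (simp add: flat_def power2_eq_square algebra_simps divide_inverse)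
    ultimately have "((\<lambda>x. poly p (1 / x) * exp (- (1 / x))) has_real_derivative flat (pCons 0 (pCons 0 (p - pderiv p))) x) (at x)"
      by simp
    then show ?thesis
      by (rule has_field_derivative_transform_within_open[where S = "{0<..}"]) (use 1 in \<open>auto simp: flat_def\<close>)
  next
    case 2
    have "((\<lambda>_. 0) has_real_derivative 0) (at x)"
      by simp
    then have "(flat p has_real_derivative 0) (at x)"
      by (rule has_field_derivative_transform_within_open[where S = "{..<0}"]) (use 2 in \<open>auto simp: flat_def\<close>)
    with 2 show ?thesis
      by (simp add: flat_def)
  next
    case 3
    have right: "((\<lambda>h. flat p h / h) \<longlongrightarrow> 0) (at_right 0)"
    proof (rule Lim_transform_eventually)
      show "((\<lambda>h. poly (pCons 0 p) (inverse h) * exp (- inverse h)) \<longlongrightarrow> 0) (at_right 0)"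
        by (rule filterlim_compose[OF poly_times_exp_minus filterlim_inverse_at_top_right])
      show "\<forall>\<^sub>F h in at_right 0. poly (pCons 0 p) (inverse h) * exp (- inverse h) = flat p h / h"
        using eventually_at_right_less by eventually_elim (simp add: flat_def divide_inverse)
    qed
    have left: "((\<lambda>h. flat p h / h) \<longlongrightarrow> 0) (at_left 0)"
    proof (rule Lim_transform_eventually[OF tendsto_const])
      show "\<forall>\<^sub>F h in at_left 0. 0 = flat p h / h"
        unfolding eventually_at_filter by (simp add: flat_def)
    qed
    have "((\<lambda>h. flat p h / h) \<longlongrightarrow> 0) (at 0)"
      by (rule filterlim_split_at[OF left right])
    then show ?thesis
      by (simp add: 3 DERIV_def flat_def)
  qed
qed

lemma smooth_flat: "smooth (\<lambda>x. of_real (flat p x))"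
proof -
  have "smooth_n n (\<lambda>x. of_real (flat p x))" for n
  proof (induction n arbitrary: p)
    case (Suc n)
    have "((\<lambda>x. complex_of_real (flat p x)) has_vector_derivative of_real (flat (pCons 0 (pCons 0 (p - pderiv p))) x)) (at x)" for x
      by (intro has_vector_derivative_of_real) (use flat_deriv in \<open>simp add: has_real_derivative_iff_has_vector_derivative\<close>)
    from smooth_n_SucI[OF this Suc.IH] show ?case .
  qed simp
  then show ?thesis
    by (simp add: smooth_def)
qed

lemma bump_exists: "\<exists>\<psi>. test_fun \<psi> \<and> FT \<psi> 0 \<noteq> 0"
proof -
  define b where "b l = flat 1 (1 + l) * flat 1 (1 - l)" for l
  define \<psi> where "\<psi> l = complex_of_real (b l)" for l
  have "smooth (\<lambda>l. complex_of_real (flat 1 (1 * l + 1)) * complex_of_real (flat 1 ((-1) * l + 1)))"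
    by (intro smooth_mult smooth_affine smooth_flat)
  then have "smooth \<psi>"
    unfolding \<psi>_def b_def by (simp add: add.commute)
  moreover have supp: "vanishes_beyond 1 \<psi>"
    by (auto simp: vanishes_beyond_def \<psi>_def b_def flat_def)
  ultimately have test: "test_fun \<psi>"
    by (auto simp: test_fun_def)
  have b_cont: "continuous_on S b" for S
  proof -
    have "continuous_on S (\<lambda>l. Re (\<psi> l))"
      by (intro continuous_intros test_funD[OF test])
    then show ?thesis
      by (simp add: \<psi>_def)
  qed
  have b_nonneg: "0 \<le> b l" for l
    by (simp add: b_def flat_def)
  have FT: "FT \<psi> 0 = of_real (integral {-1..1} b)"
  proof -
    have "FT \<psi> 0 = integral {-1..1} (\<lambda>l. complex_of_real (b l))"
      using FT_has_integral(2)[OF test_funD(1)[OF test] supp order_refl, of 0] by (simp add: \<psi>_def gamma_char_def)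
    also have "\<dots> = of_real (integral {-1..1} b)"
      using integral_linear[OF integrable_continuous_real[OF b_cont] bounded_linear_of_real, of "-1" 1]
      by (simp add: o_def)
    finally show ?thesis .
  qed
  have "integral {-1..1} b \<noteq> 0"
  proof
    assume "integral {-1..1} b = 0"
    then have "(b has_integral 0) (cbox (-1) 1)"
      using integrable_integral[OF integrable_continuous_real[OF b_cont], of "-1" 1] by simp
    then have "b 0 = 0"
      using b_cont b_nonneg by (intro has_integral_0_cbox_imp_0[of "-1" 1 b]) auto
    then show False
      by (simp add: b_def flat_def)
  qed
  with test FT show ?thesis
    by auto
qed

text \<open>
  The reflection turns the value at \<open>0\<close> of a convolution into the integral of a product with
  \<open>FT \<psi>\<close>.
\<close>
lemma C_ub_FT_reflected:
  assumes \<psi>: "test_fun \<psi>"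
  shows "(\<lambda>t. FT \<psi> (- t)) \<in> C_ub"
proof -
  have \<psi>': "test_fun (\<lambda>l. \<i> * of_real l * \<psi> l)"
    using test_fun_mult[OF \<psi> smooth_polynomial] by simp
  obtain B where B: "\<forall>t. cmod (FT \<psi> t) \<le> B"
    using FT_bounded[OF \<psi>] by blast
  obtain C where C: "\<forall>t. cmod (FT (\<lambda>l. \<i> * of_real l * \<psi> l) t) \<le> C"
    using FT_bounded[OF \<psi>'] by blast
  have lip: "norm (FT \<psi> s - FT \<psi> t) \<le> C * norm (s - t)" for s t
  proof (rule differentiable_bound[of UNIV _ "\<lambda>t h. h *\<^sub>R FT (\<lambda>l. \<i> * of_real l * \<psi> l) t"])
    show "(FT \<psi> has_derivative (\<lambda>h. h *\<^sub>R FT (\<lambda>l. \<i> * of_real l * \<psi> l) t)) (at t within UNIV)" for t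
      using FT_deriv[OF \<psi>] by (simp add: has_vector_derivative_def)
    show "onorm (\<lambda>h. h *\<^sub>R FT (\<lambda>l. \<i> * of_real l * \<psi> l) t) \<le> C" for t
      using C by (simp add: onorm_scaleR_left onorm_id bounded_linear_ident)
  qed auto
  have "uniformly_continuous_on UNIV (\<lambda>t. FT \<psi> (- t))"
  proof (rule lipschitz_on_uniformly_continuous)
    have "0 \<le> C"
      using C norm_ge_zero order_trans by blast
    then show "C-lipschitz_on UNIV (\<lambda>t. FT \<psi> (- t))"
      using lip by (intro lipschitz_onI) (simp add: dist_norm, metis minus_diff_minus norm_minus_cancel real_norm_def)
  qed
  moreover have "bounded (range (\<lambda>t. FT \<psi> (- t)))"
    using B by (auto simp: bounded_iff)
  ultimately show ?thesis
    by (simp add: C_ub_def)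
qed

text \<open>
  Up to scaling the Fejer kernel: it is nonnegative, decays quadratically, and is an average of
  characters.
\<close>
definition fejer :: "real \<Rightarrow> complex"
  where "fejer s = mean_symbol (of_real s) * mean_symbol (of_real (- s))"

lemma mean_symbol_continuous: "continuous_on S f \<Longrightarrow> continuous_on S (\<lambda>x. mean_symbol (of_real (f x)))"
  using continuous_on_compose2[OF holomorphic_on_imp_continuous_on[OF mean_symbol_holomorphic], of S "\<lambda>x. of_real (f x)"]
  by (auto intro: continuous_intros)

lemma mean_symbol_cnj: "mean_symbol (of_real (- s)) = cnj (mean_symbol (of_real s))"
  by (simp add: mean_symbol_def exp_cnj)

lemma fejer_eq: "fejer s = of_real ((cmod (mean_symbol (of_real s)))\<^sup>2)"
  unfolding fejer_def mean_symbol_cnj by (rule complex_norm_square[symmetric])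

lemma mean_symbol_bound: "cmod (mean_symbol (of_real s)) \<le> 1"
proof -
  have "norm (mean_symbol (of_real s)) \<le> 1 * (1 - 0)"
    using integral_bound[of 0 1 "\<lambda>x. gamma_char x s" 1] mean_symbol_integral[of s]
    by (simp add: has_integral_iff gamma_char_continuous continuous_on_id continuous_on_const)
  then show ?thesis
    by simp
qed

lemma fejer_decaying: "decaying fejer"
  unfolding decaying_def
proof (intro conjI exI allI)
  show "continuous_on UNIV fejer"
    unfolding fejer_def[abs_def] by (intro continuous_on_mult mean_symbol_continuous continuous_intros)
  fix s :: real
  let ?m = "cmod (mean_symbol (of_real s))"
  have "\<bar>s\<bar> * ?m \<le> 2"
  proof -
    have "\<bar>s\<bar> * ?m = cmod (\<i> * of_real s * mean_symbol (of_real s))"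
      by (simp add: norm_mult)
    also have "\<dots> = cmod (gamma_char 1 s - 1)"
      unfolding mean_symbol_mult by (simp add: gamma_char_def)
    also have "\<dots> \<le> cmod (gamma_char 1 s) + cmod 1"
      by (rule norm_triangle_ineq4)
    finally show ?thesis
      by simp
  qed
  then have "(\<bar>s\<bar> * ?m)\<^sup>2 \<le> 2\<^sup>2"
    by (intro power_mono) auto
  moreover have "?m\<^sup>2 \<le> 1\<^sup>2"
    by (intro power_mono mean_symbol_bound) auto
  ultimately have "(1 + s\<^sup>2) * ?m\<^sup>2 \<le> 5"
    by (simp add: power_mult_distrib distrib_right)
  moreover have "1 + s\<^sup>2 > 0"
    by (simp add: add_pos_nonneg)
  moreover have "cmod (fejer s) = ?m\<^sup>2"
    unfolding fejer_eq norm_of_real by simp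
  ultimately show "cmod (fejer s) \<le> 5 * weight s"
    unfolding weight_def by (simp add: pos_le_divide_eq mult.commute)
qed

lemma fejer_integral_nonzero: "integral UNIV fejer \<noteq> 0"
proof -
  let ?g = "\<lambda>s. (cmod (mean_symbol (of_real s)))\<^sup>2"
  have cont: "continuous_on S ?g" for S
    by (intro continuous_intros mean_symbol_continuous)
  have int: "fejer integrable_on UNIV"
    using fejer_decaying weighted_integrable unfolding decaying_def by blast
  have "(Re \<circ> fejer) integrable_on UNIV"
    by (rule integrable_linear[OF int bounded_linear_Re])
  then have gint: "?g integrable_on UNIV"
    by (simp add: o_def fejer_eq)
  have "Re (integral UNIV fejer) = integral UNIV ?g"
    using integral_linear[OF int bounded_linear_Re] by (simp add: o_def fejer_eq)
  moreover have "integral {-1..1} ?g \<le> integral UNIV ?g"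
    using gint by (intro integral_subset_le integrable_continuous_real cont) auto
  moreover have "integral {-1..1} ?g \<noteq> 0"
  proof
    assume "integral {-1..1} ?g = 0"
    then have "(?g has_integral 0) (cbox (-1) 1)"
      using integrable_integral[OF integrable_continuous_real[OF cont], of "-1" 1] by simp
    then have "?g 0 = 0"
      using cont by (intro has_integral_0_cbox_imp_0[of "-1" 1 ?g]) auto
    then show False
      by (simp add: mean_symbol_def)
  qed
  moreover have "0 \<le> integral {-1..1} ?g"
    by (intro integral_nonneg integrable_continuous_real cont) simp
  ultimately have "Re (integral UNIV fejer) > 0"
    by linarith
  then show ?thesis
    by auto
qed

lemma mean_symbol_integral_scaled:
  "((\<lambda>x. gamma_char (x * m) s) has_integral mean_symbol (of_real (m * s))) {0..1}"
  using mean_symbol_integral[of "m * s"] by (simp add: gamma_char_def mult.assoc)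

text \<open>
  Translating \<open>\<psi>\<close> multiplies \<open>FT \<psi>\<close> by a character.  If all integrals vanished, then \<open>FT \<psi>\<close> would be
  orthogonal to every character, hence to the averages \<open>fejer\<close> of characters and their rescalings.
  The latter form an approximate identity, so \<open>FT \<psi> 0\<close> would vanish for every \<open>\<psi>\<close>, contrary to
  \<open>bump_exists\<close>.
\<close>
lemma exists_test_fun_integral_nonzero: "\<exists>\<psi>. test_fun \<psi> \<and> integral UNIV (FT \<psi>) \<noteq> 0"
proof (rule ccontr)
  assume "\<nexists>\<psi>. test_fun \<psi> \<and> integral UNIV (FT \<psi>) \<noteq> 0"
  then have zero: "integral UNIV (FT \<psi>) = 0" if "test_fun \<psi>" for \<psi>
    using that by blast
  obtain \<psi> where \<psi>: "test_fun \<psi>" "FT \<psi> 0 \<noteq> 0"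
    using bump_exists by blast
  obtain C where C: "continuous_on UNIV (FT \<psi>)" "\<And>s. cmod (FT \<psi> s) \<le> C * weight s"
    using FT_decaying[OF \<psi>(1)] unfolding decaying_def by blast
  have modulated: "integral UNIV (\<lambda>s. gamma_char w s * FT \<psi> s) = 0" for w
  proof -
    have "test_fun (\<lambda>l. \<psi> (1 * l + - w))"
      by (rule test_fun_affine[OF \<psi>(1)]) simp
    from zero[OF this] have "integral UNIV (FT (\<lambda>l. \<psi> (l + - w))) = 0"
      by simp
    moreover have "FT (\<lambda>l. \<psi> (l + - w)) = (\<lambda>s. gamma_char w s * FT \<psi> s)"
      by (rule ext) (simp only: FT_shift[OF \<psi>(1)] minus_minus)
    ultimately show ?thesis
      by simp
  qed
  let ?v = "\<lambda>t. FT \<psi> (- t)"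
  have conv0: "conv (\<lambda>s. of_nat n * fejer (real n * s)) ?v 0 = 0" for n
  proof -
    let ?m = "\<lambda>s. mean_symbol (of_real (real n * s))"
    have inner: "integral UNIV (\<lambda>s. ?m (- s) * (gamma_char w s * FT \<psi> s)) = 0" for w
    proof -
      have "integral UNIV (\<lambda>s. ?m (- s) * (gamma_char w s * FT \<psi> s))
          = integral UNIV (\<lambda>s. integral {0..1} (\<lambda>y. gamma_char (w - y * real n) s * FT \<psi> s))"
      proof (rule arg_cong[where f = "integral UNIV"], rule ext)
        fix s
        have "((\<lambda>y. gamma_char (y * real n) (- s) * (gamma_char w s * FT \<psi> s)) has_integral
            ?m (- s) * (gamma_char w s * FT \<psi> s)) {0..1}"
          by (intro has_integral_mult_left mean_symbol_integral_scaled)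
        moreover have "gamma_char (y * real n) (- s) * (gamma_char w s * FT \<psi> s) = gamma_char (w - y * real n) s * FT \<psi> s" for y
        proof -
          have "gamma_char (w - y * real n) s = gamma_char w s * gamma_char (- (y * real n)) s"
            using gamma_char_add_left[of w "- (y * real n)" s] by simp
          moreover have "gamma_char (- (y * real n)) s = gamma_char (y * real n) (- s)"
            by (simp add: gamma_char_def)
          ultimately show ?thesis
            by simp
        qed
        ultimately have "((\<lambda>y. gamma_char (w - y * real n) s * FT \<psi> s) has_integral
            ?m (- s) * (gamma_char w s * FT \<psi> s)) {0..1}"
          by (simp only:)
        then show "?m (- s) * (gamma_char w s * FT \<psi> s) = integral {0..1} (\<lambda>y. gamma_char (w - y * real n) s * FT \<psi> s)"
          by (rule integral_unique[symmetric])
      qed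
      also have "\<dots> = integral {0..1} (\<lambda>y. integral UNIV (\<lambda>s. gamma_char (w - y * real n) s * FT \<psi> s))"
      proof (rule integral_swap_weighted[symmetric, where C = C])
        show "continuous_on UNIV (\<lambda>(s, y). gamma_char (w - y * real n) s * FT \<psi> s)"
          unfolding case_prod_beta
          by (intro continuous_on_mult gamma_char_continuous continuous_on_compose2[OF C(1)] continuous_intros) auto
        show "norm (gamma_char (w - y * real n) s * FT \<psi> s) \<le> C * weight s" for s y
          using C(2)[of s] by (simp add: norm_mult)
      qed
      also have "\<dots> = 0"
        by (simp add: modulated)
      finally show ?thesis .
    qed
    have "integral UNIV (\<lambda>s. fejer (real n * s) * FT \<psi> s)
        = integral UNIV (\<lambda>s. integral {0..1} (\<lambda>x. ?m (- s) * (gamma_char (x * real n) s * FT \<psi> s)))"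
    proof (rule arg_cong[where f = "integral UNIV"], rule ext)
      fix s
      have "((\<lambda>x. ?m (- s) * (gamma_char (x * real n) s * FT \<psi> s)) has_integral ?m (- s) * (?m s * FT \<psi> s)) {0..1}"
        by (intro has_integral_mult_right has_integral_mult_left mean_symbol_integral_scaled)
      from integral_unique[OF this]
      show "fejer (real n * s) * FT \<psi> s = integral {0..1} (\<lambda>x. ?m (- s) * (gamma_char (x * real n) s * FT \<psi> s))"
        by (simp only: fejer_def mult_minus_left mult_minus_right mult_ac)
    qed
    also have "\<dots> = integral {0..1} (\<lambda>x. integral UNIV (\<lambda>s. ?m (- s) * (gamma_char (x * real n) s * FT \<psi> s)))"
    proof (rule integral_swap_weighted[symmetric, where C = C])
      show "continuous_on UNIV (\<lambda>(s, x). ?m (- s) * (gamma_char (x * real n) s * FT \<psi> s))"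
        unfolding case_prod_beta
        by (intro continuous_on_mult mean_symbol_continuous gamma_char_continuous continuous_on_compose2[OF C(1)] continuous_intros) auto
      show "norm (?m (- s) * (gamma_char (x * real n) s * FT \<psi> s)) \<le> C * weight s" for s x
        using mult_mono[OF mean_symbol_bound[of "real n * - s"] C(2)[of s]] by (simp add: norm_mult)
    qed
    also have "\<dots> = 0"
      unfolding inner by simp
    finally have "integral UNIV (\<lambda>s. of_nat n * (fejer (real n * s) * FT \<psi> s)) = 0"
      by simp
    then show ?thesis
      by (simp add: conv_def scaleC_complex_def mult.assoc)
  qed
  have "norm (integral UNIV fejer * FT \<psi> 0) \<le> e" if e: "e > 0" for e
  proof -
    obtain n :: nat where "\<forall>t. norm (conv (\<lambda>s. of_nat n * fejer (real n * s)) ?v t - integral UNIV fejer *\<^sub>C ?v t) \<le> e"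
      using conv_approximate_identity[OF fejer_decaying C_ub_FT_reflected[OF \<psi>(1)] e] by (elim exE conjE)
    from spec[OF this, of 0] show ?thesis
      by (simp add: conv0 scaleC_complex_def)
  qed
  then have "norm (integral UNIV fejer * FT \<psi> 0) \<le> 0"
    by (rule field_le_epsilon) (simp only: add_0)
  with fejer_integral_nonzero \<psi>(2) show False
    by simp
qed

section \<open>Real zeros of entire functions\<close>

lemma entire_remove_zero:
  assumes q: "q holomorphic_on UNIV" "q \<xi> = 0" and nz: "\<exists>z. q z \<noteq> (0::complex)"
  shows "\<exists>n g. g holomorphic_on UNIV \<and> g \<xi> \<noteq> 0 \<and> (\<forall>z. q z = (z - \<xi>) ^ n * g z)"
proof -
  have "\<not> q constant_on UNIV"
    using nz q(2) unfolding constant_on_def by (metis UNIV_I)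
  then obtain g r n where g: "0 < n" "0 < r" "g holomorphic_on ball \<xi> r"
      "\<And>w. w \<in> ball \<xi> r \<Longrightarrow> q w = (w - \<xi>) ^ n * g w" "\<And>w. w \<in> ball \<xi> r \<Longrightarrow> g w \<noteq> 0"
    using holomorphic_factor_zero_nonconstant[OF q(1) open_UNIV connected_UNIV UNIV_I q(2)] by metis
  define G where "G z = (if z = \<xi> then g \<xi> else q z / (z - \<xi>) ^ n)" for z
  have G_ball: "G w = g w" if "w \<in> ball \<xi> r" for w
    using g(4)[OF that] by (simp add: G_def)
  have "G holomorphic_on ball \<xi> r"
    using g(3) by (rule holomorphic_transform) (simp add: G_ball)
  moreover have "G holomorphic_on - {\<xi>}"
  proof (rule holomorphic_transform)
    show "(\<lambda>z. q z / (z - \<xi>) ^ n) holomorphic_on - {\<xi>}"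
      by (intro holomorphic_intros holomorphic_on_subset[OF q(1)]) auto
  qed (simp add: G_def)
  ultimately have "G holomorphic_on ball \<xi> r \<union> - {\<xi>}"
    by (intro holomorphic_on_Un) auto
  moreover have "ball \<xi> r \<union> - {\<xi>} = UNIV"
    using g(2) by auto
  ultimately have "G holomorphic_on UNIV"
    by simp
  moreover have "G \<xi> \<noteq> 0"
    using g(2,5) G_ball by simp
  moreover have "q z = (z - \<xi>) ^ n * G z" for z
    using q(2) g(1) by (simp add: G_def zero_power)
  ultimately show ?thesis
    by blast
qed

text \<open>
  The real zeros of \<open>q\<close> in \<open>[-R, R]\<close> are finitely many and of finite order, so a property that
  survives the removal of one linear factor reaches an entire function without such zeros.
\<close>
lemma remove_real_zeros:
  fixes P :: "(complex \<Rightarrow> complex) \<Rightarrow> bool"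
  assumes step: "\<And>q \<omega>. q holomorphic_on UNIV \<Longrightarrow> P (\<lambda>z. (z - of_real \<omega>) * q z) \<Longrightarrow> P q"
    and q: "q holomorphic_on UNIV" "\<exists>z. q z \<noteq> 0" "P q"
  shows "\<exists>q'. q' holomorphic_on UNIV \<and> (\<forall>l::real. \<bar>l\<bar> \<le> R \<longrightarrow> q' (of_real l) \<noteq> 0) \<and> P q'"
proof -
  define Z where "Z q = {l::real. \<bar>l\<bar> \<le> R \<and> q (of_real l) = 0}" for q :: "complex \<Rightarrow> complex"
  have fin: "finite (Z q)" if "q holomorphic_on UNIV" "\<exists>z. q z \<noteq> 0" for q
  proof (cases "q constant_on UNIV")
    case True
    with that(2) have "Z q = {}"
      by (auto simp: Z_def constant_on_def)
    then show ?thesis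
      by simp
  next
    case False
    have "finite {z \<in> complex_of_real ` {-R..R}. q z = 0}"
      by (rule holomorphic_compact_finite_zeros[OF that(1) open_UNIV connected_UNIV _ subset_UNIV False])
        (intro compact_continuous_image continuous_intros compact_Icc)
    moreover have "complex_of_real ` Z q \<subseteq> {z \<in> complex_of_real ` {-R..R}. q z = 0}"
      by (auto simp: Z_def abs_le_iff)
    ultimately have "finite (complex_of_real ` Z q)"
      by (rule finite_subset[rotated])
    then show ?thesis
      by (rule finite_imageD) (auto simp: inj_on_def)
  qed
  have iterate: "P g" if "g holomorphic_on UNIV" "P (\<lambda>z. (z - of_real \<omega>) ^ n * g z)" for g \<omega> n
    using that(2)
  proof (induction n)
    case (Suc n)
    show ?case
    proof (rule Suc.IH, rule step)
      show "(\<lambda>z. (z - of_real \<omega>) ^ n * g z) holomorphic_on UNIV"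
        by (intro holomorphic_intros that)
      show "P (\<lambda>z. (z - of_real \<omega>) * ((z - of_real \<omega>) ^ n * g z))"
        using Suc.prems by (simp add: mult.assoc)
    qed
  qed simp
  show ?thesis
    using q
  proof (induction "card (Z q)" arbitrary: q rule: less_induct)
    case less
    show ?case
    proof (cases "Z q = {}")
      case True
      with less.prems show ?thesis
        unfolding Z_def by blast
    next
      case False
      then obtain \<omega> where \<omega>: "\<omega> \<in> Z q"
        by blast
      then have "q (of_real \<omega>) = 0"
        by (simp add: Z_def)
      from entire_remove_zero[OF less.prems(1) this less.prems(2)]
      obtain n g where g: "g holomorphic_on UNIV" "g (of_real \<omega>) \<noteq> 0" "\<forall>z. q z = (z - of_real \<omega>) ^ n * g z"
        by blast
      have "q = (\<lambda>z. (z - of_real \<omega>) ^ n * g z)"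
        using g(3) by (simp add: fun_eq_iff)
      then have "P g"
        using iterate[OF g(1)] less.prems(3) by simp
      moreover have "Z g \<subset> Z q"
        using g(2,3) \<omega> by (auto simp: Z_def)
      then have "card (Z g) < card (Z q)"
        by (intro psubset_card_mono fin less.prems)
      moreover have "\<exists>z. g z \<noteq> 0"
        using g(2) by blast
      ultimately show ?thesis
        using less.hyps g(1) by blast
    qed
  qed
qed

section \<open>The symbol of the equation\<close>

text \<open>
  The entries of the adjugate matrix, written as determinants of the transpose with one row replaced
  by a unit vector.
\<close>
definition cofactor :: "complex^'r^'r \<Rightarrow> 'r \<Rightarrow> 'r \<Rightarrow> complex"
  where "cofactor Q q i = det (\<chi> a. if a = q then axis i 1 else column a Q)"

text \<open>
  By linearity in row \<open>q\<close> this is the expansion behind Cramer's rule.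
\<close>
lemma cofactor_sum: "(\<Sum>i\<in>UNIV. Q $ i $ p * cofactor Q q i) = (if p = q then det Q else 0)"
proof -
  have "(\<Sum>i\<in>UNIV. Q $ i $ p * cofactor Q q i)
      = (\<Sum>i\<in>UNIV. det (\<chi> a. if a = q then Q $ i $ p *s axis i 1 else column a Q))"
    unfolding cofactor_def by (intro sum.cong refl det_row_mul[symmetric])
  also have "\<dots> = det (\<chi> a. if a = q then \<Sum>i\<in>UNIV. Q $ i $ p *s axis i 1 else column a Q)"
    by (rule det_linear_row_sum[symmetric]) simp
  also have "(\<Sum>i\<in>UNIV. Q $ i $ p *s axis i 1) = (\<Sum>i\<in>UNIV. axis p 1 $ i *s row i (transpose Q))"
    by (simp add: vec_eq_iff axis_def row_def transpose_def if_distrib if_distribR cong: if_cong)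
  also have "(\<chi> a. if a = q then (\<Sum>i\<in>UNIV. axis p 1 $ i *s row i (transpose Q)) else column a Q)
      = (\<chi> a. if a = q then (\<Sum>i\<in>UNIV. axis p 1 $ i *s row i (transpose Q)) else row a (transpose Q))"
  proof -
    have "column a Q = row a (transpose Q)" for a
      by (simp add: column_def row_def transpose_def)
    then show ?thesis
      by (simp only:)
  qed
  also have "det \<dots> = axis p 1 $ q * det (transpose Q)"
    by (rule cramer_lemma_transpose)
  finally show ?thesis
    by (simp add: axis_def)
qed

lemma holomorphic_det:
  assumes "\<And>i j. (\<lambda>z. A z $ i $ j) holomorphic_on S"
  shows "(\<lambda>z. det (A z)) holomorphic_on S"
  unfolding det_def by (intro holomorphic_intros assms)

lemma holomorphic_cofactor:
  assumes "\<And>i j. (\<lambda>z. A z $ i $ j) holomorphic_on S"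
  shows "(\<lambda>z. cofactor (A z) q i) holomorphic_on S"
  unfolding cofactor_def
proof (rule holomorphic_det)
  show "(\<lambda>z. (\<chi> a. if a = q then axis i 1 else column a (A z)) $ i' $ j) holomorphic_on S" for i' j
    by (cases "i' = q") (auto simp: column_def intro: assms holomorphic_on_const)
qed

lemma tendsto_det:
  fixes A :: "'b \<Rightarrow> complex^'r^'r"
  assumes "\<And>i j. ((\<lambda>x. A x $ i $ j) \<longlongrightarrow> B $ i $ j) F"
  shows "((\<lambda>x. det (A x)) \<longlongrightarrow> det B) F"
  unfolding det_def by (intro tendsto_intros assms)

text \<open>
  A relatively dense set of real numbers is unbounded above.
\<close>
lemma characters_return:
  assumes "finite \<Omega>" "e > 0"
  shows "\<exists>\<tau>\<ge>b. \<forall>\<omega>\<in>\<Omega>. cmod (gamma_char \<omega> \<tau> - 1) \<le> e"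
proof -
  have "relatively_dense (UNIV :: real set)"
    unfolding relatively_dense_def by (rule exI[of _ "{0}"]) auto
  then have "relatively_dense (returns ({} :: (real \<Rightarrow> complex) set) {} e \<inter> char_returns \<Omega> e)"
    by (intro relatively_dense_returns_char_returns assms) (auto simp: returns_def)
  then have "relatively_dense (char_returns \<Omega> e)"
    by (rule relatively_dense_mono) simp
  then obtain L where L: "compact L" "{\<tau> + l | \<tau> l. \<tau> \<in> char_returns \<Omega> e \<and> l \<in> L} = UNIV"
    unfolding relatively_dense_def by blast
  from compact_imp_bounded[OF L(1)] obtain B where B: "\<forall>l\<in>L. norm l \<le> B"
    unfolding bounded_iff by (elim exE)
  have "b + B \<in> {\<tau> + l | \<tau> l. \<tau> \<in> char_returns \<Omega> e \<and> l \<in> L}"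
    using L(2) by simp
  then obtain \<tau> l where "b + B = \<tau> + l" "\<tau> \<in> char_returns \<Omega> e" "l \<in> L"
    by (elim CollectE exE conjE)
  with B have "\<tau> \<ge> b" "\<forall>\<omega>\<in>\<Omega>. cmod (gamma_char \<omega> \<tau> - 1) \<le> e"
    by (auto simp: char_returns_def abs_le_iff)
  then show ?thesis
    by blast
qed

text \<open>
  The multiplier of the equation after \<open>n + 1\<close> unit means: of these, \<open>k\<close> turn the \<open>k\<close>-th derivative into
  a \<open>k\<close>-fold difference and \<open>n + 1 - k\<close> remain.
\<close>
definition symbol :: "nat \<Rightarrow> nat \<Rightarrow> (nat \<Rightarrow> real) \<Rightarrow> (nat \<Rightarrow> nat \<Rightarrow> complex^'r^'r) \<Rightarrow> complex \<Rightarrow> complex^'r^'r"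
  where "symbol m n t a z = (\<chi> p q. \<Sum>k=0..n. \<Sum>j=1..m. (a j k $ p $ q) *
    (exp (\<i> * of_real (t j) * z) * (exp (\<i> * z) - 1) ^ k * mean_symbol z ^ (n + 1 - k)))"

lemma symbol_holomorphic: "(\<lambda>z. symbol m n t a z $ p $ q) holomorphic_on UNIV"
  unfolding symbol_def vec_lambda_beta
  by (intro holomorphic_intros holomorphic_on_sum mean_symbol_holomorphic)

text \<open>
  Outside the zeros of \<open>exp (\<i> * z) - 1\<close> the symbol is a nonzero multiple of the matrix
  \<open>M = (\<Sum>k. (\<i> * z) ^ k * A k z) / (\<i> * z) ^ n\<close>, where \<open>A k\<close> collects the coefficients of the \<open>k\<close>-th
  derivative.  Choose real \<open>z\<close> tending to infinity along joint almost periods of the exponentials in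
  \<open>A k\<close>, starting from a point \<open>s1\<close> with \<open>det (A n s1) \<noteq> 0\<close>: then \<open>M\<close> tends to \<open>A n s1\<close>.
\<close>
lemma det_symbol_nonzero:
  fixes a :: "nat \<Rightarrow> nat \<Rightarrow> complex^'r^'r"
  assumes det: "\<exists>s::real. det (\<chi> p q. \<Sum>j=1..m. (a j n $ p $ q) * exp (\<i> * of_real (t j * s))) \<noteq> 0"
  shows "\<exists>z. det (symbol m n t a z) \<noteq> 0"
proof -
  define A where "A k s = (\<chi> p q. \<Sum>j=1..m. (a j k $ p $ q) * gamma_char (t j) s)" for k s
  have A_cont: "continuous_on UNIV (\<lambda>s. A k s $ p $ q)" for k p q
    unfolding A_def vec_lambda_beta
    by (intro continuous_intros gamma_char_continuous)
  obtain s0 where s0: "det (A n s0) \<noteq> 0"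
    using det by (auto simp: A_def gamma_char_def)
  have "((\<lambda>s. det (A n s)) \<longlongrightarrow> det (A n s0)) (at s0)"
    using A_cont by (intro tendsto_det) (auto simp: continuous_on_def)
  then have "\<forall>\<^sub>F s in at s0. det (A n s) \<noteq> 0"
    using s0 tendsto_imp_eventually_ne by blast
  then obtain d where d: "d > 0" "\<And>s. s \<noteq> s0 \<Longrightarrow> dist s s0 < d \<Longrightarrow> det (A n s) \<noteq> 0"
    unfolding eventually_at by auto
  obtain s1 where s1: "det (A n s1) \<noteq> 0" "gamma_char 1 s1 \<noteq> 1"
  proof (cases "gamma_char 1 s0 = 1")
    case False
    with s0 that show thesis
      by blast
  next
    case True
    let ?h = "min (d / 2) 1"
    have h: "0 < ?h" "?h < d" "?h \<le> 1"
      using d(1) by auto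
    have "gamma_char 1 (s0 + ?h) = gamma_char 1 ?h"
      using True by (simp add: gamma_char_add)
    moreover have "gamma_char 1 ?h \<noteq> 1"
    proof
      assume "gamma_char 1 ?h = 1"
      then have "cis ?h = 1"
        by (simp add: gamma_char_def cis_conv_exp)
      then have "Im (cis ?h) = Im 1"
        by (simp only:)
      then have "sin ?h = 0"
        by (simp only: cis.sel one_complex.sel)
      moreover have "sin ?h > 0"
        using h pi_gt3 by (intro sin_gt_zero) auto
      ultimately show False
        by simp
    qed
    ultimately show thesis
      using that[of "s0 + ?h"] d(2)[of "s0 + ?h"] h by (simp add: dist_real_def)
  qed
  \<comment> \<open>the frequency 1 keeps \<open>exp (\<i> * z)\<close> away from 1, where the means would contribute a zero\<close>
  define \<Omega> where "\<Omega> = insert 1 (t ` {1..m})"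
  have "\<exists>\<tau>\<ge>real \<nu>. \<forall>\<omega>\<in>\<Omega>. cmod (gamma_char \<omega> \<tau> - 1) \<le> 1 / real (Suc \<nu>)" for \<nu>
    by (rule characters_return) (auto simp: \<Omega>_def)
  then obtain \<tau> where \<tau>: "\<And>\<nu>. \<tau> \<nu> \<ge> real \<nu>"
      "\<And>\<nu> \<omega>. \<omega> \<in> \<Omega> \<Longrightarrow> cmod (gamma_char \<omega> (\<tau> \<nu>) - 1) \<le> 1 / real (Suc \<nu>)"
    by metis
  have char_lim: "(\<lambda>\<nu>. gamma_char \<omega> (s1 + \<tau> \<nu>)) \<longlonglongrightarrow> gamma_char \<omega> s1" if "\<omega> \<in> \<Omega>" for \<omega>
  proof -
    have "(\<lambda>\<nu>. 1 / real (Suc \<nu>)) \<longlonglongrightarrow> 0"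
      by (intro LIMSEQ_Suc lim_1_over_n)
    then have "(\<lambda>\<nu>. gamma_char \<omega> (\<tau> \<nu>) - 1) \<longlonglongrightarrow> 0"
      by (rule Lim_null_comparison[rotated]) (use \<tau>(2)[OF that] in auto)
    then have "(\<lambda>\<nu>. gamma_char \<omega> (\<tau> \<nu>)) \<longlonglongrightarrow> 1"
      by (simp add: LIM_zero_iff)
    then have "(\<lambda>\<nu>. gamma_char \<omega> s1 * gamma_char \<omega> (\<tau> \<nu>)) \<longlonglongrightarrow> gamma_char \<omega> s1 * 1"
      by (intro tendsto_intros)
    then show ?thesis
      by (simp add: gamma_char_add)
  qed
  define l where "l \<nu> = s1 + \<tau> \<nu>" for \<nu>
  have A_lim: "(\<lambda>\<nu>. A k (l \<nu>) $ p $ q) \<longlonglongrightarrow> A k s1 $ p $ q" for k p q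
    unfolding A_def vec_lambda_beta l_def by (intro tendsto_intros char_lim) (auto simp: \<Omega>_def)
  have "filterlim \<tau> at_top sequentially"
    by (rule filterlim_at_top_mono[OF filterlim_real_sequentially]) (use \<tau>(1) in auto)
  then have l_top: "filterlim l at_top sequentially"
    unfolding l_def[abs_def] by (intro filterlim_tendsto_add_at_top[OF tendsto_const])
  then have inv_lim: "(\<lambda>\<nu>. inverse (l \<nu>)) \<longlonglongrightarrow> 0"
    by (rule tendsto_inverse_0_at_top)
  have frac_lim: "(\<lambda>\<nu>. inverse (\<i> * of_real (l \<nu>)) ^ (n - k)) \<longlonglongrightarrow> (if k = n then 1 else 0)" if "k \<le> n" for k
  proof (cases "k = n")
    case False
    have "(\<lambda>\<nu>. (inverse \<i> * complex_of_real (inverse (l \<nu>))) ^ (n - k)) \<longlonglongrightarrow> (inverse \<i> * complex_of_real 0) ^ (n - k)"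
      by (intro tendsto_intros inv_lim)
    moreover have "(inverse \<i> * complex_of_real 0) ^ (n - k) = 0"
      using False that by (simp add: zero_power)
    moreover have "inverse \<i> * complex_of_real (inverse (l \<nu>)) = inverse (\<i> * of_real (l \<nu>))" for \<nu>
      by (simp only: of_real_inverse inverse_mult_distrib)
    ultimately show ?thesis
      using False by (simp only: if_False)
  qed simp
  define M where "M \<nu> = (\<chi> p q. \<Sum>k=0..n. inverse (\<i> * of_real (l \<nu>)) ^ (n - k) * A k (l \<nu>) $ p $ q)" for \<nu>
  have "(\<lambda>\<nu>. M \<nu> $ p $ q) \<longlonglongrightarrow> A n s1 $ p $ q" for p q
  proof -
    have "(\<lambda>\<nu>. M \<nu> $ p $ q) \<longlonglongrightarrow> (\<Sum>k=0..n. (if k = n then 1 else 0) * A k s1 $ p $ q)"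
      unfolding M_def vec_lambda_beta by (intro tendsto_sum tendsto_mult frac_lim A_lim) auto
    also have "(\<Sum>k=0..n. (if k = n then 1 else 0) * A k s1 $ p $ q) = A n s1 $ p $ q"
      by (simp add: if_distribR if_distrib sum.delta cong: if_cong)
    finally show ?thesis .
  qed
  then have "(\<lambda>\<nu>. det (M \<nu>)) \<longlonglongrightarrow> det (A n s1)"
    by (rule tendsto_det)
  then have "\<forall>\<^sub>F \<nu> in sequentially. det (M \<nu>) \<noteq> 0"
    using s1(1) tendsto_imp_eventually_ne by blast
  moreover have "\<forall>\<^sub>F \<nu> in sequentially. gamma_char 1 (l \<nu>) \<noteq> 1"
  proof -
    have "(\<lambda>\<nu>. gamma_char 1 (l \<nu>)) \<longlonglongrightarrow> gamma_char 1 s1"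
      unfolding l_def by (rule char_lim) (simp add: \<Omega>_def)
    then show ?thesis
      using s1(2) tendsto_imp_eventually_ne by blast
  qed
  moreover have "\<forall>\<^sub>F \<nu> in sequentially. l \<nu> > 0"
    using l_top by (simp add: filterlim_at_top_dense)
  ultimately have "\<forall>\<^sub>F \<nu> in sequentially. det (M \<nu>) \<noteq> 0 \<and> gamma_char 1 (l \<nu>) \<noteq> 1 \<and> l \<nu> > 0"
    by eventually_elim simp
  then obtain \<nu> where \<nu>: "det (M \<nu>) \<noteq> 0" "gamma_char 1 (l \<nu>) \<noteq> 1" "l \<nu> > 0"
    using eventually_happens' sequentially_bot by blast
  define w where "w = \<i> * complex_of_real (l \<nu>)"
  define E where "E = exp (\<i> * complex_of_real (l \<nu>)) - 1"
  have w: "w \<noteq> 0" and E: "E \<noteq> 0"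
    using \<nu>(2,3) by (auto simp: w_def E_def gamma_char_def)
  have ms: "mean_symbol (of_real (l \<nu>)) = E / w"
    using \<nu>(3) by (simp add: mean_symbol_def E_def w_def)
  have pow: "E ^ k * (E / w) ^ (n + 1 - k) = E ^ (n + 1) / w * inverse w ^ (n - k)" if k: "k \<le> n" for k
  proof -
    obtain d where "n = k + d"
      using k le_Suc_ex by blast
    then have d: "n + 1 - k = Suc d" "n - k = d" "n + 1 = k + Suc d"
      by simp_all
    have "(E / w) ^ Suc d = E ^ Suc d * inverse w ^ Suc d"
      by (simp only: divide_inverse power_mult_distrib)
    then have "E ^ k * (E / w) ^ (n + 1 - k) = (E ^ k * E ^ Suc d) * inverse w * inverse w ^ d"
      by (simp only: d(1) power_Suc mult_ac)
    also have "E ^ k * E ^ Suc d = E ^ (n + 1)"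
      by (simp only: d(3) power_add)
    finally show ?thesis
      by (simp only: d(2) divide_inverse)
  qed
  have "symbol m n t a (of_real (l \<nu>)) = (\<chi> p. (E ^ (n + 1) / w) *s (M \<nu> $ p))"
  proof -
    have "symbol m n t a (of_real (l \<nu>)) $ p $ q = E ^ (n + 1) / w * M \<nu> $ p $ q" for p q
    proof -
      have "symbol m n t a (of_real (l \<nu>)) $ p $ q
          = (\<Sum>k=0..n. \<Sum>j=1..m. (a j k $ p $ q) * (gamma_char (t j) (l \<nu>) * (E ^ k * (E / w) ^ (n + 1 - k))))"
        by (simp add: symbol_def ms E_def[symmetric] gamma_char_def mult.assoc)
      also have "\<dots> = (\<Sum>k=0..n. \<Sum>j=1..m. (a j k $ p $ q) * (gamma_char (t j) (l \<nu>) * (E ^ (n + 1) / w * inverse w ^ (n - k))))"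
        by (intro sum.cong refl arg_cong2[where f = "(*)"] pow) auto
      also have "\<dots> = E ^ (n + 1) / w * M \<nu> $ p $ q"
        by (simp add: M_def A_def w_def[symmetric] sum_distrib_left sum_distrib_right mult_ac)
      finally show ?thesis .
    qed
    then show ?thesis
      by (simp add: vec_eq_iff)
  qed
  then have "det (symbol m n t a (of_real (l \<nu>))) = (E ^ (n + 1) / w) ^ CARD('r) * det (M \<nu>)"
    by (simp add: det_rows_mul)
  then show ?thesis
    using w E \<nu>(1) by (intro exI[of _ "of_real (l \<nu>)"]) simp
qed

section \<open>The scalar problem\<close>

lemma test_fun_smooth_mult: "smooth \<psi> \<Longrightarrow> vanishes_beyond R \<psi> \<Longrightarrow> smooth f \<Longrightarrow> smooth (\<lambda>l. f l * \<psi> l) \<and> vanishes_beyond R (\<lambda>l. f l * \<psi> l)"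
  by (auto intro: smooth_mult simp: vanishes_beyond_def)

lemma conv_FT_add:
  assumes "test_fun \<psi>" "test_fun \<theta>" "v \<in> C_ub"
  shows "conv (FT (\<lambda>l. \<psi> l + \<theta> l)) v t = conv (FT \<psi>) v t + conv (FT \<theta>) v t"
proof -
  have "FT (\<lambda>l. \<psi> l + \<theta> l) = (\<lambda>s. FT \<psi> s + FT \<theta> s)"
    by (rule ext) (rule FT_add[OF assms(1,2)])
  then show ?thesis
    using conv_add_kernel[OF FT_decaying FT_decaying, OF assms] by simp
qed

lemma conv_FT_cmult:
  assumes "test_fun \<psi>" "v \<in> C_ub"
  shows "conv (FT (\<lambda>l. c * \<psi> l)) v t = c *\<^sub>C conv (FT \<psi>) v t"
proof -
  have "FT (\<lambda>l. c * \<psi> l) = (\<lambda>s. c * FT \<psi> s)"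
    by (rule ext) (rule FT_cmult[OF assms(1)])
  then show ?thesis
    using conv_scaleC_kernel[OF FT_decaying, OF assms] by simp
qed

lemma conv_FT_zero: "conv (FT (\<lambda>l. 0)) v t = 0"
  by (simp add: conv_def FT_def scaleC.zero_left)

lemma smooth_gamma_char: "smooth (\<lambda>l. gamma_char c l)"
proof -
  have "(\<lambda>z. exp (\<i> * of_real c * z)) holomorphic_on UNIV"
    by (intro holomorphic_intros)
  from smooth_entire[OF this] show ?thesis
    by (simp add: gamma_char_def mult.assoc)
qed

lemma conv_FT_translate:
  assumes "test_fun \<psi>" "v \<in> C_ub"
  shows "conv (FT (\<lambda>l. gamma_char c l * \<psi> l)) v t = conv (FT \<psi>) v (t + c)"
proof -
  have "FT (\<lambda>l. gamma_char c l * \<psi> l) = (\<lambda>s. FT \<psi> (s + c))"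
    by (rule ext) (rule FT_modulate)
  then show ?thesis
    using conv_translate_kernel[OF FT_decaying[OF assms(1)] assms(2)] by simp
qed

lemma conv_FT_sum:
  assumes "finite I" "\<And>i. i \<in> I \<Longrightarrow> test_fun (\<psi> i)" "v \<in> C_ub"
  shows "test_fun (\<lambda>l. \<Sum>i\<in>I. \<psi> i l) \<and> conv (FT (\<lambda>l. \<Sum>i\<in>I. \<psi> i l)) v t = (\<Sum>i\<in>I. conv (FT (\<psi> i)) v t)"
  using assms(1,2)
proof (induction I rule: finite_induct)
  case empty
  have "test_fun (\<lambda>_. 0)"
    by (auto simp: test_fun_def vanishes_beyond_def intro: smooth_const)
  then show ?case
    by (simp add: conv_FT_zero)
next
  case (insert i I)
  then have IH: "test_fun (\<lambda>l. \<Sum>i\<in>I. \<psi> i l)" "conv (FT (\<lambda>l. \<Sum>i\<in>I. \<psi> i l)) v t = (\<Sum>i\<in>I. conv (FT (\<psi> i)) v t)"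
    by auto
  have i: "test_fun (\<psi> i)"
    using insert.prems by simp
  show ?case
    using insert.hyps test_fun_add[OF i IH(1)] conv_FT_add[OF i IH(1) assms(3), of t] IH(2) by simp
qed

lemma conv_sum:
  assumes \<kappa>: "decaying \<kappa>" and I: "finite I" and v: "\<And>i. i \<in> I \<Longrightarrow> v i \<in> C_ub"
  shows "conv \<kappa> (\<lambda>t. \<Sum>i\<in>I. v i t) t = (\<Sum>i\<in>I. conv \<kappa> (v i) t)"
  using I v
proof (induction I rule: finite_induct)
  case empty
  then show ?case
    by (simp add: conv_def scaleC.zero_right)
next
  case (insert i I)
  have "(\<lambda>t. \<Sum>i\<in>I. v i t) \<in> C_ub"
    by (intro invariant_space_sum[OF invariant_space_C_ub]) (use insert.prems in auto)
  with insert show ?case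
    using conv_add[OF \<kappa>, of "v i" "\<lambda>t. \<Sum>i\<in>I. v i t" t] by simp
qed

context
  fixes A U :: "(real \<Rightarrow> 'a::complex_banach) set" and u :: "real \<Rightarrow> 'a"
  assumes A: "maximal_star A" and L: "satisfies_L U A"
    and U_char: "\<And>\<omega> u. u \<in> U \<inter> C_ub \<Longrightarrow> (\<lambda>s. gamma_char \<omega> s *\<^sub>C u s) \<in> U"
    and U_conv: "\<And>u \<phi>. u \<in> U \<inter> C_ub \<Longrightarrow> \<phi> \<in> schwartz \<Longrightarrow> convolution u \<phi> \<in> U"
    and u: "u \<in> U" "u \<in> C_ub"
begin

text \<open>
  Let \<open>w\<close> be the convolution in question and \<open>G\<close> its product with \<open>gamma_char (- \<omega>)\<close>.  A difference of
  \<open>G\<close> is \<open>gamma_char (- \<omega>)\<close> times a convolution whose multiplier contains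
  \<open>exp (\<i> * h * (l - \<omega>)) - 1\<close>.  This is \<open>l - \<omega>\<close> times a smooth function, so the hypothesis puts all
  differences of \<open>G\<close> into \<open>A\<close>.  Since \<open>G\<close> lies in \<open>U\<close>, it belongs to \<open>A\<close> by \<open>(L\<^sub>U)\<close>, and so does \<open>w\<close>.
\<close>
lemma remove_zero_step:
  fixes \<psi> :: "real \<Rightarrow> complex"
  assumes q: "q holomorphic_on UNIV"
    and ind: "\<And>\<psi>. smooth \<psi> \<Longrightarrow> vanishes_beyond R \<psi> \<Longrightarrow>
      conv (FT (\<lambda>l. ((of_real l - of_real \<omega>) * q (of_real l)) * \<psi> l)) u \<in> A"
    and \<psi>: "smooth \<psi>" "vanishes_beyond R \<psi>"
  shows "conv (FT (\<lambda>l. q (of_real l) * \<psi> l)) u \<in> A"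
proof -
  define \<psi>1 where "\<psi>1 l = q (of_real l) * \<psi> l" for l
  have \<psi>1: "test_fun \<psi>1"
    unfolding \<psi>1_def[abs_def] test_fun_def
    using test_fun_smooth_mult[OF \<psi> smooth_entire[OF q]] by blast
  define w where "w = conv (FT \<psi>1) u"
  have w_U: "w \<in> U"
    using U_conv[of u "FT \<psi>1"] u FT_schwartz[OF \<psi>1] convolution_eq_conv[OF FT_decaying[OF \<psi>1] u(2)]
    by (simp add: w_def)
  have w_ub: "w \<in> C_ub"
    unfolding w_def by (rule invariant_space_conv[OF invariant_space_C_ub u(2) FT_decaying[OF \<psi>1]])
  define G where "G t = gamma_char (- \<omega>) t *\<^sub>C w t" for t
  have "G \<in> U"
    unfolding G_def[abs_def] using U_char w_U w_ub by blast
  moreover have "diff_shift h G \<in> A" if h: "h > 0" for h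
  proof -
    define e where "e l = \<i> * of_real h * mean_symbol (of_real (h * l + - (h * \<omega>)))" for l
    have "smooth e"
      unfolding e_def[abs_def]
      by (intro smooth_mult smooth_const smooth_affine[of "\<lambda>l. mean_symbol (of_real l)"]
          smooth_entire mean_symbol_holomorphic)
    then have "smooth (\<lambda>l. e l * \<psi> l)" "vanishes_beyond R (\<lambda>l. e l * \<psi> l)"
      using test_fun_smooth_mult[OF \<psi>] by blast+
    from ind[OF this] have 1: "conv (FT (\<lambda>l. ((of_real l - of_real \<omega>) * q (of_real l)) * (e l * \<psi> l))) u \<in> A" .
    have "((of_real l - of_real \<omega>) * q (of_real l)) * (e l * \<psi> l)
        = gamma_char (- \<omega>) h * (gamma_char h l * \<psi>1 l) + (- 1) * \<psi>1 l" for l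
    proof -
      have "(of_real l - of_real \<omega>) * e l = \<i> * of_real (h * l + - (h * \<omega>)) * mean_symbol (of_real (h * l + - (h * \<omega>)))"
        by (simp add: e_def algebra_simps)
      also have "\<dots> = exp (\<i> * of_real (h * l + - (h * \<omega>))) - 1"
        by (rule mean_symbol_mult)
      also have "exp (\<i> * of_real (h * l + - (h * \<omega>))) = gamma_char (- \<omega>) h * gamma_char h l"
        by (simp add: gamma_char_def exp_add[symmetric] algebra_simps)
      finally have "(of_real l - of_real \<omega>) * e l * \<psi>1 l = (gamma_char (- \<omega>) h * gamma_char h l - 1) * \<psi>1 l"
        by (simp only:)
      then show ?thesis
        by (simp add: \<psi>1_def algebra_simps)
    qed
    then have 2: "conv (FT (\<lambda>l. gamma_char (- \<omega>) h * (gamma_char h l * \<psi>1 l) + (- 1) * \<psi>1 l)) u \<in> A"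
      using 1 by (simp only:)
    have t1: "test_fun (\<lambda>l. gamma_char h l * \<psi>1 l)"
      by (rule test_fun_mult[OF \<psi>1 smooth_gamma_char])
    have "conv (FT (\<lambda>l. gamma_char (- \<omega>) h * (gamma_char h l * \<psi>1 l) + (- 1) * \<psi>1 l)) u t
        = gamma_char (- \<omega>) h *\<^sub>C w (t + h) - w t" for t
    proof -
      have "conv (FT (\<lambda>l. gamma_char (- \<omega>) h * (gamma_char h l * \<psi>1 l) + (- 1) * \<psi>1 l)) u t
          = conv (FT (\<lambda>l. gamma_char (- \<omega>) h * (gamma_char h l * \<psi>1 l))) u t + conv (FT (\<lambda>l. (- 1) * \<psi>1 l)) u t"
        by (intro conv_FT_add test_fun_mult[OF t1 smooth_const] test_fun_mult[OF \<psi>1 smooth_const] u)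
      also have "\<dots> = gamma_char (- \<omega>) h *\<^sub>C w (t + h) + (- 1) *\<^sub>C w t"
        unfolding w_def conv_FT_cmult[OF t1 u(2)] conv_FT_cmult[OF \<psi>1 u(2)] conv_FT_translate[OF \<psi>1 u(2)] ..
      finally show ?thesis
        by (simp add: scaleC.minus_left)
    qed
    then have "(\<lambda>t. gamma_char (- \<omega>) h *\<^sub>C w (t + h) - w t) \<in> A"
      using 2 by presburger
    from maximal_star_gamma_char[OF A this, of "- \<omega>"]
    have "(\<lambda>t. gamma_char (- \<omega>) t *\<^sub>C (gamma_char (- \<omega>) h *\<^sub>C w (t + h) - w t)) \<in> A" .
    moreover have "(\<lambda>t. gamma_char (- \<omega>) t *\<^sub>C (gamma_char (- \<omega>) h *\<^sub>C w (t + h) - w t)) = diff_shift h G"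
      by (rule ext) (simp add: diff_shift_def G_def gamma_char_add scaleC.diff_right scaleC_scaleC)
    ultimately show ?thesis
      by simp
  qed
  ultimately have "G \<in> A"
    using L unfolding satisfies_L_def by blast
  from maximal_star_gamma_char[OF A this, of \<omega>]
  have "(\<lambda>t. gamma_char \<omega> t *\<^sub>C G t) \<in> A" .
  moreover have "gamma_char \<omega> t *\<^sub>C G t = w t" for t
  proof -
    have "gamma_char \<omega> t * gamma_char (- \<omega>) t = 1"
      using gamma_char_add_left[of \<omega> "- \<omega>" t] by (simp add: gamma_char_def)
    then show ?thesis
      by (simp add: G_def scaleC_scaleC)
  qed
  ultimately have "w \<in> A"
    by simp
  then show ?thesis
    by (simp add: w_def \<psi>1_def[abs_def])
qed

text \<open>
  Removing the zeros of \<open>q\<close> in the support of \<open>\<psi>\<close> and dividing by the rest shows that \<open>q\<close> can be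
  dropped from the hypothesis; an approximate identity of kernels \<open>FT \<psi>\<close> then recovers \<open>u\<close>.
\<close>
lemma scalar_regularity:
  assumes q: "q holomorphic_on UNIV" "\<exists>z. q z \<noteq> 0"
    and qA: "\<And>\<psi>. test_fun \<psi> \<Longrightarrow> conv (FT (\<lambda>l. q (of_real l) * \<psi> l)) u \<in> A"
  shows "u \<in> A"
proof -
  have inv: "invariant_space A"
    by (rule invariant_space_maximal_star[OF A])
  have test: "conv (FT \<psi>) u \<in> A" if \<psi>: "test_fun \<psi>" for \<psi>
  proof -
    obtain R where R: "vanishes_beyond R \<psi>"
      using \<psi> by (auto simp: test_fun_def)
    define P where "P q \<longleftrightarrow> (\<forall>\<psi>. smooth \<psi> \<and> vanishes_beyond R \<psi> \<longrightarrow> conv (FT (\<lambda>l. q (of_real l) * \<psi> l)) u \<in> A)"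
      for q :: "complex \<Rightarrow> complex"
    have "P q"
      unfolding P_def using qA by (auto simp: test_fun_def)
    moreover have "P q" if "q holomorphic_on UNIV" "P (\<lambda>z. (z - of_real \<omega>) * q z)" for q and \<omega> :: real
      using that remove_zero_step[OF that(1)] unfolding P_def by blast
    ultimately obtain q' where q': "q' holomorphic_on UNIV" "\<And>l::real. \<bar>l\<bar> \<le> R \<Longrightarrow> q' (of_real l) \<noteq> 0" "P q'"
      using remove_real_zeros[of P q R] q by blast
    have "smooth (\<lambda>l. \<psi> l / q' (of_real l))" "vanishes_beyond R (\<lambda>l. \<psi> l / q' (of_real l))"
      using test_fun_divide[OF test_funD(3)[OF \<psi>] R smooth_entire[OF q'(1)] q'(2)] by auto
    with q'(3) have "conv (FT (\<lambda>l. q' (of_real l) * (\<psi> l / q' (of_real l)))) u \<in> A"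
      unfolding P_def by blast
    moreover have "q' (of_real l) * (\<psi> l / q' (of_real l)) = \<psi> l" for l
      using q'(2)[of l] R by (cases "\<bar>l\<bar> \<le> R") (auto simp: vanishes_beyond_def)
    ultimately show ?thesis
      by simp
  qed
  obtain \<psi> where \<psi>: "test_fun \<psi>" "integral UNIV (FT \<psi>) \<noteq> 0"
    using exists_test_fun_integral_nonzero by blast
  define c where "c = integral UNIV (FT \<psi>)"
  have "(\<lambda>t. c *\<^sub>C u t) \<in> A"
  proof (rule invariant_spaceD(6)[OF inv])
    fix e :: real assume e: "e > 0"
    obtain n :: nat where n: "n \<ge> 1" "\<And>t. norm (conv (\<lambda>s. of_nat n * FT \<psi> (real n * s)) u t - c *\<^sub>C u t) \<le> e"
      using conv_approximate_identity[OF FT_decaying[OF \<psi>(1)] u(2) e] unfolding c_def by blast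
    have "test_fun (\<lambda>l. \<psi> ((1 / real n) * l + 0))"
      by (rule test_fun_affine[OF \<psi>(1)]) (use n(1) in simp)
    then have "test_fun (\<lambda>l. \<psi> (l / real n))"
      by simp
    moreover have "FT (\<lambda>l. \<psi> (l / real n)) = (\<lambda>s. of_nat n * FT \<psi> (real n * s))"
      using FT_scale[OF \<psi>(1), of "real n"] n(1) by (simp add: fun_eq_iff)
    ultimately have "conv (\<lambda>s. of_nat n * FT \<psi> (real n * s)) u \<in> A"
      using test by fastforce
    with n(2) show "\<exists>f\<in>A. \<forall>t. norm (f t - c *\<^sub>C u t) \<le> e"
      by blast
  qed
  from maximal_star_scaleC[OF A this, of "1 / c"] show ?thesis
    using \<psi>(2) by (simp add: scaleC_scaleC c_def)
qed

end

section \<open>Unit means and differences\<close>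

definition window :: "(real \<Rightarrow> 'b::banach) \<Rightarrow> real \<Rightarrow> 'b"
  where "window v t = integral {0..1} (\<lambda>x. v (t + x))"

lemma continuous_translate: "continuous_on UNIV v \<Longrightarrow> continuous_on S (\<lambda>x::real. v (t + x))"
  by (rule continuous_on_compose2[of UNIV v]) (auto intro: continuous_intros)

lemma window_integrable:
  fixes v :: "real \<Rightarrow> 'b::banach"
  shows "continuous_on UNIV v \<Longrightarrow> (\<lambda>x. v (t + x)) integrable_on {0..1}"
  by (intro integrable_continuous_real continuous_translate)

lemma window_continuous:
  assumes "continuous_on UNIV v" shows "continuous_on UNIV (window v)"
proof -
  have "(window v has_vector_derivative v (t + 1) - v t) (at t)" for t
    using integral_translate_eq_antiderivative[OF assms, of 1 t] by (simp add: window_def[abs_def])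
  then show ?thesis
    by (meson has_vector_derivative_continuous continuous_at_imp_continuous_on)
qed

lemma window_linear:
  assumes "bounded_linear T" "continuous_on UNIV v"
  shows "window (\<lambda>s. T (v s)) t = T (window v t)"
  using integral_linear[OF window_integrable[OF assms(2)] assms(1), of t] by (simp add: window_def o_def)

lemma window_translate: "window (\<lambda>s. v (s + c)) t = window v (t + c)"
  by (simp add: window_def algebra_simps)

lemma window_sum:
  assumes "finite I" "\<And>i. i \<in> I \<Longrightarrow> continuous_on UNIV (v i)"
  shows "window (\<lambda>s. \<Sum>i\<in>I. v i s) t = (\<Sum>i\<in>I. window (v i) t)"
  unfolding window_def by (intro integral_sum assms(1) window_integrable assms(2))

lemma window_diff_shift:
  assumes "continuous_on UNIV v"
  shows "window (diff_shift h v) = diff_shift h (window v)"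
proof
  fix t
  have "integral {0..1} (\<lambda>x. v (t + h + x) - v (t + x))
      = integral {0..1} (\<lambda>x. v (t + h + x)) - integral {0..1} (\<lambda>x. v (t + x))"
    by (intro integral_diff window_integrable assms)
  then show "window (diff_shift h v) t = diff_shift h (window v) t"
    by (simp add: window_def diff_shift_def add_ac)
qed

lemma window_funpow_continuous:
  "continuous_on UNIV v \<Longrightarrow> continuous_on UNIV ((window ^^ N) v)"
  by (induction N) (auto intro: window_continuous)

lemma window_funpow_lincomb:
  fixes v :: "'i \<Rightarrow> real \<Rightarrow> 'a::complex_banach"
  assumes I: "finite I" and v: "\<And>i. i \<in> I \<Longrightarrow> continuous_on UNIV (v i)"
  shows "(window ^^ N) (\<lambda>s. \<Sum>i\<in>I. c i *\<^sub>C v i (s + b i)) = (\<lambda>s. \<Sum>i\<in>I. c i *\<^sub>C (window ^^ N) (v i) (s + b i))"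
proof (induction N)
  case (Suc N)
  have cont: "continuous_on UNIV (\<lambda>s. (window ^^ N) (v i) (s + b i))" if "i \<in> I" for i
    using continuous_translate[OF window_funpow_continuous[OF v[OF that]], where S = UNIV and t = "b i"] by (simp add: add.commute)
  show ?case
  proof
    fix t
    have "(window ^^ Suc N) (\<lambda>s. \<Sum>i\<in>I. c i *\<^sub>C v i (s + b i)) t = window (\<lambda>s. \<Sum>i\<in>I. c i *\<^sub>C (window ^^ N) (v i) (s + b i)) t"
      using Suc by simp
    also have "\<dots> = (\<Sum>i\<in>I. window (\<lambda>s. c i *\<^sub>C (window ^^ N) (v i) (s + b i)) t)"
      by (intro window_sum I continuous_on_scaleC continuous_on_const cont)
    also have "\<dots> = (\<Sum>i\<in>I. c i *\<^sub>C (window ^^ Suc N) (v i) (t + b i))"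
    proof (rule sum.cong)
      fix i assume "i \<in> I"
      from window_linear[OF scaleC.bounded_linear_right cont[OF this]]
      show "window (\<lambda>s. c i *\<^sub>C (window ^^ N) (v i) (s + b i)) t = c i *\<^sub>C (window ^^ Suc N) (v i) (t + b i)"
        by (simp add: window_translate)
    qed simp
    finally show "(window ^^ Suc N) (\<lambda>s. \<Sum>i\<in>I. c i *\<^sub>C v i (s + b i)) t = (\<Sum>i\<in>I. c i *\<^sub>C (window ^^ Suc N) (v i) (t + b i))" .
  qed
qed simp

lemma window_funpow_diff_shift:
  assumes v: "continuous_on UNIV v"
  shows "(window ^^ N) (diff_shift h v) = diff_shift h ((window ^^ N) v)"
  by (induction N) (simp_all add: window_diff_shift window_funpow_continuous[OF v])

text \<open>
  Each of the first \<open>k\<close> means uses up one derivative and leaves a difference behind.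
\<close>
lemma window_funpow_derivs:
  assumes D: "\<And>k. k \<le> n \<Longrightarrow> continuous_on UNIV (D k)"
    and step: "\<And>k. k < n \<Longrightarrow> window (D (Suc k)) = diff_shift 1 (D k)"
  shows "k \<le> N \<Longrightarrow> k \<le> n \<Longrightarrow> (window ^^ N) (D k) = (diff_shift 1 ^^ k) ((window ^^ (N - k)) (D 0))"
proof (induction k arbitrary: N)
  case (Suc k)
  then obtain N' where N: "N = Suc N'"
    using Suc_le_D by blast
  have "(window ^^ N) (D (Suc k)) = (window ^^ N') (diff_shift 1 (D k))"
    using step[of k] Suc.prems by (simp add: N funpow_swap1 del: funpow.simps(2)) (simp add: funpow_Suc_right del: funpow.simps(2))
  also have "\<dots> = diff_shift 1 ((window ^^ N') (D k))"
    by (intro window_funpow_diff_shift D) (use Suc.prems in simp)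
  also have "(window ^^ N') (D k) = (diff_shift 1 ^^ k) ((window ^^ (N' - k)) (D 0))"
    by (rule Suc.IH) (use Suc.prems N in auto)
  finally show ?case
    by (simp add: N)
qed simp

lemma C_ub_window:
  assumes v: "v \<in> C_ub" shows "window v \<in> C_ub"
proof -
  have cont: "continuous_on UNIV v"
    using C_ub_continuous[OF v continuous_on_id] by simp
  obtain B where B: "B > 0" "\<forall>t. norm (v t) \<le> B"
    using v by (auto simp: C_ub_def bounded_pos)
  have "norm (window v t) \<le> B * (1 - 0)" for t
    unfolding window_def by (intro integral_bound continuous_translate cont) (use B in auto)
  then have "bounded (range (window v))"
    by (auto simp: bounded_iff)
  moreover have "uniformly_continuous_on UNIV (window v)"
    unfolding uniformly_continuous_on_def dist_norm
  proof (intro allI impI)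
    fix e :: real assume e: "e > 0"
    have "uniformly_continuous_on UNIV v" "e / 2 > 0"
      using v e by (simp_all add: C_ub_def)
    from uniformly_continuous_modulus[OF this] obtain d where d: "d > 0" "\<And>s t. \<bar>s - t\<bar> < d \<Longrightarrow> norm (v s - v t) < e / 2"
      by blast
    have "norm (window v s - window v t) < e" if "\<bar>s - t\<bar> < d" for s t
    proof -
      have "window v s - window v t = integral {0..1} (\<lambda>x. v (s + x) - v (t + x))"
        unfolding window_def by (intro integral_diff[symmetric] window_integrable cont)
      also have "norm \<dots> \<le> e / 2 * (1 - 0)"
      proof (rule integral_bound)
        show "norm (v (s + x) - v (t + x)) \<le> e / 2" for x
          using d(2)[of "s + x" "t + x"] that by simp
        show "continuous_on {0..1} (\<lambda>x. v (s + x) - v (t + x))"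
          by (intro continuous_on_diff continuous_translate cont)
      qed simp
      finally show ?thesis
        using e by simp
    qed
    with d(1) show "\<exists>d>0. \<forall>s\<in>UNIV. \<forall>t\<in>UNIV. norm (t - s) < d \<longrightarrow> norm (window v t - window v s) < e"
      by (intro exI[of _ d]) auto
  qed
  ultimately show ?thesis
    by (simp add: C_ub_def)
qed

lemma C_ub_diff_shift:
  fixes v :: "real \<Rightarrow> 'a::complex_banach"
  assumes "v \<in> C_ub" shows "diff_shift h v \<in> C_ub"
proof -
  have "(\<lambda>t. v (t + h) + (- 1) *\<^sub>C v t) \<in> C_ub"
    by (intro C_ub_add C_ub_translate invariant_spaceD(4)[OF invariant_space_C_ub] assms)
  then show ?thesis
    by (simp add: diff_shift_def[abs_def] scaleC.minus_left)
qed

lemma C_ub_window_funpow: "v \<in> C_ub \<Longrightarrow> (window ^^ N) v \<in> C_ub"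
  by (induction N) (auto intro: C_ub_window)

lemma C_ub_diff_shift_funpow: "v \<in> C_ub \<Longrightarrow> (diff_shift h ^^ k) v \<in> C_ub" for v :: "real \<Rightarrow> 'a::complex_banach"
  by (induction k) (auto intro: C_ub_diff_shift)

lemma smooth_power: "smooth f \<Longrightarrow> smooth (\<lambda>l. f l ^ k)"
  by (induction k) (auto intro: smooth_const smooth_mult)

lemma smooth_mean_symbol: "smooth (\<lambda>l. mean_symbol (of_real l))"
  by (rule smooth_entire[OF mean_symbol_holomorphic])

lemma conv_FT_window:
  assumes "test_fun \<psi>" "v \<in> C_ub"
  shows "conv (FT \<psi>) (window v) t = conv (FT (\<lambda>l. mean_symbol (of_real l) * \<psi> l)) v t"
  using conv_window[OF FT_decaying[OF assms(1)] assms(2), of t] FT_window[OF assms(1)]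
  by (simp add: window_def[abs_def])

lemma conv_FT_window_funpow:
  assumes "v \<in> C_ub"
  shows "test_fun \<psi> \<Longrightarrow> conv (FT \<psi>) ((window ^^ N) v) t = conv (FT (\<lambda>l. mean_symbol (of_real l) ^ N * \<psi> l)) v t"
proof (induction N arbitrary: \<psi>)
  case (Suc N)
  have "conv (FT \<psi>) ((window ^^ Suc N) v) t = conv (FT (\<lambda>l. mean_symbol (of_real l) * \<psi> l)) ((window ^^ N) v) t"
    using conv_FT_window[OF Suc.prems C_ub_window_funpow[OF assms]] by simp
  also have "\<dots> = conv (FT (\<lambda>l. mean_symbol (of_real l) ^ N * (mean_symbol (of_real l) * \<psi> l))) v t"
    by (intro Suc.IH test_fun_mult[OF Suc.prems smooth_mean_symbol])
  finally show ?case
    by (simp add: mult_ac)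
qed simp

lemma conv_FT_diff_shift:
  assumes \<psi>: "test_fun \<psi>" and v: "v \<in> C_ub"
  shows "conv (FT \<psi>) (diff_shift 1 v) t = conv (FT (\<lambda>l. (gamma_char 1 l - 1) * \<psi> l)) v t"
proof -
  have "conv (FT \<psi>) (\<lambda>t. v (t + 1) + (- 1) *\<^sub>C v t) t = conv (FT \<psi>) (\<lambda>t. v (t + 1)) t + conv (FT \<psi>) (\<lambda>t. (- 1) *\<^sub>C v t) t"
    by (intro conv_add FT_decaying \<psi> C_ub_translate v invariant_spaceD(4)[OF invariant_space_C_ub])
  also have "\<dots> = conv (FT \<psi>) v (t + 1) + (- 1) *\<^sub>C conv (FT \<psi>) v t"
    by (simp only: conv_translate conv_scaleC[OF FT_decaying[OF \<psi>] v])
  also have "\<dots> = conv (FT (\<lambda>l. gamma_char 1 l * \<psi> l)) v t + conv (FT (\<lambda>l. (- 1) * \<psi> l)) v t"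
    by (simp only: conv_FT_translate[OF \<psi> v] conv_FT_cmult[OF \<psi> v])
  also have "\<dots> = conv (FT (\<lambda>l. gamma_char 1 l * \<psi> l + (- 1) * \<psi> l)) v t"
    by (intro conv_FT_add[symmetric] test_fun_mult[OF \<psi>] smooth_gamma_char smooth_const v)
  finally show ?thesis
    by (simp add: diff_shift_def[abs_def] scaleC.minus_left algebra_simps)
qed

lemma conv_FT_diff_shift_funpow:
  assumes "v \<in> C_ub"
  shows "test_fun \<psi> \<Longrightarrow> conv (FT \<psi>) ((diff_shift 1 ^^ k) v) t = conv (FT (\<lambda>l. (gamma_char 1 l - 1) ^ k * \<psi> l)) v t"
proof (induction k arbitrary: \<psi>)
  case (Suc k)
  have s: "smooth (\<lambda>l. gamma_char 1 l - 1)"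
    using smooth_add[OF smooth_gamma_char smooth_const[of "- 1"]] by simp
  have "conv (FT \<psi>) ((diff_shift 1 ^^ Suc k) v) t = conv (FT (\<lambda>l. (gamma_char 1 l - 1) * \<psi> l)) ((diff_shift 1 ^^ k) v) t"
    using conv_FT_diff_shift[OF Suc.prems C_ub_diff_shift_funpow[OF assms]] by simp
  also have "\<dots> = conv (FT (\<lambda>l. (gamma_char 1 l - 1) ^ k * ((gamma_char 1 l - 1) * \<psi> l))) v t"
    by (intro Suc.IH test_fun_mult[OF Suc.prems s])
  finally show ?case
    by (simp add: mult_ac)
qed simp

definition symbol_entry :: "nat \<Rightarrow> nat \<Rightarrow> real \<Rightarrow> real \<Rightarrow> complex"
  where "symbol_entry n k c l = gamma_char c l * ((gamma_char 1 l - 1) ^ k * mean_symbol (of_real l) ^ (n + 1 - k))"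

lemma smooth_symbol_entry: "smooth (symbol_entry n k c)"
proof -
  have "smooth (\<lambda>l. gamma_char 1 l - 1)"
    using smooth_add[OF smooth_gamma_char smooth_const[of "- 1"]] by simp
  then show ?thesis
    unfolding symbol_entry_def[abs_def]
    by (intro smooth_mult smooth_gamma_char smooth_power smooth_mean_symbol)
qed

lemma symbol_of_real:
  "symbol m n t a (of_real l) $ p $ q = (\<Sum>k=0..n. \<Sum>j=1..m. (a j k $ p $ q) * symbol_entry n k (t j) l)"
  by (simp add: symbol_def symbol_entry_def gamma_char_def mult.assoc)

text \<open>
  Translation, differences and means of \<open>v\<close> act on the kernel as multiplications of \<open>\<psi>\<close>.
\<close>
lemma conv_FT_symbol_entry:
  assumes \<psi>: "test_fun \<psi>" and v: "v \<in> C_ub"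
  shows "conv (FT \<psi>) (\<lambda>s. (diff_shift 1 ^^ k) ((window ^^ (n + 1 - k)) v) (s + c)) t
    = conv (FT (\<lambda>l. symbol_entry n k c l * \<psi> l)) v t"
proof -
  let ?N = "n + 1 - k"
  have s: "smooth (\<lambda>l. gamma_char 1 l - 1)"
    using smooth_add[OF smooth_gamma_char smooth_const[of "- 1"]] by simp
  have w: "(window ^^ ?N) v \<in> C_ub" "(diff_shift 1 ^^ k) ((window ^^ ?N) v) \<in> C_ub"
    by (intro C_ub_window_funpow C_ub_diff_shift_funpow v)+
  have \<psi>1: "test_fun (\<lambda>l. gamma_char c l * \<psi> l)"
    by (rule test_fun_mult[OF \<psi> smooth_gamma_char])
  have \<psi>2: "test_fun (\<lambda>l. (gamma_char 1 l - 1) ^ k * (gamma_char c l * \<psi> l))"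
    by (rule test_fun_mult[OF \<psi>1 smooth_power[OF s]])
  have "conv (FT \<psi>) (\<lambda>s. (diff_shift 1 ^^ k) ((window ^^ ?N) v) (s + c)) t
      = conv (FT (\<lambda>l. gamma_char c l * \<psi> l)) ((diff_shift 1 ^^ k) ((window ^^ ?N) v)) t"
    by (simp only: conv_translate conv_FT_translate[OF \<psi> w(2)])
  also have "\<dots> = conv (FT (\<lambda>l. (gamma_char 1 l - 1) ^ k * (gamma_char c l * \<psi> l))) ((window ^^ ?N) v) t"
    by (rule conv_FT_diff_shift_funpow[OF w(1) \<psi>1])
  also have "\<dots> = conv (FT (\<lambda>l. mean_symbol (of_real l) ^ ?N * ((gamma_char 1 l - 1) ^ k * (gamma_char c l * \<psi> l)))) v t"
    by (rule conv_FT_window_funpow[OF v \<psi>2])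
  finally show ?thesis
    by (simp add: symbol_entry_def mult_ac)
qed

section \<open>The system\<close>

text \<open>
  The components of a recurrent function satisfy condition (*), since any finite list of them returns
  whenever the function itself does.
\<close>
lemma maximal_star_rec_urc:
  fixes g :: "real \<Rightarrow> 'a::banach^'r"
  assumes sel: "rec_urc_selection rec_urc" and g: "g \<in> REC_urc"
  shows "maximal_star (rec_urc (range (\<lambda>i s. g s $ i)))" "(\<lambda>s. g s $ i) \<in> rec_urc (range (\<lambda>i s. g s $ i))"
proof -
  let ?V = "range (\<lambda>i s. g s $ i)"
  have REC: "REC_tuple UNIV (\<lambda>i s. g s $ i)"
    using g REC_vec_iff by (auto simp: REC_urc_def)
  have urc: "(\<lambda>s. g s $ i) \<in> C_urc" for i
  proof (rule C_urcI)
    have "compact (closure (range g))" "uniformly_continuous_on UNIV g"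
      using g by (auto simp: REC_urc_def C_urc_def)
    then show "compact ((\<lambda>x. x $ i) ` closure (range g))" "uniformly_continuous_on UNIV (\<lambda>s. g s $ i)"
      using bounded_linear.uniformly_continuous_on[OF bounded_linear_vec_nth]
      by (auto intro!: compact_continuous_image continuous_intros)
    show "range (\<lambda>s. g s $ i) \<subseteq> (\<lambda>x. x $ i) ` closure (range g)"
      using closure_subset[of "range g"] by blast
  qed
  have tuple: "REC_tuple I f" if f: "\<And>i. i \<in> I \<Longrightarrow> f i \<in> ?V" for f and I :: "nat set"
    unfolding REC_tuple_def
  proof (intro conjI ballI allI impI)
    show "continuous_on UNIV (f i)" if "i \<in> I" for i
      using f[OF that] REC by (auto simp: REC_tuple_def)
    fix K :: "real set" and e :: real assume "compact K \<and> e > 0"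
    then have "relatively_dense {\<tau>. \<forall>t\<in>K. \<forall>i\<in>UNIV. norm (g (t + \<tau>) $ i - g t $ i) \<le> e}"
      using REC by (simp add: REC_tuple_def)
    then show "relatively_dense {\<tau>. \<forall>t\<in>K. \<forall>i\<in>I. norm (f i (t + \<tau>) - f i t) \<le> e}"
    proof (rule relatively_dense_mono)
      show "{\<tau>. \<forall>t\<in>K. \<forall>i\<in>UNIV. norm (g (t + \<tau>) $ i - g t $ i) \<le> e}
          \<subseteq> {\<tau>. \<forall>t\<in>K. \<forall>i\<in>I. norm (f i (t + \<tau>) - f i t) \<le> e}"
      proof clarify
        fix \<tau> t i assume *: "\<forall>t\<in>K. \<forall>i\<in>UNIV. norm (g (t + \<tau>) $ i - g t $ i) \<le> e" "t \<in> K" "i \<in> I"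
        obtain j where "f i = (\<lambda>s. g s $ j)"
          using f[OF *(3)] by blast
        with *(1,2) show "norm (f i (t + \<tau>) - f i t) \<le> e"
          by simp
      qed
    qed
  qed
  have star: "condition_star ?V"
    unfolding condition_star_def using tuple by blast
  have "(\<lambda>s. g s $ i) \<in> REC" for i
    using tuple[of "{0}" "\<lambda>_ s. g s $ i"] by (auto simp: REC_tuple_def REC_def)
  then have "?V \<subseteq> REC_urc"
    using urc by (auto simp: REC_urc_def)
  then have V: "?V \<noteq> {} \<and> ?V \<subseteq> REC_urc \<and> condition_star ?V"
    using star by blast
  then have ext: "rec_urc ?V \<in> star_extensions ?V"
      "\<And>W. W \<in> star_extensions ?V \<Longrightarrow> rec_urc ?V \<subseteq> W \<Longrightarrow> W = rec_urc ?V"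
    using sel[unfolded rec_urc_selection_def, rule_format, OF V] by blast+
  have "rec_urc ?V \<subseteq> REC_urc" "?V \<subseteq> rec_urc ?V" "condition_star (rec_urc ?V)"
    using ext(1) by (auto simp: star_extensions_def)
  moreover have "W = rec_urc ?V" if "rec_urc ?V \<subseteq> W" "W \<subseteq> REC_urc" "condition_star W" for W
    by (rule ext(2)) (use that calculation in \<open>auto simp: star_extensions_def\<close>)
  ultimately show "maximal_star (rec_urc ?V)"
    unfolding maximal_star_def by auto
  show "(\<lambda>s. g s $ i) \<in> rec_urc ?V"
    using ext(1) by (auto simp: star_extensions_def)
qed

lemma bounded_linear_axis: "bounded_linear (axis i :: 'a::real_normed_vector \<Rightarrow> 'a^'r)"
proof (rule bounded_linear_intro[where K = 1])
  fix x y :: 'a and c :: real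
  show "axis i (x + y) = axis i x + (axis i y :: 'a^'r)" "axis i (c *\<^sub>R x) = c *\<^sub>R (axis i x :: 'a^'r)"
    by (simp_all add: axis_def vec_eq_iff)
  have "norm (axis i x :: 'a^'r) \<le> (\<Sum>j\<in>UNIV. norm ((axis i x :: 'a^'r) $ j))"
    unfolding norm_vec_def by (rule L2_set_le_sum) simp
  also have "\<dots> = norm x"
    by (simp add: axis_def if_distrib[of norm] cong: if_cong)
  finally show "norm (axis i x :: 'a^'r) \<le> norm x * 1"
    by simp
qed

lemma C_urc_linear:
  fixes T :: "'a::banach \<Rightarrow> 'b::banach"
  assumes T: "bounded_linear T" and f: "f \<in> C_urc"
  shows "(\<lambda>t. T (f t)) \<in> C_urc"
proof (rule C_urcI)
  show "compact (T ` closure (range f))"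
    using C_urcD(2)[OF f] linear_continuous_on[OF T] by (intro compact_continuous_image)
  show "range (\<lambda>t. T (f t)) \<subseteq> T ` closure (range f)"
    using closure_subset[of "range f"] by blast
  show "uniformly_continuous_on UNIV (\<lambda>t. T (f t))"
    by (rule bounded_linear.uniformly_continuous_on[OF T C_urcD(1)[OF f]])
qed

lemma C_urc_sum:
  assumes "finite I" "\<And>i. i \<in> I \<Longrightarrow> f i \<in> C_urc"
  shows "(\<lambda>t. \<Sum>i\<in>I. f i t) \<in> (C_urc :: (real \<Rightarrow> 'b::banach) set)"
  using assms
proof (induction I rule: finite_induct)
  case empty
  show ?case
    by (rule C_urcI[of _ "{0}"]) (auto simp: uniformly_continuous_on_const)
qed (auto intro: C_urc_add)

lemma REC_urc_componentwise:
  fixes y :: "real \<Rightarrow> 'a::banach^'r"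
  assumes A: "maximal_star A" and y: "\<And>p. (\<lambda>t. y t $ p) \<in> A"
  shows "y \<in> REC_urc"
proof -
  have A': "condition_star A" "A \<noteq> {}"
    using A by (auto simp: maximal_star_def)
  have urc: "(\<lambda>t. y t $ p) \<in> C_urc" for p
    by (rule maximal_starD(1)[OF A y])
  have "(\<lambda>t. \<Sum>p\<in>UNIV. axis p (y t $ p)) \<in> C_urc"
    by (intro C_urc_sum C_urc_linear[OF bounded_linear_axis] urc) simp
  moreover have "(\<Sum>p\<in>UNIV. axis p (y t $ p)) = y t" for t
    by (simp add: vec_eq_iff axis_def cong: if_cong)
  ultimately have "y \<in> C_urc"
    by simp
  moreover have "REC_tuple UNIV (\<lambda>p t. y t $ p)"
    unfolding REC_tuple_def
  proof (intro conjI ballI allI impI)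
    show "continuous_on UNIV (\<lambda>t. y t $ p)" for p
      using C_urcD(1)[OF urc] uniformly_continuous_imp_continuous by blast
    fix K :: "real set" and e :: real assume "compact K \<and> e > 0"
    then have "relatively_dense (returns (range (\<lambda>p t. y t $ p)) K e)"
      using y by (intro condition_star_returns[OF A']) auto
    then show "relatively_dense {\<tau>. \<forall>t\<in>K. \<forall>p\<in>UNIV. norm (y (t + \<tau>) $ p - y t $ p) \<le> e}"
      by (rule relatively_dense_mono) (auto simp: returns_def)
  qed
  ultimately show ?thesis
    using REC_vec_iff by (auto simp: REC_urc_def)
qed

lemma matrix_scaleC_nth: "(B *v\<^sub>C x) $ i = (\<Sum>p\<in>UNIV. (B $ i $ p) *\<^sub>C (x $ p))"
  by (simp add: matrix_scaleC_def)

lemma window_nth: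
  fixes v :: "real \<Rightarrow> 'b::banach^'r"
  assumes "continuous_on UNIV v"
  shows "window (\<lambda>t. v t $ p) = (\<lambda>t. window v t $ p)"
  by (rule ext) (rule window_linear[OF bounded_linear_vec_nth assms])

lemma mean_one_eq_window: "continuous_on UNIV v \<Longrightarrow> mean 1 v = window v"
  using mean_continuous[of v 1] by (simp add: fun_eq_iff window_def)

text \<open>
  The first mean makes the equation hold everywhere, between continuous functions; \<open>n\<close> further means
  trade the remaining derivatives for differences.
\<close>
lemma averaged_equation:
  fixes y f :: "real \<Rightarrow> 'a::complex_banach^'r" and t :: "nat \<Rightarrow> real"
  assumes sol: "is_solution m n t a f y" and y: "\<And>p. (\<lambda>s. y s $ p) \<in> C_ub" "y \<in> L1loc" and f: "f \<in> L1loc"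
  shows "(window ^^ n) (\<lambda>s. mean 1 f s $ i) =
    (\<lambda>s. \<Sum>k=0..n. \<Sum>j=1..m. \<Sum>p\<in>UNIV. (a j k $ i $ p) *\<^sub>C
      (diff_shift 1 ^^ k) ((window ^^ (n + 1 - k)) (\<lambda>s. y s $ p)) (s + t j))"
proof -
  obtain D where D: "W1loc_derivs n y D"
    "AE s in lebesgue. (\<Sum>k=0..n. \<Sum>j=1..m. a j k *v\<^sub>C D k (s + t j)) = f s"
    using sol by (auto simp: is_solution_def)
  have y_cont: "continuous_on UNIV (\<lambda>s. y s $ p)" for p
    using C_ub_continuous[OF y(1) continuous_on_id] by simp
  then have "continuous_on UNIV (\<lambda>s. \<chi> p. y s $ p)"
    by (intro continuous_on_vec_lambda) auto
  then have cont_y: "continuous_on UNIV y"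
    by simp
  define E where "E = mean_derivs 1 y D"
  have E0: "E 0 = window y"
    by (simp add: E_def mean_one_eq_window[OF cont_y])
  have eq: "(\<Sum>k=0..n. \<Sum>j=1..m. a j k *v\<^sub>C E k (s + t j)) = mean 1 f s" for s
    unfolding E_def by (rule mean_equation[OF D(1) _ y(2) f D(2)]) simp
  have cont: "continuous_on UNIV (E k)" if "k \<le> n" for k
  proof (cases "n = 0")
    case True
    with that show ?thesis
      by (simp add: E0 window_continuous[OF cont_y])
  next
    case False
    with that show ?thesis
      unfolding E_def by (intro mean_derivs_continuous[OF D(1)]) auto
  qed
  have step: "window (E (Suc k)) = diff_shift 1 (E k)" if k: "k < n" for k
  proof
    fix s
    have "(E k has_vector_derivative E (Suc k) x) (at x)" for x
      unfolding E_def by (rule mean_derivs_has_derivative[OF D(1) _ k]) simp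
    then have "((\<lambda>x. E k (x + s)) has_vector_derivative E (Suc k) (x + s)) (at x)" for x
      by (rule has_vector_derivative_translate)
    then have "((\<lambda>x. E (Suc k) (x + s)) has_integral (E k (1 + s) - E k (0 + s))) {0..1}"
      by (intro fundamental_theorem_of_calculus) (auto intro: has_vector_derivative_at_within)
    then show "window (E (Suc k)) s = diff_shift 1 (E k) s"
      by (simp add: window_def diff_shift_def has_integral_iff add.commute)
  qed
  define d where "d p k s = E k s $ p" for p k s
  have d_cont: "continuous_on UNIV (d p k)" if "k \<le> n" for p k
    unfolding d_def[abs_def] using cont[OF that] by (intro continuous_intros)
  have d_step: "window (d p (Suc k)) = diff_shift 1 (d p k)" if "k < n" for p k
    using window_nth[OF cont, of "Suc k" p] step[OF that] that
    by (simp add: d_def[abs_def] diff_shift_def[abs_def])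
  have d0: "d p 0 = window (\<lambda>s. y s $ p)" for p
    by (simp add: d_def[abs_def] E0 window_nth[OF cont_y])
  have d_eq: "(window ^^ n) (d p k) = (diff_shift 1 ^^ k) ((window ^^ (n + 1 - k)) (\<lambda>s. y s $ p))" if "k \<le> n" for p k
  proof -
    have "(window ^^ n) (d p k) = (diff_shift 1 ^^ k) ((window ^^ (n - k)) (d p 0))"
      using window_funpow_derivs[of n "d p" k n] d_cont d_step that by simp
    also have "(window ^^ (n - k)) (d p 0) = (window ^^ Suc (n - k)) (\<lambda>s. y s $ p)"
      unfolding d0 by (simp add: funpow_swap1)
    also have "Suc (n - k) = n + 1 - k"
      using that by simp
    finally show ?thesis .
  qed
  let ?I = "{0..n} \<times> {1..m} \<times> (UNIV :: 'r set)"
  have "(\<lambda>s. mean 1 f s $ i) = (\<lambda>s. \<Sum>(k, j, p)\<in>?I. (a j k $ i $ p) *\<^sub>C d p k (s + t j))"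
  proof
    fix s
    have "mean 1 f s $ i = (\<Sum>k=0..n. \<Sum>j=1..m. \<Sum>p\<in>UNIV. (a j k $ i $ p) *\<^sub>C d p k (s + t j))"
      by (simp add: eq[symmetric] matrix_scaleC_nth d_def)
    then show "mean 1 f s $ i = (\<Sum>(k, j, p)\<in>?I. (a j k $ i $ p) *\<^sub>C d p k (s + t j))"
      by (simp only: sum.cartesian_product)
  qed
  then have "(window ^^ n) (\<lambda>s. mean 1 f s $ i)
      = (window ^^ n) (\<lambda>s. \<Sum>x\<in>?I. (a (fst (snd x)) (fst x) $ i $ snd (snd x)) *\<^sub>C d (snd (snd x)) (fst x) (s + t (fst (snd x))))"
    by (simp add: case_prod_beta)
  also have "\<dots> = (\<lambda>s. \<Sum>x\<in>?I. (a (fst (snd x)) (fst x) $ i $ snd (snd x)) *\<^sub>C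
      (window ^^ n) (d (snd (snd x)) (fst x)) (s + t (fst (snd x))))"
    by (rule window_funpow_lincomb) (auto intro: d_cont)
  also have "\<dots> = (\<lambda>s. \<Sum>k=0..n. \<Sum>j=1..m. \<Sum>p\<in>UNIV. (a j k $ i $ p) *\<^sub>C
      (window ^^ n) (d p k) (s + t j))"
    by (simp add: sum.cartesian_product case_prod_beta)
  also have "\<dots> = (\<lambda>s. \<Sum>k=0..n. \<Sum>j=1..m. \<Sum>p\<in>UNIV. (a j k $ i $ p) *\<^sub>C
      (diff_shift 1 ^^ k) ((window ^^ (n + 1 - k)) (\<lambda>s. y s $ p)) (s + t j))"
    by (intro ext sum.cong refl) (simp add: d_eq)
  finally show ?thesis .
qed

text \<open>
  The \<open>i\<close>-th row of the averaged equation, convolved with \<open>FT \<psi>\<close>.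
\<close>
lemma symbol_convolution:
  fixes y f :: "real \<Rightarrow> 'a::complex_banach^'r" and t :: "nat \<Rightarrow> real"
  assumes sol: "is_solution m n t a f y" and y: "\<And>p. (\<lambda>s. y s $ p) \<in> C_ub" "y \<in> L1loc" and f: "f \<in> L1loc"
    and A: "invariant_space A" and g: "(\<lambda>s. mean 1 f s $ i) \<in> A" and \<psi>: "test_fun \<psi>"
  shows "(\<lambda>s. \<Sum>p\<in>UNIV. conv (FT (\<lambda>l. symbol m n t a (of_real l) $ i $ p * \<psi> l)) (\<lambda>s. y s $ p) s) \<in> A"
proof -
  let ?g = "\<lambda>s. mean 1 f s $ i"
  let ?v = "\<lambda>k p. (diff_shift 1 ^^ k) ((window ^^ (n + 1 - k)) (\<lambda>s. y s $ p))"
  have g_ub: "?g \<in> C_ub"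
    by (rule invariant_spaceD(2)[OF A g])
  have ms: "test_fun (\<lambda>l. mean_symbol (of_real l) ^ n * \<psi> l)"
    by (intro test_fun_mult[OF \<psi>] smooth_power smooth_mean_symbol)
  have v_ub: "(\<lambda>s. ?v k p (s + c)) \<in> C_ub" for k p c
    by (intro C_ub_translate C_ub_diff_shift_funpow C_ub_window_funpow y)
  have cv_ub: "(\<lambda>s. z *\<^sub>C ?v k p (s + c)) \<in> C_ub" for k p c z
    by (rule invariant_spaceD(4)[OF invariant_space_C_ub v_ub])
  have entry: "test_fun (\<lambda>l. symbol_entry n k c l * \<psi> l)" for k c
    by (rule test_fun_mult[OF \<psi> smooth_symbol_entry])
  have pointwise: "conv (FT (\<lambda>l. mean_symbol (of_real l) ^ n * \<psi> l)) ?g s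
      = (\<Sum>p\<in>UNIV. conv (FT (\<lambda>l. symbol m n t a (of_real l) $ i $ p * \<psi> l)) (\<lambda>s. y s $ p) s)" for s
  proof -
    have "conv (FT (\<lambda>l. mean_symbol (of_real l) ^ n * \<psi> l)) ?g s = conv (FT \<psi>) ((window ^^ n) ?g) s"
      by (rule conv_FT_window_funpow[OF g_ub \<psi>, symmetric])
    also have "\<dots> = (\<Sum>k=0..n. \<Sum>j=1..m. \<Sum>p\<in>UNIV. conv (FT \<psi>) (\<lambda>s. (a j k $ i $ p) *\<^sub>C ?v k p (s + t j)) s)"
    proof -
      have 1: "(\<lambda>s. \<Sum>p\<in>UNIV. (a j k $ i $ p) *\<^sub>C ?v k p (s + t j)) \<in> C_ub" for j k
        by (intro invariant_space_sum[OF invariant_space_C_ub] cv_ub)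
      have 2: "(\<lambda>s. \<Sum>j=1..m. \<Sum>p\<in>UNIV. (a j k $ i $ p) *\<^sub>C ?v k p (s + t j)) \<in> C_ub" for k
        by (intro invariant_space_sum[OF invariant_space_C_ub] 1)
      show ?thesis
        unfolding averaged_equation[OF sol y f, of i]
        by (simp add: conv_sum[OF FT_decaying[OF \<psi>]] 1 2 cv_ub del: One_nat_def)
    qed
    also have "\<dots> = (\<Sum>k=0..n. \<Sum>j=1..m. \<Sum>p\<in>UNIV.
        conv (FT (\<lambda>l. (a j k $ i $ p) * (symbol_entry n k (t j) l * \<psi> l))) (\<lambda>s. y s $ p) s)"
    proof (intro sum.cong refl)
      fix k j p
      have "conv (FT \<psi>) (\<lambda>s. (a j k $ i $ p) *\<^sub>C ?v k p (s + t j)) s = (a j k $ i $ p) *\<^sub>C conv (FT \<psi>) (\<lambda>s. ?v k p (s + t j)) s"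
        by (rule conv_scaleC[OF FT_decaying[OF \<psi>] v_ub])
      also have "\<dots> = (a j k $ i $ p) *\<^sub>C conv (FT (\<lambda>l. symbol_entry n k (t j) l * \<psi> l)) (\<lambda>s. y s $ p) s"
        by (simp only: conv_FT_symbol_entry[OF \<psi> y(1)])
      also have "\<dots> = conv (FT (\<lambda>l. (a j k $ i $ p) * (symbol_entry n k (t j) l * \<psi> l))) (\<lambda>s. y s $ p) s"
        by (rule conv_FT_cmult[OF entry y(1), symmetric])
      finally show "conv (FT \<psi>) (\<lambda>s. (a j k $ i $ p) *\<^sub>C ?v k p (s + t j)) s
          = conv (FT (\<lambda>l. (a j k $ i $ p) * (symbol_entry n k (t j) l * \<psi> l))) (\<lambda>s. y s $ p) s" .
    qed
    also have "\<dots> = (\<Sum>p\<in>UNIV. \<Sum>x\<in>{0..n} \<times> {1..m}.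
        conv (FT (\<lambda>l. (a (snd x) (fst x) $ i $ p) * (symbol_entry n (fst x) (t (snd x)) l * \<psi> l))) (\<lambda>s. y s $ p) s)"
    proof -
      have "(\<Sum>k=0..n. \<Sum>j=1..m. G k j) = (\<Sum>x\<in>{0..n} \<times> {1..m}. G (fst x) (snd x))" for G :: "nat \<Rightarrow> nat \<Rightarrow> 'a"
        by (simp add: sum.cartesian_product case_prod_beta)
      then show ?thesis
        by (simp only:) (rule sum.swap)
    qed
    also have "\<dots> = (\<Sum>p\<in>UNIV. conv (FT (\<lambda>l. symbol m n t a (of_real l) $ i $ p * \<psi> l)) (\<lambda>s. y s $ p) s)"
    proof (rule sum.cong[OF refl])
      fix p
      have "symbol m n t a (of_real l) $ i $ p * \<psi> l = (\<Sum>x\<in>{0..n} \<times> {1..m}. (a (snd x) (fst x) $ i $ p) * (symbol_entry n (fst x) (t (snd x)) l * \<psi> l))" for l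
        by (simp add: symbol_of_real sum.cartesian_product case_prod_beta sum_distrib_right mult.assoc)
      moreover have "conv (FT (\<lambda>l. \<Sum>x\<in>{0..n} \<times> {1..m}. (a (snd x) (fst x) $ i $ p) * (symbol_entry n (fst x) (t (snd x)) l * \<psi> l))) (\<lambda>s. y s $ p) s
          = (\<Sum>x\<in>{0..n} \<times> {1..m}. conv (FT (\<lambda>l. (a (snd x) (fst x) $ i $ p) * (symbol_entry n (fst x) (t (snd x)) l * \<psi> l))) (\<lambda>s. y s $ p) s)"
        by (rule conv_FT_sum[THEN conjunct2]) (auto intro: test_fun_mult[OF entry smooth_const] y)
      ultimately show "(\<Sum>x\<in>{0..n} \<times> {1..m}. conv (FT (\<lambda>l. (a (snd x) (fst x) $ i $ p) * (symbol_entry n (fst x) (t (snd x)) l * \<psi> l))) (\<lambda>s. y s $ p) s)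
          = conv (FT (\<lambda>l. symbol m n t a (of_real l) $ i $ p * \<psi> l)) (\<lambda>s. y s $ p) s"
        by simp
    qed
    finally show ?thesis .
  qed
  have "conv (FT (\<lambda>l. mean_symbol (of_real l) ^ n * \<psi> l)) ?g \<in> A"
    by (rule invariant_space_conv[OF A g FT_decaying[OF ms]])
  also have "conv (FT (\<lambda>l. mean_symbol (of_real l) ^ n * \<psi> l)) ?g
      = (\<lambda>s. \<Sum>p\<in>UNIV. conv (FT (\<lambda>l. symbol m n t a (of_real l) $ i $ p * \<psi> l)) (\<lambda>s. y s $ p) s)"
    by (rule ext) (rule pointwise)
  finally show ?thesis .
qed

text \<open>
  Row \<open>i\<close> is used with the cofactor \<open>(q, i)\<close> absorbed into \<open>\<psi>\<close>, and the rows are added up.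
\<close>
lemma det_convolution:
  fixes y f :: "real \<Rightarrow> 'a::complex_banach^'r" and t :: "nat \<Rightarrow> real"
  assumes sol: "is_solution m n t a f y" and y: "\<And>p. (\<lambda>s. y s $ p) \<in> C_ub" "y \<in> L1loc" and f: "f \<in> L1loc"
    and A: "invariant_space A" and g: "\<And>i. (\<lambda>s. mean 1 f s $ i) \<in> A" and \<psi>: "test_fun \<psi>"
  shows "conv (FT (\<lambda>l. det (symbol m n t a (of_real l)) * \<psi> l)) (\<lambda>s. y s $ q) \<in> A"
proof -
  let ?Q = "\<lambda>l::real. symbol m n t a (of_real l)"
  have smooth_cof: "smooth (\<lambda>l. cofactor (?Q l) q i)" for i
    using smooth_entire[OF holomorphic_cofactor[OF symbol_holomorphic]] .
  have smooth_Q: "smooth (\<lambda>l. ?Q l $ i $ p)" for i p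
    using smooth_entire[OF symbol_holomorphic] .
  have \<psi>i: "test_fun (\<lambda>l. cofactor (?Q l) q i * \<psi> l)" for i
    by (rule test_fun_mult[OF \<psi> smooth_cof])
  have Q\<psi>i: "test_fun (\<lambda>l. ?Q l $ i $ p * (cofactor (?Q l) q i * \<psi> l))" for i p
    by (rule test_fun_mult[OF \<psi>i smooth_Q])
  have "(\<lambda>s. \<Sum>i\<in>UNIV. \<Sum>p\<in>UNIV. conv (FT (\<lambda>l. ?Q l $ i $ p * (cofactor (?Q l) q i * \<psi> l))) (\<lambda>s. y s $ p) s) \<in> A"
    by (intro invariant_space_sum[OF A] symbol_convolution[OF sol y f A g \<psi>i])
  moreover have "(\<Sum>i\<in>UNIV. \<Sum>p\<in>UNIV. conv (FT (\<lambda>l. ?Q l $ i $ p * (cofactor (?Q l) q i * \<psi> l))) (\<lambda>s. y s $ p) s)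
      = conv (FT (\<lambda>l. det (?Q l) * \<psi> l)) (\<lambda>s. y s $ q) s" for s
  proof -
    have "(\<Sum>i\<in>UNIV. \<Sum>p\<in>UNIV. conv (FT (\<lambda>l. ?Q l $ i $ p * (cofactor (?Q l) q i * \<psi> l))) (\<lambda>s. y s $ p) s)
        = (\<Sum>p\<in>UNIV. \<Sum>i\<in>UNIV. conv (FT (\<lambda>l. ?Q l $ i $ p * (cofactor (?Q l) q i * \<psi> l))) (\<lambda>s. y s $ p) s)"
      by (rule sum.swap)
    also have "\<dots> = (\<Sum>p\<in>UNIV. if p = q then conv (FT (\<lambda>l. det (?Q l) * \<psi> l)) (\<lambda>s. y s $ q) s else 0)"
    proof (rule sum.cong[OF refl])
      fix p
      have "(\<Sum>i\<in>UNIV. conv (FT (\<lambda>l. ?Q l $ i $ p * (cofactor (?Q l) q i * \<psi> l))) (\<lambda>s. y s $ p) s)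
          = conv (FT (\<lambda>l. \<Sum>i\<in>UNIV. ?Q l $ i $ p * (cofactor (?Q l) q i * \<psi> l))) (\<lambda>s. y s $ p) s"
        using conv_FT_sum[of UNIV "\<lambda>i l. ?Q l $ i $ p * (cofactor (?Q l) q i * \<psi> l)" "\<lambda>s. y s $ p" s] Q\<psi>i y(1) by simp
      also have "(\<lambda>l. \<Sum>i\<in>UNIV. ?Q l $ i $ p * (cofactor (?Q l) q i * \<psi> l)) = (\<lambda>l. (if p = q then det (?Q l) else 0) * \<psi> l)"
        unfolding cofactor_sum[symmetric] by (simp add: sum_distrib_right mult.assoc)
      finally show "(\<Sum>i\<in>UNIV. conv (FT (\<lambda>l. ?Q l $ i $ p * (cofactor (?Q l) q i * \<psi> l))) (\<lambda>s. y s $ p) s)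
          = (if p = q then conv (FT (\<lambda>l. det (?Q l) * \<psi> l)) (\<lambda>s. y s $ q) s else 0)"
        by (simp add: conv_FT_zero)
    qed
    also have "\<dots> = conv (FT (\<lambda>l. det (?Q l) * \<psi> l)) (\<lambda>s. y s $ q) s"
      by simp
    finally show ?thesis .
  qed
  ultimately show ?thesis
    by simp
qed

lemma mean_class_pow_L1loc: "mean_class_pow l A \<subseteq> L1loc"
  by (cases l) (auto simp: mean_class_def)

theorem theorem5p1:
  fixes m n l :: nat
    and t :: "nat \<Rightarrow> real"
    and a :: "nat \<Rightarrow> nat \<Rightarrow> complex^'r^'r"
    and U :: "(real \<Rightarrow> 'a::complex_banach) set"
    and rec_urc :: "(real \<Rightarrow> 'a) set \<Rightarrow> (real \<Rightarrow> 'a) set"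
    and y f :: "real \<Rightarrow> 'a^'r"
  assumes m: "m \<ge> 1"
    and t: "strict_mono_on {1..m} t"
    and det: "\<exists>s::real. det (\<chi> p q. \<Sum>j=1..m. (a j n $ p $ q) * exp (\<i> * of_real (t j * s))) \<noteq> 0"
    and U: "U \<subseteq> L1loc"
    and U_char: "\<And>\<omega> u. u \<in> U \<inter> C_ub \<Longrightarrow> (\<lambda>s. gamma_char \<omega> s *\<^sub>C u s) \<in> U"
    and U_conv: "\<And>u \<phi>. u \<in> U \<inter> C_ub \<Longrightarrow> \<phi> \<in> schwartz \<Longrightarrow> convolution u \<phi> \<in> U"
    and rec_urc: "rec_urc_selection rec_urc"
    and U_L: "\<And>g :: real \<Rightarrow> 'a^'r. g \<in> REC_urc \<Longrightarrow>
      satisfies_L U (rec_urc (range (\<lambda>i s. g s $ i)))"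
    and sol: "is_solution m n t a f y"
    and f: "f \<in> mean_class_pow (l + 1) REC_urc"
    and y: "y \<in> mean_class_pow l (C_ub \<inter> componentwise U)"
  shows "y \<in> mean_class_pow l REC_urc"
  using sol f y
proof (induction l arbitrary: y f)
  case 0
  define g where "g = mean 1 f"
  have f: "f \<in> L1loc" and g: "g \<in> REC_urc" and y: "y \<in> L1loc" "y \<in> C_ub" "y \<in> componentwise U"
    using 0 by (auto simp: mean_class_def g_def)
  have y_ub: "(\<lambda>s. y s $ p) \<in> C_ub" for p
  proof -
    have "uniformly_continuous_on UNIV (\<lambda>s. y s $ p)"
      using y(2) by (intro bounded_linear.uniformly_continuous_on[OF bounded_linear_vec_nth]) (auto simp: C_ub_def)
    moreover obtain B where "\<forall>s. norm (y s) \<le> B"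
      using y(2) by (auto simp: C_ub_def bounded_iff)
    then have "norm (y s $ p) \<le> B" for s
      using order_trans[OF Finite_Cartesian_Product.norm_nth_le] by blast
    ultimately show ?thesis
      by (auto simp: C_ub_def bounded_iff)
  qed
  let ?A = "rec_urc (range (\<lambda>i s. g s $ i))"
  have A: "maximal_star ?A" "\<And>i. (\<lambda>s. g s $ i) \<in> ?A"
    using maximal_star_rec_urc[OF rec_urc g] by auto
  have "(\<lambda>s. y s $ p) \<in> ?A" for p
  proof (rule scalar_regularity[OF A(1) U_L[OF g] U_char U_conv])
    show "(\<lambda>s. y s $ p) \<in> U" "(\<lambda>s. y s $ p) \<in> C_ub"
      using y(3) y_ub by (auto simp: componentwise_def)
    show "(\<lambda>z. det (symbol m n t a z)) holomorphic_on UNIV"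
      by (rule holomorphic_det[OF symbol_holomorphic])
    show "\<exists>z. det (symbol m n t a z) \<noteq> 0"
      by (rule det_symbol_nonzero[where m = m and n = n and t = t and a = a, OF det])
    show "conv (FT (\<lambda>l. det (symbol m n t a (of_real l)) * \<psi> l)) (\<lambda>s. y s $ p) \<in> ?A" if "test_fun \<psi>" for \<psi>
      using det_convolution[OF 0(1) y_ub y(1) f invariant_space_maximal_star[OF A(1)] _ that] A(2)
      by (simp add: g_def)
  qed
  then have "y \<in> REC_urc"
    by (rule REC_urc_componentwise[OF A(1)])
  with y(1) show ?case
    by simp
next
  case (Suc l)
  have y: "y \<in> L1loc" "\<And>h. h > 0 \<Longrightarrow> mean h y \<in> mean_class_pow l (C_ub \<inter> componentwise U)"
    using Suc.prems(3) by (auto simp: mean_class_def)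
  have f: "f \<in> L1loc" "\<And>h. h > 0 \<Longrightarrow> mean h f \<in> mean_class_pow (l + 1) REC_urc"
    using Suc.prems(2) by (auto simp: mean_class_def)
  have "mean h y \<in> mean_class_pow l REC_urc" if h: "h > 0" for h
  proof (rule Suc.IH[OF _ f(2)[OF h] y(2)[OF h]])
    show "is_solution m n t a (mean h f) (mean h y)"
      using is_solution_mean[OF Suc.prems(1) h y(1) _ f(1)] y(2)[OF h] mean_class_pow_L1loc by blast
  qed
  with y(1) show ?case
    by (simp add: mean_class_def)
qed

end
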